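(* Consider the nominal adaptive stochastic shortest path problem described in the context, with risk function $f:\mathbb{R}\to\mathbb{R}$. Case 1: Suppose there exists $T_1\in\mathbb{R}$ such that either (a) $f$ is increasing, concave and $C^2$ on $(-\infty,T_1)$ and $f''(t)/f'(t)\to 0$ as $t\to-\infty$; or (b) $f$ is $C^1$ on $(-\infty,T_1)$ and $\lim_{t\to-\infty} f'(t)$ exists, is positive and is finite. Then there exists $T_f\in\mathbb{R}$ such that, for any initial budget $T\ge 0$, every optimal strategy $\pi^*$ for the problem $\sup_{\pi\in\Pi}\mathbb{E}[f(T-X_\pi)]$ has the following property: at every history at which the current node is $i\neq d$ and the total cost spent so far is larger than $T-T_f$, the next node chosen by $\pi^*$ belongs to $\mathcal{T}(i)$ (i.e. $\pi^*$ follows the shortest-path tree with respect to the mean arc costs). Case 2: If there exists $T_f$ such that the support of $f$ is included in $[T_f,\infty)$, then following $\mathcal{T}$ (i.e. always moving from the current node $i$ to a node of $\mathcal{T}(i)$) is optimal as soon as the total cost spent so far is larger than $T-T_f$.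
   Context: Let $\mathcal{G}=(\mathcal{V},\mathcal{A})$ be a finite directed graph with a source $s$ and destination $d$; write $\mathcal{V}(i)=\{j:(i,j)\in\mathcal{A}\}$. Each arc $(i,j)$ has a random non-negative cost $c_{ij}$ with distribution $p_{ij}$; every time the arc is crossed, its cost is a fresh realization, and all these realizations are independent (across arcs and across crossings) and their distribution does not depend on the total cost already spent. Each $p_{ij}$ has support in $[\delta^{\inf}_{ij},\delta^{\sup}_{ij}]$ with $0<\delta^{\inf}_{ij}\le\delta^{\sup}_{ij}<\infty$. A user starts at $s$ with budget $T$ and travels along arcs until reaching $d$; the cost of an arc is observed after it is crossed. $\Pi$ is the set of history-dependent randomized strategies: maps from histories (previously visited nodes and previously realized costs), ending at a node $i\neq d$, to probability distributions over $\mathcal{V}(i)$. $X_\pi$ is the total random cost incurred by strategy $\pi$ from $s$ until reaching $d$. The nominal problem is $\sup_{\pi\in\Pi}\mathbb{E}[f(T-X_\pi)]$; the remaining budget at a history is $T$ minus the total cost spent so far. Let $m_{ij}=\mathbb{E}[c_{ij}]$, let $M_i$ be the length of a shortest path from $i$ to $d$ with arc lengths $m_{ij}$ (it is implicitly assumed that $d$ is reachable from every node), and let $\mathcal{T}(i)=\{j\in\mathcal{V}(i): m_{ij}+M_j=M_i\}$ be the set of immediate successors of $i$ in the shortest-path tree $\mathcal{T}$ rooted at $d$ with respect to the mean arc costs.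
   Formalization: In Case 1, "at every history" is proved almost surely along the strategy's trajectories, and at each single history where the rest of the strategy is optimal for the remaining budget; "optimal" means attaining a finite supremum. Literally, the claim fails on null histories or infinite suprema. *)

theory Defs
  imports "HOL-Probability.Probability" "Graph_Theory.Graph_Theory"
begin

text \<open>
  A history starting at a node \<open>v\<close> is the list of the moves made so far, a move being the node
  moved to together with the realized cost of the arc that was crossed; \<open>v\<close> itself is not
  stored.  A trajectory is an infinite sequence of moves.
\<close>

type_synonym 'v move = "'v \<times> real"
type_synonym 'v strategy = "'v move list \<Rightarrow> 'v pmf"

definition cur_node :: "'v \<Rightarrow> 'v move list \<Rightarrow> 'v" where
  "cur_node v h = (if h = [] then v else fst (last h))"

definition spent :: "'v move list \<Rightarrow> real" where
  "spent h = sum_list (map snd h)"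

definition hist :: "nat \<Rightarrow> (nat \<Rightarrow> 'v move) \<Rightarrow> 'v move list" where
  "hist n \<omega> = map \<omega> [0..<n]"

text \<open>The strategy that remains to be played, from node \<open>cur_node v h\<close>, after history \<open>h\<close>.\<close>

definition continuation :: "'v strategy \<Rightarrow> 'v move list \<Rightarrow> 'v strategy" where
  "continuation \<pi> h = (\<lambda>h'. \<pi> (h @ h'))"

text \<open>
  The destination is absorbing at cost 0 (see \<open>step\<close> below), so summing over all moves gives the
  cost until the destination is reached; the sum is infinite if it is never reached.
\<close>

definition total_cost :: "(nat \<Rightarrow> 'v move) \<Rightarrow> ennreal" where
  "total_cost \<omega> = (\<Sum>n. ennreal (snd (\<omega> n)))"

text \<open>
  \<open>f (T - X)\<close>, with \<open>f (-\<infinity>)\<close> read as the limit of \<open>f\<close> at \<open>-\<infinity>\<close> (the lower limit, should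
  there be no limit).  This matters only on trajectories that never reach the destination.
\<close>

definition payoff :: "(real \<Rightarrow> real) \<Rightarrow> real \<Rightarrow> (nat \<Rightarrow> 'v move) \<Rightarrow> ereal" where
  "payoff f T \<omega> =
     (if total_cost \<omega> = \<infinity> then Liminf at_bot (\<lambda>t. ereal (f t))
      else ereal (f (T - enn2real (total_cost \<omega>))))"

locale adaptive_ssp = pair_fin_digraph G for G :: "'v pair_pre_digraph" +
  fixes s d :: 'v
    and p :: "'v \<times> 'v \<Rightarrow> real measure"
    and \<delta>_inf \<delta>_sup :: "'v \<times> 'v \<Rightarrow> real"
  assumes source_in_verts: "s \<in> pverts G"
    and dest_in_verts: "d \<in> pverts G"
    and dest_reachable: "\<And>i. i \<in> pverts G \<Longrightarrow> i \<rightarrow>\<^sup>*\<^bsub>with_proj G\<^esub> d"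
    and prob_space_p: "\<And>e. e \<in> parcs G \<Longrightarrow> prob_space (p e)"
    and sets_p: "\<And>e. e \<in> parcs G \<Longrightarrow> sets (p e) = sets borel"
    and \<delta>_inf_pos: "\<And>e. e \<in> parcs G \<Longrightarrow> 0 < \<delta>_inf e"
    and \<delta>_inf_le_sup: "\<And>e. e \<in> parcs G \<Longrightarrow> \<delta>_inf e \<le> \<delta>_sup e"
    and p_support: "\<And>e. e \<in> parcs G \<Longrightarrow> AE c in p e. \<delta>_inf e \<le> c \<and> c \<le> \<delta>_sup e"
begin

definition succs :: "'v \<Rightarrow> 'v set" where
  "succs i = {j. (i, j) \<in> parcs G}"

definition mean_cost :: "'v \<times> 'v \<Rightarrow> real" where
  "mean_cost e = (\<integral>c. c \<partial>p e)"

definition sp_tree :: "'v \<Rightarrow> 'v set" where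
  "sp_tree i = {j \<in> succs i. ereal (mean_cost (i, j)) + \<mu> mean_cost j d = \<mu> mean_cost i d}"

text \<open>Histories that can occur from \<open>v\<close>: the destination is not left once it is reached.\<close>

definition history :: "'v \<Rightarrow> 'v move list \<Rightarrow> bool" where
  "history v h \<longleftrightarrow> (\<forall>k<length h.
     let e = (cur_node v (take k h), fst (h ! k))
     in fst e \<noteq> d \<and> e \<in> parcs G \<and> snd (h ! k) \<in> {\<delta>_inf e..\<delta>_sup e})"

definition move_space :: "'v move measure" where
  "move_space = count_space (pverts G) \<Otimes>\<^sub>M borel"

text \<open>
  A strategy is a total function on lists of moves.  Its values on lists that are not histories
  have no effect; requiring them to be supported on the successors of the last node only makes
  the transition kernel below well-defined everywhere.  The second condition is measurability
  in the realized costs, for each sequence of visited nodes.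
\<close>

definition strategy :: "'v \<Rightarrow> 'v strategy \<Rightarrow> bool" where
  "strategy v \<pi> \<longleftrightarrow>
     (\<forall>h. cur_node v h \<in> pverts G \<and> cur_node v h \<noteq> d \<longrightarrow> set_pmf (\<pi> h) \<subseteq> succs (cur_node v h)) \<and>
     (\<forall>n j. (\<lambda>\<omega>. pmf (\<pi> (hist n \<omega>)) j) \<in> borel_measurable (\<Pi>\<^sub>M k\<in>{0..<n}. move_space))"

text \<open>
  Law of the next move given the moves so far: the next node is drawn from the strategy, then the
  cost of the arc is drawn afresh.  The null measure covers only nodes that are chosen with
  probability 0.
\<close>

definition step :: "'v \<Rightarrow> 'v strategy \<Rightarrow> nat \<Rightarrow> (nat \<Rightarrow> 'v move) \<Rightarrow> 'v move measure" where
  "step v \<pi> n \<omega> =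
     (let h = hist n \<omega>; i = cur_node v h
      in if i = d then return move_space (d, 0)
         else measure_pmf (\<pi> h) \<bind>
           (\<lambda>j. if (i, j) \<in> parcs G then distr (p (i, j)) move_space (Pair j)
                else null_measure move_space))"

text \<open>The hypotheses of the Ionescu-Tulcea extension theorem are met.\<close>

lemma Ionescu_Tulcea_step:
  assumes v: "v \<in> pverts G" and strat: "strategy v \<pi>"
  shows "Ionescu_Tulcea (step v \<pi>) (\<lambda>_. move_space)"
proof -
  let ?K = "\<lambda>i j. if (i, j) \<in> parcs G then distr (p (i, j)) move_space (Pair j)
                   else null_measure move_space"
  have sp: "space move_space = pverts G \<times> UNIV"
    by (simp add: move_space_def space_pair_measure)
  have Pair_meas: "Pair j \<in> measurable (p (i, j)) move_space" if "(i, j) \<in> parcs G" for i j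
  proof -
    have "j \<in> pverts G" using arc_snd_in_verts[OF that] by simp
    then show ?thesis
      unfolding move_space_def measurable_cong_sets[OF sets_p[OF that] refl]
      by (intro measurable_Pair measurable_const measurable_ident) simp_all
  qed
  have K_prob: "prob_space (?K i j)" if "(i, j) \<in> parcs G" for i j
    using that prob_space.prob_space_distr[OF prob_space_p Pair_meas] by simp
  have K_sub: "?K i j \<in> space (subprob_algebra move_space)" for i j
  proof (cases "(i, j) \<in> parcs G")
    case True
    then show ?thesis using K_prob[OF True] by (simp add: space_subprob_algebra prob_space_imp_subprob_space)
  next
    case False
    have "subprob_space (null_measure move_space)"
      using dest_in_verts by (intro subprob_spaceI) (auto simp: sp)
    with False show ?thesis by (simp add: space_subprob_algebra)
  qed
  have K_meas: "?K i \<in> measurable (measure_pmf (\<pi> h)) (subprob_algebra move_space)" for i h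
    using K_sub by (auto simp: measurable_def)
  have cur: "(\<lambda>\<omega>. cur_node v (hist n \<omega>)) \<in>
      measurable (\<Pi>\<^sub>M k\<in>{0..<n}. move_space) (count_space (pverts G))" for n
  proof (cases n)
    case 0
    then show ?thesis using v by (simp add: cur_node_def hist_def)
  next
    case (Suc m)
    have "(\<lambda>\<omega>. \<omega> m) \<in> measurable (\<Pi>\<^sub>M k\<in>{0..<n}. move_space) move_space"
      using Suc by (intro measurable_component_singleton) auto
    then have "(\<lambda>\<omega>. fst (\<omega> m)) \<in>
        measurable (\<Pi>\<^sub>M k\<in>{0..<n}. move_space) (count_space (pverts G))"
      unfolding move_space_def by measurable
    then show ?thesis using Suc by (simp add: cur_node_def hist_def)
  qed
  have supp: "set_pmf (\<pi> (hist n \<omega>)) \<subseteq> succs (cur_node v (hist n \<omega>))"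
    if "\<omega> \<in> space (\<Pi>\<^sub>M k\<in>{0..<n}. move_space)" "cur_node v (hist n \<omega>) \<noteq> d" for n \<omega>
    using strat measurable_space[OF cur that(1)] that(2) by (simp add: strategy_def)
  have step_prob: "prob_space (step v \<pi> n \<omega>)"
    if \<omega>: "\<omega> \<in> space (\<Pi>\<^sub>M k\<in>{0..<n}. move_space)" for n \<omega>
  proof (cases "cur_node v (hist n \<omega>) = d")
    case True
    then show ?thesis using dest_in_verts by (simp add: step_def sp prob_space_return)
  next
    case False
    have "AE j in measure_pmf (\<pi> (hist n \<omega>)). prob_space (?K (cur_node v (hist n \<omega>)) j)"
      using supp[OF \<omega> False] K_prob by (auto simp: AE_measure_pmf_iff succs_def)
    from prob_space.prob_space_bind[OF measure_pmf.prob_space_axioms this K_meas] False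
    show ?thesis by (simp add: step_def Let_def)
  qed
  have step_sets: "sets (step v \<pi> n \<omega>) = sets move_space" for n \<omega>
    by (auto simp: step_def Let_def intro!: sets_bind)
  have "step v \<pi> n \<in> measurable (\<Pi>\<^sub>M k\<in>{0..<n}. move_space) (subprob_algebra move_space)" for n
  proof (rule measurable_subprob_algebra)
    let ?N = "\<Pi>\<^sub>M k\<in>{0..<n}. move_space"
    fix A assume A: "A \<in> sets move_space"
    let ?i = "\<lambda>\<omega>. cur_node v (hist n \<omega>)"
    have "emeasure (step v \<pi> n \<omega>) A =
        (if ?i \<omega> = d then indicator A (d, 0)
         else \<Sum>j\<in>pverts G. emeasure (?K (?i \<omega>) j) A * ennreal (pmf (\<pi> (hist n \<omega>)) j))"
      if \<omega>: "\<omega> \<in> space ?N" for \<omega>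
    proof (cases "?i \<omega> = d")
      case True
      then show ?thesis using A by (simp add: step_def)
    next
      case False
      have "set_pmf (\<pi> (hist n \<omega>)) \<subseteq> pverts G"
        using supp[OF \<omega> False] arc_snd_in_verts by (fastforce simp: succs_def)
      then have "(\<integral>\<^sup>+j. emeasure (?K (?i \<omega>) j) A \<partial>\<pi> (hist n \<omega>)) =
          (\<Sum>j\<in>pverts G. emeasure (?K (?i \<omega>) j) A * ennreal (pmf (\<pi> (hist n \<omega>)) j))"
        using pair_finite_verts
        by (intro nn_integral_measure_pmf_support) (auto simp: set_pmf_iff)
      moreover have "emeasure (step v \<pi> n \<omega>) A = (\<integral>\<^sup>+j. emeasure (?K (?i \<omega>) j) A \<partial>\<pi> (hist n \<omega>))"
        using False emeasure_bind[OF _ K_meas A] by (simp add: step_def Let_def)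
      ultimately show ?thesis using False by simp
    qed
    moreover have "(\<lambda>\<omega>. if ?i \<omega> = d then indicator A (d, 0)
         else \<Sum>j\<in>pverts G. emeasure (?K (?i \<omega>) j) A * ennreal (pmf (\<pi> (hist n \<omega>)) j))
        \<in> borel_measurable ?N" (is "?g \<in> _")
    proof -
      have [measurable]: "(\<lambda>\<omega>. pmf (\<pi> (hist n \<omega>)) j) \<in> borel_measurable ?N" for j
        using strat by (simp add: strategy_def)
      have [measurable]: "(\<lambda>\<omega>. emeasure (?K (?i \<omega>) j) A) \<in> borel_measurable ?N" for j
        by (rule measurable_compose[OF cur, of "\<lambda>i. emeasure (?K i j) A"]) simp
      have [measurable]: "Measurable.pred ?N (\<lambda>\<omega>. ?i \<omega> = d)"
        by (rule measurable_compose[OF cur, of "\<lambda>i. i = d"]) simp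
      show ?thesis by measurable
    qed
    ultimately show "(\<lambda>\<omega>. emeasure (step v \<pi> n \<omega>) A) \<in> borel_measurable ?N"
      by (subst measurable_cong) auto
  qed (blast intro: prob_space_imp_subprob_space step_prob, rule step_sets)
  then show ?thesis
    using step_prob by (simp add: Ionescu_Tulcea_def)
qed

text \<open>The law of the trajectory, by that theorem.\<close>

definition traj :: "'v \<Rightarrow> 'v strategy \<Rightarrow> (nat \<Rightarrow> 'v move) measure" where
  "traj v \<pi> = projective_family.lim UNIV
     (Ionescu_Tulcea.CI (step v \<pi>) (\<lambda>_. move_space)) (\<lambda>_. move_space)"

definition pos_part :: "(real \<Rightarrow> real) \<Rightarrow> real \<Rightarrow> 'v \<Rightarrow> 'v strategy \<Rightarrow> ennreal" where
  "pos_part f T v \<pi> = (\<integral>\<^sup>+\<omega>. e2ennreal (payoff f T \<omega>) \<partial>traj v \<pi>)"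

definition neg_part :: "(real \<Rightarrow> real) \<Rightarrow> real \<Rightarrow> 'v \<Rightarrow> 'v strategy \<Rightarrow> ennreal" where
  "neg_part f T v \<pi> = (\<integral>\<^sup>+\<omega>. e2ennreal (- payoff f T \<omega>) \<partial>traj v \<pi>)"

text \<open>
  The expected payoff is an extended real, meaningful unless both parts are infinite.
\<close>

definition has_expected_payoff :: "(real \<Rightarrow> real) \<Rightarrow> real \<Rightarrow> 'v \<Rightarrow> 'v strategy \<Rightarrow> bool" where
  "has_expected_payoff f T v \<pi> \<longleftrightarrow> pos_part f T v \<pi> \<noteq> \<infinity> \<or> neg_part f T v \<pi> \<noteq> \<infinity>"

definition expected_payoff :: "(real \<Rightarrow> real) \<Rightarrow> real \<Rightarrow> 'v \<Rightarrow> 'v strategy \<Rightarrow> ereal" where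
  "expected_payoff f T v \<pi> = enn2ereal (pos_part f T v \<pi>) - enn2ereal (neg_part f T v \<pi>)"

definition at_least_as_good ::
    "(real \<Rightarrow> real) \<Rightarrow> real \<Rightarrow> 'v \<Rightarrow> 'v strategy \<Rightarrow> 'v strategy \<Rightarrow> bool" where
  "at_least_as_good f T v \<pi> \<pi>' \<longleftrightarrow>
     (has_expected_payoff f T v \<pi>' \<longrightarrow>
        has_expected_payoff f T v \<pi> \<and> expected_payoff f T v \<pi>' \<le> expected_payoff f T v \<pi>)"

text \<open>
  Optimality for the problem with initial node \<open>v\<close> and budget \<open>T\<close>: the supremum is a real number
  and is attained.  (If the supremum is infinite, every strategy attaining it would count, whatever
  it does later on.)
\<close>

definition optimal :: "(real \<Rightarrow> real) \<Rightarrow> real \<Rightarrow> 'v \<Rightarrow> 'v strategy \<Rightarrow> bool" where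
  "optimal f T v \<pi> \<longleftrightarrow>
     strategy v \<pi> \<and> has_expected_payoff f T v \<pi> \<and> \<bar>expected_payoff f T v \<pi>\<bar> \<noteq> \<infinity> \<and>
     (\<forall>\<pi>'. strategy v \<pi>' \<longrightarrow> at_least_as_good f T v \<pi> \<pi>')"

text \<open>The next node chosen by \<open>\<pi>\<close> after \<open>h\<close> belongs to the tree (with probability 1).\<close>

definition follows_tree_at :: "'v \<Rightarrow> 'v strategy \<Rightarrow> 'v move list \<Rightarrow> bool" where
  "follows_tree_at v \<pi> h \<longleftrightarrow> set_pmf (\<pi> h) \<subseteq> sp_tree (cur_node v h)"

end

end

theory Submission
  imports Defs
begin

text \<open>
  Case 1. For budgets \<open>t\<close> far enough below, \<open>f (t - x)\<close> lies between two linear functions of the cost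
  \<open>x\<close> with almost equal slopes, the upper one for all \<open>x \<ge> 0\<close> and the lower one for the bounded costs
  that can arise along the tree: in case (a) because \<open>f''/f'\<close> is the derivative of \<open>ln f'\<close>, in case
  (b) because \<open>f'\<close> converges. So comparing expected payoffs amounts to comparing expected costs. Cost
  incurred plus mean distance to the destination is a submartingale under every strategy, and a
  martingale on the tree; an arc off the tree adds at least a fixed \<open>\<epsilon>\<close>, so to choose it with
  certainty is strictly worse than to follow the tree from there on. If an optimal strategy chose
  such an arc only with positive probability, it would be a mixture of strategies one of which
  chooses it with certainty and would be optimal as well.

  Case 2. The payoff vanishes once the cost exceeds \<open>T - T\<^sub>f\<close>, and before that the two strategies
  induce the same law.
\<close>

section \<open>Linear bounds on the risk function, and distances to the destination\<close>

text \<open>A strategy sees only the moves made: probability shifted from an arc off the tree to one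
  on it leaves no trace in the history, so later moves cannot depend on whether the shift took
  place. This is why a randomized choice is split as a mixture instead of being improved directly.
  The threshold \<theta> on the probability of the arc keeps the likelihood ratios of the two
  components bounded, so that integrability passes from the optimal strategy to both. The linear
  bounds are asymmetric because a detour may cost arbitrarily much, while in case (a) the slopes may
  grow without bound towards -infinity and are comparable only over bounded stretches; the lower
  bound is applied to the tree alone, where costs are bounded path by path. In case (a) the slope
  depends on the budget left, so costs are compared after weighting by a function of the history at
  the detour; this weight takes the place of conditioning. Unequal slopes lose at most
  \<open>\<eta> * K\<close> per unit of slope, with \<open>K\<close> the largest distance, against a
  gain of \<epsilon>.\<close>

lemma linear_sandwich_of_convergent_deriv:
  fixes f f' :: "real \<Rightarrow> real"
  assumes deriv: "\<And>t. t < T1 \<Longrightarrow> (f has_real_derivative f' t) (at t)"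
    and lim: "(f' \<longlongrightarrow> L) at_bot" and L: "0 < L" and \<eta>: "0 < \<eta>"
  obtains T0 a where "0 < a"
    "\<And>t x. t \<le> T0 \<Longrightarrow> 0 \<le> x \<Longrightarrow> f (t - x) \<le> f t - a * x"
    "\<And>t x. t \<le> T0 \<Longrightarrow> 0 \<le> x \<Longrightarrow> f t - (1 + \<eta>) * a * x \<le> f (t - x)"
proof -
  \<comment> \<open>Since \<open>2 / (2 + \<eta>) < 1 < (1 + \<eta>) * 2 / (2 + \<eta>)\<close>, the
    limit \<open>L\<close> lies strictly between \<open>a\<close> and
    \<open>(1 + \<eta>) * a\<close>, and so does the derivative eventually.\<close>
  define a where "a = L * (2 / (2 + \<eta>))"
  have a: "0 < a" "a < L" "L < (1 + \<eta>) * a"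
    using L \<eta> by (auto simp: a_def field_simps)
  have "\<forall>\<^sub>F t in at_bot. a < f' t" "\<forall>\<^sub>F t in at_bot. f' t < (1 + \<eta>) * a"
    using order_tendstoD[OF lim] a by auto
  then have "\<forall>\<^sub>F t in at_bot. a < f' t \<and> f' t < (1 + \<eta>) * a \<and> t < T1"
    using eventually_gt_at_bot[of T1] by eventually_elim simp
  then obtain T0 where T0: "\<And>t. t \<le> T0 \<Longrightarrow> a < f' t \<and> f' t < (1 + \<eta>) * a \<and> t < T1"
    unfolding eventually_at_bot_linorder by auto
  have mvt: "\<exists>z\<le>T0. f t - f (t - x) = x * f' z" if "t \<le> T0" "0 \<le> x" for t x
  proof (cases "x = 0")
    case False
    then have "t - x < t" using that by simp
    moreover have "(f has_real_derivative f' z) (at z)" if "z \<le> t" for z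
      using deriv T0[of z] that \<open>t \<le> T0\<close> by simp
    ultimately obtain z where "t - x < z" "z < t" "f t - f (t - x) = (t - (t - x)) * f' z"
      using MVT2[of "t - x" t f f'] by blast
    then show ?thesis using that by (intro exI[of _ z]) auto
  qed auto
  show ?thesis
  proof (rule that[of a T0])
    fix t x :: real assume tx: "t \<le> T0" "0 \<le> x"
    then obtain z where z: "z \<le> T0" "f t - f (t - x) = x * f' z" using mvt by blast
    have "x * a \<le> x * f' z" "x * f' z \<le> x * ((1 + \<eta>) * a)"
      using tx T0[OF z(1)] by (auto intro!: mult_left_mono)
    then show "f (t - x) \<le> f t - a * x" "f t - (1 + \<eta>) * a * x \<le> f (t - x)"
      using z(2) by (auto simp: algebra_simps)
  qed (rule a)
qed

text \<open>
  The upper bound is the tangent at \<open>t\<close>, the lower bound the tangent at \<open>t - x\<close>; the slopes are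
  comparable because \<open>f''/f'\<close> is the derivative of \<open>ln f'\<close>.
\<close>

lemma linear_sandwich_of_concave:
  fixes f f' f'' :: "real \<Rightarrow> real"
  assumes mono: "mono_on {..<T1} f" and concave: "concave_on {..<T1} f"
    and deriv: "\<And>t. t < T1 \<Longrightarrow> (f has_real_derivative f' t) (at t)"
    and deriv2: "\<And>t. t < T1 \<Longrightarrow> (f' has_real_derivative f'' t) (at t)"
    and nz: "\<forall>\<^sub>F t in at_bot. f' t \<noteq> 0"
    and lim: "((\<lambda>t. f'' t / f' t) \<longlongrightarrow> 0) at_bot"
    and \<eta>: "0 < \<eta>" and B: "0 \<le> B"
  obtains T0 where "T0 < T1" "\<And>t. t \<le> T0 \<Longrightarrow> 0 < f' t"
    "\<And>t x. t \<le> T0 \<Longrightarrow> 0 \<le> x \<Longrightarrow> f (t - x) \<le> f t - f' t * x"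
    "\<And>t x. t \<le> T0 \<Longrightarrow> 0 \<le> x \<Longrightarrow> x \<le> B \<Longrightarrow> f t - (1 + \<eta>) * f' t * x \<le> f (t - x)"
proof -
  \<comment> \<open>A bound \<kappa> on the derivative of \<open>ln f'\<close> lets the slope change
    by a factor of at most \<open>1 + \<eta>\<close> over a distance \<open>B\<close>; the
    \<open>+ 1\<close> covers \<open>B = 0\<close>.\<close>
  define \<kappa> where "\<kappa> = ln (1 + \<eta>) / (B + 1)"
  have \<kappa>: "0 < \<kappa>" using \<eta> B by (simp add: \<kappa>_def)
  have "\<forall>\<^sub>F t in at_bot. \<bar>f'' t / f' t\<bar> < \<kappa>"
    using tendstoD[OF lim \<kappa>] by simp
  then have "\<forall>\<^sub>F t in at_bot. f' t \<noteq> 0 \<and> \<bar>f'' t / f' t\<bar> < \<kappa> \<and> t < T1"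
    using nz eventually_gt_at_bot[of T1] by eventually_elim simp
  then obtain T0 where T0: "\<And>t. t \<le> T0 \<Longrightarrow> f' t \<noteq> 0 \<and> \<bar>f'' t / f' t\<bar> < \<kappa> \<and> t < T1"
    unfolding eventually_at_bot_linorder by auto
  \<comment> \<open>Where \<open>f' t = 0\<close> the quotient \<open>f'' t / f' t\<close> is 0 by
    convention, so the limit alone would not exclude such points; monotonicity gives the sign and
    \<open>nz\<close> the strictness.\<close>
  have pos: "0 < f' t" if "t \<le> T0" for t
  proof -
    have "0 \<le> f' t"
      by (rule mono_on_imp_deriv_nonneg[OF mono deriv]) (use T0[OF that] in \<open>auto simp: interior_open\<close>)
    then show ?thesis using T0[OF that] by simp
  qed
  have tangent: "f y \<le> f t + f' t * (y - t)" if "t < T1" "y < T1" for t y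
  proof -
    have "((\<lambda>x. - f x) has_real_derivative - f' t) (at t within {..<T1})"
      by (intro has_field_derivative_at_within[OF DERIV_minus] deriv that)
    from convex_on_imp_above_tangent[OF _ _ _ _ this, of y]
    have "- f' t * (y - t) \<le> - f y - - f t"
      using concave that by (simp add: concave_on_def interior_open)
    then show ?thesis by simp
  qed
  have ratio: "f' (t - x) \<le> (1 + \<eta>) * f' t" if "t \<le> T0" "0 \<le> x" "x \<le> B" for t x
  proof (cases "x = 0")
    case True
    then show ?thesis using pos[of t] that \<eta> by (simp add: algebra_simps)
  next
    case False
    have "((\<lambda>t. ln (f' t)) has_real_derivative f'' z / f' z) (at z)" if "z \<le> t" for z
      using DERIV_chain2[OF DERIV_ln_divide deriv2[of z]] pos[of z] T0[of z] that \<open>t \<le> T0\<close>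
      by simp
    moreover have "t - x < t" using False that by simp
    ultimately obtain z where z: "t - x < z" "z < t"
      "ln (f' t) - ln (f' (t - x)) = (t - (t - x)) * (f'' z / f' z)"
      using MVT2[of "t - x" t "\<lambda>t. ln (f' t)" "\<lambda>z. f'' z / f' z"] by blast
    have "\<bar>f'' z / f' z\<bar> < \<kappa>" using T0[of z] z that by auto
    then have "- \<kappa> \<le> f'' z / f' z" by linarith
    then have "x * (- \<kappa>) \<le> x * (f'' z / f' z)" using that by (intro mult_left_mono)
    moreover have "x * \<kappa> \<le> B * \<kappa>" using that \<kappa> by (intro mult_right_mono) auto
    moreover have "B * \<kappa> \<le> ln (1 + \<eta>)" using B \<eta> by (simp add: \<kappa>_def field_simps)
    ultimately have "ln (f' (t - x)) \<le> ln (1 + \<eta>) + ln (f' t)" using z(3) by simp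
    also have "\<dots> = ln ((1 + \<eta>) * f' t)" using \<eta> pos[of t] that by (simp add: ln_mult)
    finally show ?thesis using pos[of t] pos[of "t - x"] that \<eta> by simp
  qed
  show ?thesis
  proof (rule that[of T0])
    fix t x :: real assume tx: "t \<le> T0" "0 \<le> x"
    then show "f (t - x) \<le> f t - f' t * x"
      using tangent[of t "t - x"] T0[of t] T0[of "t - x"] by simp
    assume "x \<le> B"
    then have "f' (t - x) * x \<le> (1 + \<eta>) * f' t * x"
      using ratio tx by (intro mult_right_mono) auto
    moreover have "f t \<le> f (t - x) + f' (t - x) * x"
      using tangent[of "t - x" t] T0[of t] T0[of "t - x"] tx by simp
    ultimately show "f t - (1 + \<eta>) * f' t * x \<le> f (t - x)" by linarith
  qed (use T0[of T0] pos in auto)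
qed

section \<open>Shortest distances to the destination for the mean arc costs\<close>

definition (in adaptive_ssp) dist_dest :: "'v \<Rightarrow> real" where
  "dist_dest i = real_of_ereal (\<mu> mean_cost i d)"

lemma (in adaptive_ssp) integrable_cost: "integrable (p e) (\<lambda>c. c)" if "e \<in> parcs G"
proof -
  interpret prob_space "p e" using prob_space_p that .
  show ?thesis
    using p_support[OF that] sets_p[OF that] \<delta>_inf_pos[OF that]
    by (intro integrable_const_bound[where B="\<delta>_sup e"]) (auto cong: measurable_cong_sets)
qed

lemma (in adaptive_ssp) mean_cost_bounds:
  assumes "e \<in> parcs G"
  shows "\<delta>_inf e \<le> mean_cost e" "0 < mean_cost e"
proof -
  interpret prob_space "p e" using prob_space_p assms .
  have "\<delta>_inf e = (\<integral>c. \<delta>_inf e \<partial>p e)" by (simp add: prob_space)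
  also have "\<dots> \<le> mean_cost e"
    unfolding mean_cost_def using p_support[OF assms] integrable_cost[OF assms]
    by (intro integral_mono_AE) auto
  finally show "\<delta>_inf e \<le> mean_cost e" .
  then show "0 < mean_cost e" using \<delta>_inf_pos[OF assms] by simp
qed

lemma (in adaptive_ssp) nn_integral_cost: "(\<integral>\<^sup>+c. ennreal c \<partial>p e) = ennreal (mean_cost e)" if "e \<in> parcs G"
  unfolding mean_cost_def
  using p_support[OF that] \<delta>_inf_pos[OF that] integrable_cost[OF that]
  by (intro nn_integral_eq_integral) auto

text \<open>With non-negative costs the minimum over all walks is attained by a path, and one exists
  because the destination is reachable. So the distance is finite, and \<open>dist_dest\<close>
  never falls back on the default value of \<open>real_of_ereal\<close>.\<close>

lemma (in adaptive_ssp) min_awalk: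
  assumes "i \<in> pverts G"
  obtains q where "awalk i q d" "\<mu> mean_cost i d = ereal (awalk_cost mean_cost q)"
    "0 \<le> awalk_cost mean_cost q"
proof -
  obtain q where q: "apath i q d" "\<mu> mean_cost i d = awalk_cost mean_cost q"
    using min_cost_awalk[OF dest_reachable[OF assms], of mean_cost] mean_cost_bounds(2)
    by (force intro: less_imp_le)
  then have "awalk i q d" by (simp add: apath_def)
  moreover have "0 \<le> awalk_cost mean_cost q"
    using pos_cost_pos_awalk_cost[OF \<open>awalk i q d\<close>, of mean_cost] mean_cost_bounds(2)
    by (force intro: less_imp_le)
  ultimately show ?thesis using that q by blast
qed

lemma (in adaptive_ssp) dist_dest_eq: "\<mu> mean_cost i d = ereal (dist_dest i)" if "i \<in> pverts G"
  using min_awalk[OF that] by (metis dist_dest_def real_of_ereal.simps(1))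

lemma (in adaptive_ssp) dist_dest_nonneg: "0 \<le> dist_dest i" if "i \<in> pverts G"
  using min_awalk[OF that] by (metis dist_dest_def real_of_ereal.simps(1))

lemma (in adaptive_ssp) dist_dest_dest [simp]: "dist_dest d = 0"
proof -
  have "awalk d [] d" using dest_in_verts by (simp add: awalk_Nil_iff)
  from min_cost_le_walk_cost[OF this, of mean_cost]
  show ?thesis using dist_dest_eq[OF dest_in_verts] dist_dest_nonneg[OF dest_in_verts] by simp
qed

lemma (in adaptive_ssp) dist_dest_triangle: "dist_dest i \<le> mean_cost (i, j) + dist_dest j" if "(i, j) \<in> parcs G"
proof -
  note ij = in_arcsD1[OF that] in_arcsD2[OF that]
  obtain q where q: "awalk j q d" "\<mu> mean_cost j d = ereal (awalk_cost mean_cost q)"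
    using min_awalk[OF ij(2)] by blast
  have "awalk i ((i, j) # q) d" using q(1) that ij by (simp add: awalk_Cons_iff)
  from min_cost_le_walk_cost[OF this, of mean_cost] show ?thesis
    using q(2) by (simp add: dist_dest_eq ij)
qed

lemma (in adaptive_ssp) sp_tree_iff:
  assumes "i \<in> pverts G"
  shows "j \<in> sp_tree i \<longleftrightarrow> (i, j) \<in> parcs G \<and> mean_cost (i, j) + dist_dest j = dist_dest i"
  using assms in_arcsD2 by (auto simp: sp_tree_def succs_def dist_dest_eq)

text \<open>The first arc of a shortest walk is on the tree: the rest of the walk costs at least the
  distance from its start, which forces equality in the triangle inequality.\<close>

lemma (in adaptive_ssp) sp_tree_nonempty:
  assumes i: "i \<in> pverts G" "i \<noteq> d"
  shows "sp_tree i \<noteq> {}"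
proof -
  obtain q where q: "awalk i q d" "\<mu> mean_cost i d = ereal (awalk_cost mean_cost q)"
    using min_awalk[OF i(1)] by blast
  then obtain e q' where q_eq [simp]: "q = e # q'" using i by (cases q) (auto simp: awalk_Nil_iff)
  obtain j where e: "e = (i, j)" "(i, j) \<in> parcs G" "awalk j q' d"
    using q(1) by (cases e) (auto simp: awalk_Cons_iff)
  have "dist_dest j \<le> awalk_cost mean_cost q'"
    using min_cost_le_walk_cost[OF e(3), of mean_cost] in_arcsD2[OF e(2)] by (simp add: dist_dest_eq)
  moreover have "dist_dest i = mean_cost (i, j) + awalk_cost mean_cost q'"
    using q(2) i e by (simp add: dist_dest_eq)
  ultimately have "mean_cost (i, j) + dist_dest j = dist_dest i"
    using dist_dest_triangle[OF e(2)] by simp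
  then show ?thesis using e(2) sp_tree_iff[OF i(1)] by blast
qed

lemma (in adaptive_ssp) off_tree_gap:
  obtains \<epsilon> where "0 < \<epsilon>"
    "\<And>i j. (i, j) \<in> parcs G \<Longrightarrow> j \<notin> sp_tree i \<Longrightarrow> dist_dest i + \<epsilon> \<le> mean_cost (i, j) + dist_dest j"
proof -
  define gap where "gap e = mean_cost e + dist_dest (snd e) - dist_dest (fst e)" for e
  \<comment> \<open>Finitely many arcs have a smallest gap; the inserted 1 keeps the minimum defined
    when every arc is on the tree.\<close>
  define S where "S = insert 1 (gap ` {e \<in> parcs G. snd e \<notin> sp_tree (fst e)})"
  have fin: "finite S" using pair_finite_arcs by (simp add: S_def)
  have "0 < gap e" if "e \<in> parcs G" "snd e \<notin> sp_tree (fst e)" for e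
    using dist_dest_triangle[of "fst e" "snd e"] sp_tree_iff[of "fst e" "snd e"] that in_arcsD1
    by (cases e) (force simp: gap_def)
  then have "0 < Min S" using fin by (subst Min_gr_iff) (auto simp: S_def)
  moreover have "Min S \<le> gap (i, j)" if "(i, j) \<in> parcs G" "j \<notin> sp_tree i" for i j
    using that fin by (intro Min_le) (force simp: S_def)+
  ultimately show ?thesis
    by (intro that[of "Min S"]) (force simp: gap_def algebra_simps)+
qed

lemma (in adaptive_ssp) uniform_bounds:
  obtains \<delta> \<Delta> K where "0 < \<delta>" "\<delta> \<le> \<Delta>" "0 \<le> K"
    "\<And>e. e \<in> parcs G \<Longrightarrow> \<delta> \<le> \<delta>_inf e" "\<And>e. e \<in> parcs G \<Longrightarrow> \<delta>_sup e \<le> \<Delta>"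
    "\<And>i. i \<in> pverts G \<Longrightarrow> dist_dest i \<le> K"
proof -
  \<comment> \<open>The inserted 1 covers a graph without arcs, and gives
    \<open>\<delta> \<le> 1 \<le> \<Delta>\<close> without reference to any arc.\<close>
  define \<delta> where "\<delta> = Min (insert 1 (\<delta>_inf ` parcs G))"
  define \<Delta> where "\<Delta> = Max (insert 1 (\<delta>_sup ` parcs G))"
  define K where "K = Max (dist_dest ` pverts G)"
  note fin = pair_finite_arcs pair_finite_verts
  have \<delta>: "0 < \<delta>" "\<delta> \<le> 1"
    unfolding \<delta>_def using fin \<delta>_inf_pos by (subst Min_gr_iff) auto
  have \<Delta>: "1 \<le> \<Delta>" "\<delta> \<le> \<Delta>"
    using \<delta>(2) fin by (auto simp: \<Delta>_def Max_ge_iff)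
  have K: "dist_dest i \<le> K" if "i \<in> pverts G" for i
    unfolding K_def using fin that by simp
  have K0: "0 \<le> K" using K[OF dest_in_verts] by simp
  have "\<delta> \<le> \<delta>_inf e" "\<delta>_sup e \<le> \<Delta>" if "e \<in> parcs G" for e
    using fin that by (simp_all add: \<delta>_def \<Delta>_def)
  then show ?thesis
    using that[of \<delta> \<Delta> K] \<delta> \<Delta> K K0 by blast
qed

section \<open>The law of the trajectory\<close>

lemma hist_0 [simp]: "hist 0 \<omega> = []"
  by (simp add: hist_def)

lemma hist_Suc: "hist (Suc n) \<omega> = hist n \<omega> @ [\<omega> n]"
  by (simp add: hist_def)

lemma length_hist [simp]: "length (hist n \<omega>) = n"
  by (simp add: hist_def)

lemma take_hist: "k \<le> n \<Longrightarrow> take k (hist n \<omega>) = hist k \<omega>"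
  by (simp add: hist_def take_map)

lemma nth_hist: "k < n \<Longrightarrow> hist n \<omega> ! k = \<omega> k"
  by (simp add: hist_def)

lemma hist_restrict: "n \<le> m \<Longrightarrow> hist n (restrict \<omega> {0..<m}) = hist n \<omega>"
  by (auto simp: hist_def)

lemma hist_fun_upd: "hist (Suc n) (fun_upd \<omega> n x) = hist n \<omega> @ [x]"
  by (simp add: hist_def)

lemma cur_node_Nil [simp]: "cur_node v [] = v"
  by (simp add: cur_node_def)

lemma cur_node_snoc [simp]: "cur_node v (h @ [m]) = fst m"
  by (simp add: cur_node_def)

lemma cur_node_hist_Suc: "cur_node v (hist (Suc n) \<omega>) = fst (\<omega> n)"
  by (simp add: hist_Suc)

lemma spent_snoc [simp]: "spent (h @ [m]) = spent h + snd m"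
  by (simp add: spent_def)

abbreviation (in adaptive_ssp) fin_traj_space :: "nat \<Rightarrow> (nat \<Rightarrow> 'v move) measure" where
  "fin_traj_space n \<equiv> \<Pi>\<^sub>M k\<in>{0..<n}. move_space"

abbreviation (in adaptive_ssp) traj_space :: "(nat \<Rightarrow> 'v move) measure" where
  "traj_space \<equiv> \<Pi>\<^sub>M k\<in>UNIV. move_space"

text \<open>The transition kernel applied to \<open>g\<close>, as a function of the history alone:
  the choice of the arc is a finite sum, and only the fresh cost remains as an integral.\<close>

definition (in adaptive_ssp) next_val :: "'v \<Rightarrow> 'v strategy \<Rightarrow> ('v move list \<Rightarrow> ennreal) \<Rightarrow> 'v move list \<Rightarrow> ennreal" where
  "next_val v \<pi> g h =
     (if cur_node v h = d then g (h @ [(d, 0)])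
      else \<Sum>j\<in>succs (cur_node v h).
             ennreal (pmf (\<pi> h) j) * (\<integral>\<^sup>+c. g (h @ [(j, c)]) \<partial>p (cur_node v h, j)))"

lemma (in adaptive_ssp) space_move_space: "space move_space = pverts G \<times> UNIV"
  by (simp add: move_space_def space_pair_measure)

lemma (in adaptive_ssp) measurable_node [measurable]: "fst \<in> measurable move_space (count_space (pverts G))"
  unfolding move_space_def by measurable

lemma (in adaptive_ssp) measurable_cost [measurable]: "snd \<in> borel_measurable move_space"
  unfolding move_space_def by measurable

lemma (in adaptive_ssp) measurable_Pair_cost: "Pair j \<in> measurable (p (i, j)) move_space" if "(i, j) \<in> parcs G"
  using in_arcsD2[OF that]
  unfolding move_space_def measurable_cong_sets[OF sets_p[OF that] refl]
  by (intro measurable_Pair measurable_const measurable_ident) simp_all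

lemma (in adaptive_ssp) finite_succs: "finite (succs i)"
  by (rule finite_subset[OF _ pair_finite_verts]) (auto simp: succs_def dest: in_arcsD2)

text \<open>Lists of moves are given no sigma-algebra. Measurability of \<open>g\<close> on
  histories of length \<open>n\<close> means that of \<open>g\<close> composed with
  \<open>hist n\<close> on the product of the first \<open>n\<close> coordinates; this lemma carries
  it to longer products and the next one to whole trajectories.\<close>

lemma (in adaptive_ssp) measurable_hist_prefix:
  assumes "(\<lambda>\<omega>. g (hist n \<omega>)) \<in> measurable (fin_traj_space n) N" "n \<le> m"
  shows "(\<lambda>\<omega>. g (hist n \<omega>)) \<in> measurable (fin_traj_space m) N"
proof -
  have "(\<lambda>\<omega>. g (hist n (restrict \<omega> {0..<n}))) \<in> measurable (fin_traj_space m) N"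
    using assms(2) by (intro measurable_compose[OF measurable_restrict_subset assms(1)]) auto
  then show ?thesis by (simp add: hist_restrict)
qed

lemma (in adaptive_ssp) measurable_hist_traj:
  assumes "(\<lambda>\<omega>. g (hist n \<omega>)) \<in> measurable (fin_traj_space n) N"
  shows "(\<lambda>\<omega>. g (hist n \<omega>)) \<in> measurable traj_space N"
proof -
  have "(\<lambda>\<omega>. g (hist n (restrict \<omega> {0..<n}))) \<in> measurable traj_space N"
    by (intro measurable_compose[OF measurable_restrict_subset assms]) auto
  then show ?thesis by (simp add: hist_restrict)
qed

lemma (in adaptive_ssp) measurable_move: "m < n \<Longrightarrow> (\<lambda>\<omega>. \<omega> m) \<in> measurable (fin_traj_space n) move_space"
  using measurable_component_singleton[of m "{0..<n}" "\<lambda>_. move_space"] by simp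

lemma (in adaptive_ssp) measurable_cur_node:
  assumes "v \<in> pverts G"
  shows "(\<lambda>\<omega>. cur_node v (hist n \<omega>)) \<in> measurable (fin_traj_space n) (count_space (pverts G))"
proof (cases n)
  case 0
  then show ?thesis using assms by simp
next
  case (Suc m)
  have "(\<lambda>\<omega>. fst (\<omega> m)) \<in> measurable (fin_traj_space n) (count_space (pverts G))"
    using Suc by (intro measurable_compose[OF measurable_move measurable_node]) auto
  then show ?thesis using Suc by (simp add: cur_node_hist_Suc)
qed

lemma (in adaptive_ssp) measurable_spent: "(\<lambda>\<omega>. spent (hist n \<omega>)) \<in> borel_measurable (fin_traj_space n)"
proof -
  have "spent (hist n \<omega>) = (\<Sum>k<n. snd (\<omega> k))" for \<omega> :: "nat \<Rightarrow> 'v move"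
    by (induction n) (simp_all add: hist_Suc, simp add: spent_def)
  moreover have "(\<lambda>\<omega>. \<Sum>k<n. snd (\<omega> k)) \<in> borel_measurable (fin_traj_space n)"
    by (intro borel_measurable_sum measurable_compose[OF measurable_move measurable_cost]) auto
  ultimately show ?thesis by simp
qed

lemma (in adaptive_ssp) measurable_pmf_strategy:
  "strategy v \<pi> \<Longrightarrow> (\<lambda>\<omega>. pmf (\<pi> (hist n \<omega>)) j) \<in> borel_measurable (fin_traj_space n)"
  by (simp add: strategy_def)

text \<open>The strategy is supported on the finitely many successors, so the integral over the
  chosen node is a finite sum, and in each of its terms the kernel is the law of the cost of an
  existing arc.\<close>

lemma (in adaptive_ssp) nn_integral_step:
  assumes v: "v \<in> pverts G" and \<pi>: "strategy v \<pi>" and \<omega>: "\<omega> \<in> space (fin_traj_space n)"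
    and g: "(\<lambda>m. g (hist n \<omega> @ [m])) \<in> borel_measurable move_space"
  shows "(\<integral>\<^sup>+m. g (hist n \<omega> @ [m]) \<partial>step v \<pi> n \<omega>) = next_val v \<pi> g (hist n \<omega>)"
proof -
  define h where "h = hist n \<omega>"
  define i where "i = cur_node v h"
  have i: "i \<in> pverts G"
    using measurable_space[OF measurable_cur_node[OF v] \<omega>] by (simp add: i_def h_def)
  note g' = g[folded h_def]
  show ?thesis
  proof (cases "i = d")
    case True
    then show ?thesis
      using g' dest_in_verts
      by (simp add: step_def next_val_def Let_def h_def[symmetric] i_def[symmetric]
            nn_integral_return space_move_space)
  next
    case False
    let ?K = "\<lambda>j. if (i, j) \<in> parcs G then distr (p (i, j)) move_space (Pair j)
                  else null_measure move_space"
    have supp: "set_pmf (\<pi> h) \<subseteq> succs i"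
      using \<pi> i False by (auto simp: strategy_def i_def)
    have K_sub: "?K j \<in> space (subprob_algebra move_space)" for j
    proof (cases "(i, j) \<in> parcs G")
      case True
      from prob_space.prob_space_distr[OF prob_space_p[OF True] measurable_Pair_cost[OF True]]
      show ?thesis using True by (simp add: space_subprob_algebra prob_space_imp_subprob_space)
    next
      case False
      have "subprob_space (null_measure move_space)"
        using dest_in_verts by (intro subprob_spaceI) (auto simp: space_move_space)
      with False show ?thesis by (simp add: space_subprob_algebra)
    qed
    have K: "?K \<in> measurable (measure_pmf (\<pi> h)) (subprob_algebra move_space)"
      using K_sub by (auto simp: measurable_def)
    have "step v \<pi> n \<omega> = measure_pmf (\<pi> h) \<bind> ?K"
      using False unfolding step_def Let_def h_def[symmetric] i_def[symmetric] by (simp only: if_False)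
    then have "(\<integral>\<^sup>+m. g (h @ [m]) \<partial>step v \<pi> n \<omega>) = (\<integral>\<^sup>+j. (\<integral>\<^sup>+m. g (h @ [m]) \<partial>?K j) \<partial>\<pi> h)"
      using nn_integral_bind[OF g' K] by simp
    also have "\<dots> = (\<Sum>j\<in>succs i. (\<integral>\<^sup>+m. g (h @ [m]) \<partial>?K j) * ennreal (pmf (\<pi> h) j))"
      using supp by (intro nn_integral_measure_pmf_support finite_succs) auto
    also have "\<dots> = (\<Sum>j\<in>succs i. ennreal (pmf (\<pi> h) j) * (\<integral>\<^sup>+c. g (h @ [(j, c)]) \<partial>p (i, j)))"
      using measurable_Pair_cost g'
      by (intro sum.cong refl) (simp add: succs_def nn_integral_distr mult.commute)
    finally show ?thesis using False by (simp add: next_val_def h_def i_def)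
  qed
qed

text \<open>Appending a move to a history is the same as setting coordinate \<open>n\<close> of the
  trajectory, which is measurable jointly in the trajectory and the move.\<close>

lemma (in adaptive_ssp) measurable_snoc:
  assumes "(\<lambda>\<omega>. g (hist (Suc n) \<omega>)) \<in> measurable (fin_traj_space (Suc n)) N"
  shows "(\<lambda>(\<omega>, m). g (hist n \<omega> @ [m])) \<in> measurable (fin_traj_space n \<Otimes>\<^sub>M move_space) N"
proof -
  have "(\<lambda>(\<omega>, m). fun_upd \<omega> n m) \<in>
      measurable (fin_traj_space n \<Otimes>\<^sub>M move_space) (fin_traj_space (Suc n))"
    using measurable_add_dim[of n "{0..<n}" "\<lambda>_. move_space"] by (simp add: atLeastLessThanSuc)
  from measurable_compose[OF this assms] show ?thesis
    by (simp add: split_beta' hist_fun_upd)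
qed

lemma (in adaptive_ssp) measurable_snoc_move:
  assumes "(\<lambda>\<omega>. g (hist (Suc n) \<omega>)) \<in> measurable (fin_traj_space (Suc n)) N"
    and "\<omega> \<in> space (fin_traj_space n)"
  shows "(\<lambda>m. g (hist n \<omega> @ [m])) \<in> measurable move_space N"
  using measurable_compose[OF measurable_Pair1'[OF assms(2)] measurable_snoc[OF assms(1)]] by simp

lemma (in adaptive_ssp) measurable_next_val:
  assumes v: "v \<in> pverts G" and \<pi>: "strategy v \<pi>"
    and g: "(\<lambda>\<omega>. g (hist (Suc n) \<omega>)) \<in> borel_measurable (fin_traj_space (Suc n))"
  shows "(\<lambda>\<omega>. next_val v \<pi> g (hist n \<omega>)) \<in> borel_measurable (fin_traj_space n)"
proof -
  interpret IT: Ionescu_Tulcea "step v \<pi>" "\<lambda>_. move_space"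
    by (rule Ionescu_Tulcea_step[OF v \<pi>])
  have "(\<lambda>\<omega>. \<integral>\<^sup>+m. g (hist n \<omega> @ [m]) \<partial>step v \<pi> n \<omega>) \<in> borel_measurable (fin_traj_space n)"
    by (rule nn_integral_measurable_subprob_algebra2[OF measurable_snoc[OF g] IT.P])
  then show ?thesis
    by (rule measurable_cong[THEN iffD1, rotated])
       (intro nn_integral_step[OF v \<pi>] measurable_snoc_move[OF g])
qed

section \<open>Finite-dimensional laws of the trajectory\<close>

lemma (in adaptive_ssp) sets_traj: "v \<in> pverts G \<Longrightarrow> strategy v \<pi> \<Longrightarrow> sets (traj v \<pi>) = sets traj_space"
proof -
  assume "v \<in> pverts G" "strategy v \<pi>"
  then interpret IT: Ionescu_Tulcea "step v \<pi>" "\<lambda>_. move_space"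
    by (rule Ionescu_Tulcea_step)
  show ?thesis by (simp add: traj_def)
qed

lemma (in adaptive_ssp) space_traj: "v \<in> pverts G \<Longrightarrow> strategy v \<pi> \<Longrightarrow> space (traj v \<pi>) = space traj_space"
  using sets_eq_imp_space_eq[OF sets_traj] .

text \<open>The projective limit has the composed kernels as its marginals. The starting point
  \<open>\<lambda>_. undefined\<close> is the only point of the product over no coordinates, that
  is, the empty history.\<close>

lemma (in adaptive_ssp) distr_traj:
  assumes v: "v \<in> pverts G" and \<pi>: "strategy v \<pi>"
  shows "distr (traj v \<pi>) (fin_traj_space n) (\<lambda>\<omega>. restrict \<omega> {0..<n}) =
    Ionescu_Tulcea.C (step v \<pi>) (\<lambda>_. move_space) 0 n (\<lambda>_. undefined)"
proof -
  interpret IT: Ionescu_Tulcea "step v \<pi>" "\<lambda>_. move_space"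
    by (rule Ionescu_Tulcea_step[OF v \<pi>])
  have "IT.CI {0..<n} = IT.C 0 n (\<lambda>_. undefined)"
  proof (rule measure_eqI)
    fix A assume "A \<in> sets (IT.CI {0..<n})"
    then have A: "A \<in> sets (fin_traj_space n)" by (simp add: IT.CI_def)
    then have "prod_emb {0..<n} (\<lambda>_. move_space) {0..<n} A = A"
      by (intro prod_emb_id sets.sets_into_space[OF A, unfolded space_PiM])
    then show "emeasure (IT.CI {0..<n}) A = emeasure (IT.C 0 n (\<lambda>_. undefined)) A"
      using IT.emeasure_CI[OF subset_refl A] by simp
  qed (simp add: IT.CI_def IT.sets_C)
  then show ?thesis using IT.distr_lim[of "{0..<n}"] by (simp add: traj_def)
qed

lemma (in adaptive_ssp) prob_space_traj:
  assumes v: "v \<in> pverts G" and \<pi>: "strategy v \<pi>"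
  shows "prob_space (traj v \<pi>)"
proof -
  interpret IT: Ionescu_Tulcea "step v \<pi>" "\<lambda>_. move_space"
    by (rule Ionescu_Tulcea_step[OF v \<pi>])
  \<comment> \<open>The total mass is read off the projection to no coordinates at all.\<close>
  have "prob_space (distr (traj v \<pi>) (fin_traj_space 0) (\<lambda>\<omega>. restrict \<omega> {0..<0}))"
    unfolding distr_traj[OF v \<pi>] by (intro IT.prob_space_C) simp
  moreover have "(\<lambda>\<omega>. restrict \<omega> {0..<0}) \<in> measurable (traj v \<pi>) (fin_traj_space 0)"
    unfolding measurable_cong_sets[OF sets_traj[OF v \<pi>] refl] by (intro measurable_restrict_subset) auto
  ultimately show ?thesis by (rule prob_space_distrD[rotated])
qed

text \<open>The tower property. Everything proved later about \<open>traj\<close> reaches the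
  transition kernel through this identity.\<close>

lemma (in adaptive_ssp) traj_step:
  assumes v: "v \<in> pverts G" and \<pi>: "strategy v \<pi>"
    and g: "(\<lambda>\<omega>. g (hist (Suc n) \<omega>)) \<in> borel_measurable (fin_traj_space (Suc n))"
  shows "(\<integral>\<^sup>+\<omega>. g (hist (Suc n) \<omega>) \<partial>traj v \<pi>) = (\<integral>\<^sup>+\<omega>. next_val v \<pi> g (hist n \<omega>) \<partial>traj v \<pi>)"
proof -
  interpret IT: Ionescu_Tulcea "step v \<pi>" "\<lambda>_. move_space"
    by (rule Ionescu_Tulcea_step[OF v \<pi>])
  let ?C = "\<lambda>n. IT.C 0 n (\<lambda>_. undefined)"
  \<comment> \<open>An integrand that depends on the first \<open>m\<close> moves only can be
    integrated against the marginal, which is a composition of \<open>m\<close> kernels.\<close>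
  have fin: "(\<integral>\<^sup>+\<omega>. k (hist m \<omega>) \<partial>traj v \<pi>) = (\<integral>\<^sup>+\<omega>. k (hist m \<omega>) \<partial>?C m)"
    if "(\<lambda>\<omega>. k (hist m \<omega>)) \<in> borel_measurable (fin_traj_space m)" for k m
  proof -
    have "(\<lambda>\<omega>. restrict \<omega> {0..<m}) \<in> measurable (traj v \<pi>) (fin_traj_space m)"
      unfolding measurable_cong_sets[OF sets_traj[OF v \<pi>] refl]
      by (intro measurable_restrict_subset) auto
    from nn_integral_distr[OF this, of "\<lambda>\<omega>. k (hist m \<omega>)"] that show ?thesis
      by (simp add: distr_traj[OF v \<pi>] hist_restrict measurable_cong_sets[OF IT.sets_C refl])
  qed
  have sp: "space (?C n) = space (fin_traj_space n)" by (simp add: IT.space_C)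
  have "(\<integral>\<^sup>+\<omega>. g (hist (Suc n) \<omega>) \<partial>?C (Suc n)) = (\<integral>\<^sup>+\<omega>. (\<integral>\<^sup>+x. g (hist (Suc n) x) \<partial>IT.eP n \<omega>) \<partial>?C n)"
    using IT.measurable_C[of 0 n] g
    by (simp, subst nn_integral_bind[where B = "fin_traj_space (Suc n)"])
       (auto simp: measurable_cong_sets[OF IT.sets_C refl])
  also have "\<dots> = (\<integral>\<^sup>+\<omega>. next_val v \<pi> g (hist n \<omega>) \<partial>?C n)"
  proof (rule nn_integral_cong)
    fix \<omega> assume "\<omega> \<in> space (?C n)"
    then have \<omega>: "\<omega> \<in> space (fin_traj_space n)" by (simp add: sp)
    show "(\<integral>\<^sup>+x. g (hist (Suc n) x) \<partial>IT.eP n \<omega>) = next_val v \<pi> g (hist n \<omega>)"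
      using nn_integral_step[OF v \<pi> \<omega> measurable_snoc_move[OF g \<omega>]] IT.nn_integral_eP[OF \<omega> g]
      by (simp add: hist_fun_upd)
  qed
  finally show ?thesis
    using fin[OF g] fin[OF measurable_next_val[OF v \<pi> g]] by simp
qed

text \<open>Cylinders generate the product sigma-algebra and are closed under intersection. Events
  are phrased as sets of histories because the change of measure compares integrals of functions of
  histories.\<close>

lemma (in adaptive_ssp) traj_space_measure_eqI:
  assumes "sets M = sets traj_space" "sets N = sets traj_space" "finite_measure M"
    and eq: "\<And>n A. (\<lambda>\<omega>. indicator A (hist n \<omega>) :: ennreal) \<in> borel_measurable (fin_traj_space n) \<Longrightarrow>
      (\<integral>\<^sup>+\<omega>. indicator A (hist n \<omega>) \<partial>M) = (\<integral>\<^sup>+\<omega>. indicator A (hist n \<omega>) \<partial>N)"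
  shows "M = N"
proof (rule measure_eqI_PiM_infinite[OF assms(1,2) _ assms(3)])
  fix B :: "nat \<Rightarrow> 'v move set" and J :: "nat set"
  assume J: "finite J" and B: "\<And>i. i \<in> J \<Longrightarrow> B i \<in> sets move_space"
  \<comment> \<open>A cylinder over a finite set of times is a condition on the history at any later
    time \<open>n\<close>.\<close>
  obtain n where n: "\<And>i. i \<in> J \<Longrightarrow> i < n"
    using finite_nat_set_iff_bounded J by auto
  define A where "A = {h. \<forall>i\<in>J. h ! i \<in> B i}"
  have emb: "\<omega> \<in> prod_emb UNIV (\<lambda>_. move_space) J (Pi\<^sub>E J B) \<longleftrightarrow> hist n \<omega> \<in> A"
    if "\<omega> \<in> space traj_space" for \<omega>
    using that n by (auto simp: prod_emb_iff A_def nth_hist space_PiM)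
  have "Measurable.pred (fin_traj_space n) (\<lambda>\<omega>. \<forall>i\<in>J. \<omega> i \<in> B i)"
    using n B by (intro pred_intros_finite J pred_sets2[OF _ measurable_move]) auto
  then have "Measurable.pred (fin_traj_space n) (\<lambda>\<omega>. hist n \<omega> \<in> A)"
    using n by (simp add: A_def nth_hist)
  then have A: "(\<lambda>\<omega>. indicator A (hist n \<omega>) :: ennreal) \<in> borel_measurable (fin_traj_space n)"
    by (simp add: indicator_def)
  have C: "prod_emb UNIV (\<lambda>_. move_space) J (Pi\<^sub>E J B) \<in> sets traj_space"
    using J B by (intro sets_PiM_I) auto
  have "emeasure Q (prod_emb UNIV (\<lambda>_. move_space) J (Pi\<^sub>E J B)) = (\<integral>\<^sup>+\<omega>. indicator A (hist n \<omega>) \<partial>Q)"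
    if "sets Q = sets traj_space" for Q
  proof -
    have "emeasure Q (prod_emb UNIV (\<lambda>_. move_space) J (Pi\<^sub>E J B)) =
        (\<integral>\<^sup>+\<omega>. indicator (prod_emb UNIV (\<lambda>_. move_space) J (Pi\<^sub>E J B)) \<omega> \<partial>Q)"
      using C that by simp
    also have "\<dots> = (\<integral>\<^sup>+\<omega>. indicator A (hist n \<omega>) \<partial>Q)"
      using emb sets_eq_imp_space_eq[OF that] by (intro nn_integral_cong) (simp add: indicator_def)
    finally show ?thesis .
  qed
  then show "emeasure M (prod_emb UNIV (\<lambda>_. move_space) J (Pi\<^sub>E J B)) =
      emeasure N (prod_emb UNIV (\<lambda>_. move_space) J (Pi\<^sub>E J B))"
    using assms(1,2) eq[OF A] by simp
qed

section \<open>Change of measure\<close>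

text \<open>What the kernel produces almost surely after \<open>h\<close>. In contrast to
  \<open>history\<close>, it asks that the strategy give the node positive probability, and it
  admits the idle move at the destination.\<close>

definition (in adaptive_ssp) legal_move :: "'v \<Rightarrow> 'v strategy \<Rightarrow> 'v move list \<Rightarrow> 'v move \<Rightarrow> bool" where
  "legal_move v \<pi> h m \<longleftrightarrow>
     (let i = cur_node v h in
      if i = d then m = (d, 0)
      else (i, fst m) \<in> parcs G \<and> fst m \<in> set_pmf (\<pi> h) \<and>
        \<delta>_inf (i, fst m) \<le> snd m \<and> snd m \<le> \<delta>_sup (i, fst m))"

lemma (in adaptive_ssp) cur_node_in_verts:
  "v \<in> pverts G \<Longrightarrow> \<omega> \<in> space traj_space \<Longrightarrow> cur_node v (hist n \<omega>) \<in> pverts G"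
  by (cases n) (auto simp: cur_node_hist_Suc space_PiM space_move_space PiE_iff mem_Times_iff)

lemma (in adaptive_ssp) measurable_legal_move:
  assumes v: "v \<in> pverts G" and \<pi>: "strategy v \<pi>"
  shows "Measurable.pred (fin_traj_space (Suc n)) (\<lambda>\<omega>. legal_move v \<pi> (hist n \<omega>) (\<omega> n))"
proof -
  let ?N = "fin_traj_space (Suc n)"
  note [measurable] = measurable_move[of n "Suc n"]
  have cur [measurable]: "(\<lambda>\<omega>. cur_node v (hist n \<omega>)) \<in> measurable ?N (count_space (pverts G))"
    by (rule measurable_hist_prefix[OF measurable_cur_node[OF v]]) simp
  have [measurable]: "(\<lambda>\<omega>. pmf (\<pi> (hist n \<omega>)) j) \<in> borel_measurable ?N" for j
    by (rule measurable_hist_prefix[OF measurable_pmf_strategy[OF \<pi>]]) simp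
  have [measurable]: "Measurable.pred ?N (\<lambda>\<omega>. cur_node v (hist n \<omega>) = i)" for i
    by (rule measurable_compose[where g = "\<lambda>j. j = i"]) measurable
  have [measurable]: "Measurable.pred ?N (\<lambda>\<omega>. fst (\<omega> n) = i)" for i
    by (rule measurable_compose[where g = "\<lambda>j. j = i" and N = "count_space (pverts G)"]) measurable
  \<comment> \<open>There are finitely many nodes, so legality becomes a finite disjunction over
    current and next node; membership in the support is written as a nonzero probability, which is
    measurable by the definition of a strategy.\<close>
  have "Measurable.pred ?N (\<lambda>\<omega>. \<exists>i\<in>pverts G. cur_node v (hist n \<omega>) = i \<and>
      (if i = d then fst (\<omega> n) = d \<and> snd (\<omega> n) = 0
       else \<exists>j\<in>succs i. fst (\<omega> n) = j \<and> pmf (\<pi> (hist n \<omega>)) j \<noteq> 0 \<and>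
         \<delta>_inf (i, j) \<le> snd (\<omega> n) \<and> snd (\<omega> n) \<le> \<delta>_sup (i, j)))"
    using pair_finite_verts finite_succs by measurable
  then show ?thesis
  proof (rule measurable_cong[THEN iffD1, rotated])
    fix \<omega> assume "\<omega> \<in> space ?N"
    from measurable_space[OF cur this] have "cur_node v (hist n \<omega>) \<in> pverts G" by simp
    then show "(\<exists>i\<in>pverts G. cur_node v (hist n \<omega>) = i \<and>
      (if i = d then fst (\<omega> n) = d \<and> snd (\<omega> n) = 0
       else \<exists>j\<in>succs i. fst (\<omega> n) = j \<and> pmf (\<pi> (hist n \<omega>)) j \<noteq> 0 \<and>
         \<delta>_inf (i, j) \<le> snd (\<omega> n) \<and> snd (\<omega> n) \<le> \<delta>_sup (i, j))) \<longleftrightarrow> legal_move v \<pi> (hist n \<omega>) (\<omega> n)"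
      by (cases "\<omega> n") (auto simp: legal_move_def Let_def succs_def set_pmf_iff)
  qed
qed

lemma (in adaptive_ssp) AE_legal_move:
  assumes v: "v \<in> pverts G" and \<pi>: "strategy v \<pi>"
  shows "AE \<omega> in traj v \<pi>. \<forall>n. legal_move v \<pi> (hist n \<omega>) (\<omega> n)"
  unfolding AE_all_countable
proof
  fix n
  \<comment> \<open>The last move is judged against the history before it, so that illegality of
    move \<open>n\<close> is a function of the history of length \<open>Suc n\<close>; its one-step
    expectation is 0.\<close>
  define g where "g h = (if legal_move v \<pi> (butlast h) (last h) then 0 else 1 :: ennreal)" for h
  have g_hist: "g (hist (Suc n) \<omega>) = (if legal_move v \<pi> (hist n \<omega>) (\<omega> n) then 0 else 1)" for \<omega>
    by (simp add: g_def hist_Suc)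
  have g: "(\<lambda>\<omega>. g (hist (Suc n) \<omega>)) \<in> borel_measurable (fin_traj_space (Suc n))"
    unfolding g_hist using measurable_legal_move[OF v \<pi>, of n] by measurable
  have "next_val v \<pi> g h = 0" for h
  proof (cases "cur_node v h = d")
    case True
    then show ?thesis by (simp add: next_val_def g_def legal_move_def)
  next
    case False
    have "ennreal (pmf (\<pi> h) j) * (\<integral>\<^sup>+c. g (h @ [(j, c)]) \<partial>p (cur_node v h, j)) = 0"
      if j: "(cur_node v h, j) \<in> parcs G" for j
    proof (cases "j \<in> set_pmf (\<pi> h)")
      case True
      have "AE c in p (cur_node v h, j). g (h @ [(j, c)]) = 0"
        using p_support[OF j] by eventually_elim (use False True j in \<open>auto simp: g_def legal_move_def\<close>)
      then have "(\<integral>\<^sup>+c. g (h @ [(j, c)]) \<partial>p (cur_node v h, j)) = (\<integral>\<^sup>+c. 0 \<partial>p (cur_node v h, j))"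
        by (rule nn_integral_cong_AE)
      then show ?thesis by simp
    qed (simp add: set_pmf_iff)
    then show ?thesis
      using False unfolding next_val_def by (simp only: if_False) (auto simp: succs_def intro!: sum.neutral)
  qed
  then have "(\<integral>\<^sup>+\<omega>. g (hist (Suc n) \<omega>) \<partial>traj v \<pi>) = 0"
    using traj_step[OF v \<pi> g] by simp
  moreover have "(\<lambda>\<omega>. g (hist (Suc n) \<omega>)) \<in> borel_measurable (traj v \<pi>)"
    unfolding measurable_cong_sets[OF sets_traj[OF v \<pi>] refl] by (rule measurable_hist_traj[OF g])
  ultimately have "AE \<omega> in traj v \<pi>. g (hist (Suc n) \<omega>) = 0"
    by (simp add: nn_integral_0_iff_AE)
  then show "AE \<omega> in traj v \<pi>. legal_move v \<pi> (hist n \<omega>) (\<omega> n)"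
    by eventually_elim (auto simp: g_hist split: if_splits)
qed

text \<open>
  Change of measure: \<open>\<rho>\<close> and \<open>\<rho>'\<close> are the one-step weights that turn the transitions of \<open>\<pi>\<close> and
  of \<open>\<pi>'\<close> into the same kernel, \<open>\<Lambda>\<close> and \<open>\<Lambda>'\<close> their running products.
\<close>

lemma (in adaptive_ssp) nn_integral_traj_reweight:
  assumes v: "v \<in> pverts G" and \<pi>: "strategy v \<pi>" and \<pi>': "strategy v \<pi>'"
    and \<rho>: "\<And>n. (\<lambda>\<omega>. \<rho> (hist n \<omega>) :: ennreal) \<in> borel_measurable (fin_traj_space n)"
    and \<rho>': "\<And>n. (\<lambda>\<omega>. \<rho>' (hist n \<omega>) :: ennreal) \<in> borel_measurable (fin_traj_space n)"
    and \<Lambda>: "\<And>n. (\<lambda>\<omega>. \<Lambda> (hist n \<omega>)) \<in> borel_measurable (fin_traj_space n)"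
    and \<Lambda>': "\<And>n. (\<lambda>\<omega>. \<Lambda>' (hist n \<omega>)) \<in> borel_measurable (fin_traj_space n)"
    and start: "\<Lambda> [] = \<Lambda>' []"
    and prod: "\<And>h m. \<Lambda> (h @ [m]) = \<Lambda> h * \<rho> (h @ [m])" "\<And>h m. \<Lambda>' (h @ [m]) = \<Lambda>' h * \<rho>' (h @ [m])"
    and dest: "\<And>h. cur_node v h = d \<Longrightarrow> \<rho> (h @ [(d, 0)]) = \<rho>' (h @ [(d, 0)])"
    and arc: "\<And>h j c. cur_node v h \<noteq> d \<Longrightarrow> (cur_node v h, j) \<in> parcs G \<Longrightarrow>
      ennreal (pmf (\<pi> h) j) * \<rho> (h @ [(j, c)]) = ennreal (pmf (\<pi>' h) j) * \<rho>' (h @ [(j, c)])"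
    and g: "(\<lambda>\<omega>. g (hist n \<omega>)) \<in> borel_measurable (fin_traj_space n)"
  shows "(\<integral>\<^sup>+\<omega>. \<Lambda> (hist n \<omega>) * g (hist n \<omega>) \<partial>traj v \<pi>) =
    (\<integral>\<^sup>+\<omega>. \<Lambda>' (hist n \<omega>) * g (hist n \<omega>) \<partial>traj v \<pi>')"
  using g
proof (induction n arbitrary: g)
  case 0
  show ?case
    using start prob_space.emeasure_space_1[OF prob_space_traj[OF v \<pi>]]
      prob_space.emeasure_space_1[OF prob_space_traj[OF v \<pi>']] by simp
next
  case (Suc n)
  \<comment> \<open>The factor of the running product that is known before the move is pulled out of
    the one-step expectation; the one-step weight stays inside.\<close>
  have split: "(\<integral>\<^sup>+\<omega>. L (hist (Suc n) \<omega>) * g (hist (Suc n) \<omega>) \<partial>traj v \<sigma>) =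
      (\<integral>\<^sup>+\<omega>. L (hist n \<omega>) * next_val v \<sigma> (\<lambda>h. r h * g h) (hist n \<omega>) \<partial>traj v \<sigma>)"
    if \<sigma>: "strategy v \<sigma>"
      and r: "(\<lambda>\<omega>. r (hist (Suc n) \<omega>)) \<in> borel_measurable (fin_traj_space (Suc n))"
      and L: "(\<lambda>\<omega>. L (hist (Suc n) \<omega>)) \<in> borel_measurable (fin_traj_space (Suc n))"
      and p: "\<And>h m. L (h @ [m]) = L h * r (h @ [m])" for \<sigma> r L
  proof -
    have "(\<lambda>\<omega>. L (hist (Suc n) \<omega>) * g (hist (Suc n) \<omega>)) \<in> borel_measurable (fin_traj_space (Suc n))"
      using L Suc.prems by measurable
    from traj_step[OF v \<sigma>, of "\<lambda>h. L h * g h", OF this]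
    have "(\<integral>\<^sup>+\<omega>. L (hist (Suc n) \<omega>) * g (hist (Suc n) \<omega>) \<partial>traj v \<sigma>) =
        (\<integral>\<^sup>+\<omega>. next_val v \<sigma> (\<lambda>h. L h * g h) (hist n \<omega>) \<partial>traj v \<sigma>)" .
    also have "\<dots> = (\<integral>\<^sup>+\<omega>. L (hist n \<omega>) * next_val v \<sigma> (\<lambda>h. r h * g h) (hist n \<omega>) \<partial>traj v \<sigma>)"
    proof (rule nn_integral_cong)
      fix \<omega> assume "\<omega> \<in> space (traj v \<sigma>)"
      then have "restrict \<omega> {0..<n} \<in> space (fin_traj_space n)"
        by (auto simp: space_traj[OF v \<sigma>] space_PiM PiE_iff)
      note snoc = measurable_snoc_move[OF _ this, unfolded hist_restrict[OF order_refl]]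
      let ?h = "hist n \<omega>"
      have "(\<integral>\<^sup>+c. L (?h @ [(j, c)]) * g (?h @ [(j, c)]) \<partial>p (cur_node v ?h, j)) =
          L ?h * (\<integral>\<^sup>+c. r (?h @ [(j, c)]) * g (?h @ [(j, c)]) \<partial>p (cur_node v ?h, j))"
        if "(cur_node v ?h, j) \<in> parcs G" for j
        using measurable_compose[OF measurable_Pair_cost[OF that] snoc[OF Suc.prems]]
          measurable_compose[OF measurable_Pair_cost[OF that] snoc[of r, OF r]]
        by (simp add: p mult.assoc nn_integral_cmult)
      then show "next_val v \<sigma> (\<lambda>h. L h * g h) ?h = L ?h * next_val v \<sigma> (\<lambda>h. r h * g h) ?h"
        by (simp add: next_val_def p mult.assoc sum_distrib_left succs_def mult.left_commute)
    qed
    finally show ?thesis .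
  qed
  have eq: "next_val v \<pi> (\<lambda>h. \<rho> h * g h) (hist n \<omega>) = next_val v \<pi>' (\<lambda>h. \<rho>' h * g h) (hist n \<omega>)"
    if "\<omega> \<in> space (fin_traj_space n)" for \<omega>
  proof -
    let ?h = "hist n \<omega>"
    note snoc = measurable_snoc_move[OF _ that]
    have "ennreal (pmf (\<pi> ?h) j) * (\<integral>\<^sup>+c. \<rho> (?h @ [(j, c)]) * g (?h @ [(j, c)]) \<partial>p (cur_node v ?h, j)) =
        ennreal (pmf (\<pi>' ?h) j) * (\<integral>\<^sup>+c. \<rho>' (?h @ [(j, c)]) * g (?h @ [(j, c)]) \<partial>p (cur_node v ?h, j))"
      if "cur_node v ?h \<noteq> d" "(cur_node v ?h, j) \<in> parcs G" for j
      using measurable_compose[OF measurable_Pair_cost[OF that(2)] snoc[OF Suc.prems]]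
        measurable_compose[OF measurable_Pair_cost[OF that(2)] snoc[of \<rho>, OF \<rho>]]
        measurable_compose[OF measurable_Pair_cost[OF that(2)] snoc[of \<rho>', OF \<rho>']]
      by (simp add: nn_integral_cmult[symmetric] mult.assoc[symmetric] arc[OF that])
    then show ?thesis by (simp add: next_val_def dest succs_def)
  qed
  have "(\<lambda>\<omega>. \<rho> (hist (Suc n) \<omega>) * g (hist (Suc n) \<omega>)) \<in> borel_measurable (fin_traj_space (Suc n))"
    using \<rho> Suc.prems by measurable
  \<comment> \<open>The induction hypothesis is used for the one-step value of the weighted
    \<open>g\<close>, which changes the law of the past; \<open>eq\<close> then changes the kernel
    of the last move.\<close>
  from measurable_next_val[OF v \<pi>, of "\<lambda>h. \<rho> h * g h", OF this]
  have "(\<integral>\<^sup>+\<omega>. \<Lambda> (hist n \<omega>) * next_val v \<pi> (\<lambda>h. \<rho> h * g h) (hist n \<omega>) \<partial>traj v \<pi>) =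
      (\<integral>\<^sup>+\<omega>. \<Lambda>' (hist n \<omega>) * next_val v \<pi> (\<lambda>h. \<rho> h * g h) (hist n \<omega>) \<partial>traj v \<pi>')"
    by (rule Suc.IH)
  also have "\<dots> = (\<integral>\<^sup>+\<omega>. \<Lambda>' (hist n \<omega>) * next_val v \<pi>' (\<lambda>h. \<rho>' h * g h) (hist n \<omega>) \<partial>traj v \<pi>')"
  proof (rule nn_integral_cong)
    fix \<omega> assume "\<omega> \<in> space (traj v \<pi>')"
    then have "restrict \<omega> {0..<n} \<in> space (fin_traj_space n)"
      by (auto simp: space_traj[OF v \<pi>'] space_PiM PiE_iff)
    from eq[OF this]
    show "\<Lambda>' (hist n \<omega>) * next_val v \<pi> (\<lambda>h. \<rho> h * g h) (hist n \<omega>) =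
        \<Lambda>' (hist n \<omega>) * next_val v \<pi>' (\<lambda>h. \<rho>' h * g h) (hist n \<omega>)"
      by (simp add: hist_restrict)
  qed
  finally show ?case
    using split[OF \<pi> \<rho> \<Lambda> prod(1)] split[OF \<pi>' \<rho>' \<Lambda>' prod(2)] by simp
qed

text \<open>An event about the first \<open>n\<close> moves has equal weighted mass at every time
  \<open>m \<ge> n\<close>. As the running products are bounded and converge, dominated convergence
  passes this to the limit weights, which may depend on the whole trajectory; finite measures that
  agree on such events are equal.\<close>

lemma (in adaptive_ssp) density_traj_reweight:
  assumes v: "v \<in> pverts G" and \<pi>: "strategy v \<pi>" and \<pi>': "strategy v \<pi>'"
    and \<rho>: "\<And>n. (\<lambda>\<omega>. \<rho> (hist n \<omega>) :: ennreal) \<in> borel_measurable (fin_traj_space n)"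
    and \<rho>': "\<And>n. (\<lambda>\<omega>. \<rho>' (hist n \<omega>) :: ennreal) \<in> borel_measurable (fin_traj_space n)"
    and \<Lambda>: "\<And>n. (\<lambda>\<omega>. \<Lambda> (hist n \<omega>)) \<in> borel_measurable (fin_traj_space n)"
    and \<Lambda>': "\<And>n. (\<lambda>\<omega>. \<Lambda>' (hist n \<omega>)) \<in> borel_measurable (fin_traj_space n)"
    and start: "\<Lambda> [] = \<Lambda>' []"
    and prod: "\<And>h m. \<Lambda> (h @ [m]) = \<Lambda> h * \<rho> (h @ [m])" "\<And>h m. \<Lambda>' (h @ [m]) = \<Lambda>' h * \<rho>' (h @ [m])"
    and dest: "\<And>h. cur_node v h = d \<Longrightarrow> \<rho> (h @ [(d, 0)]) = \<rho>' (h @ [(d, 0)])"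
    and arc: "\<And>h j c. cur_node v h \<noteq> d \<Longrightarrow> (cur_node v h, j) \<in> parcs G \<Longrightarrow>
      ennreal (pmf (\<pi> h) j) * \<rho> (h @ [(j, c)]) = ennreal (pmf (\<pi>' h) j) * \<rho>' (h @ [(j, c)])"
    and C: "\<And>h. \<Lambda> h \<le> ennreal C" "\<And>h. \<Lambda>' h \<le> ennreal C"
    and L: "L \<in> borel_measurable traj_space" "L' \<in> borel_measurable traj_space"
    and lim: "\<And>\<omega>. (\<lambda>n. \<Lambda> (hist n \<omega>)) \<longlonglongrightarrow> L \<omega>" "\<And>\<omega>. (\<lambda>n. \<Lambda>' (hist n \<omega>)) \<longlonglongrightarrow> L' \<omega>"
  shows "density (traj v \<pi>) L = density (traj v \<pi>') L'"
proof -
  have meas: "f \<in> borel_measurable (traj v \<sigma>)" if "strategy v \<sigma>" "f \<in> borel_measurable traj_space"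
    for \<sigma> and f :: "(nat \<Rightarrow> 'v move) \<Rightarrow> ennreal"
    using that measurable_cong_sets[OF sets_traj[OF v that(1)] refl] by blast
  have conv: "(\<lambda>m. \<integral>\<^sup>+\<omega>. L1 (hist m \<omega>) * indicator A (hist n \<omega>) \<partial>traj v \<sigma>)
      \<longlonglongrightarrow> (\<integral>\<^sup>+\<omega>. indicator A (hist n \<omega>) \<partial>density (traj v \<sigma>) Lim)"
    if \<sigma>: "strategy v \<sigma>" and Lim: "Lim \<in> borel_measurable traj_space"
      and L1: "\<And>n. (\<lambda>\<omega>. L1 (hist n \<omega>)) \<in> borel_measurable (fin_traj_space n)"
      and le: "\<And>h. L1 h \<le> ennreal C"
      and l: "\<And>\<omega>. (\<lambda>n. L1 (hist n \<omega>)) \<longlonglongrightarrow> Lim \<omega>"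
      and A: "(\<lambda>\<omega>. indicator A (hist n \<omega>) :: ennreal) \<in> borel_measurable (fin_traj_space n)"
    for \<sigma> Lim L1 n A
  proof -
    interpret prob_space "traj v \<sigma>" by (rule prob_space_traj[OF v \<sigma>])
    note [measurable] = meas[OF \<sigma> Lim] meas[OF \<sigma> measurable_hist_traj[OF A]]
      meas[OF \<sigma> measurable_hist_traj[OF L1]]
    have "(\<lambda>m. \<integral>\<^sup>+\<omega>. L1 (hist m \<omega>) * indicator A (hist n \<omega>) \<partial>traj v \<sigma>)
      \<longlonglongrightarrow> (\<integral>\<^sup>+\<omega>. Lim \<omega> * indicator A (hist n \<omega>) \<partial>traj v \<sigma>)"
    proof (rule nn_integral_dominated_convergence[where w = "\<lambda>_. ennreal C"])
      show "AE \<omega> in traj v \<sigma>. L1 (hist m \<omega>) * indicator A (hist n \<omega>) \<le> ennreal C" for m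
        using le by (auto simp: indicator_def)
      show "AE \<omega> in traj v \<sigma>. (\<lambda>m. L1 (hist m \<omega>) * indicator A (hist n \<omega>)) \<longlonglongrightarrow>
          Lim \<omega> * indicator A (hist n \<omega>)"
        using l by (auto simp: indicator_def)
      show "(\<integral>\<^sup>+\<omega>. ennreal C \<partial>traj v \<sigma>) < \<infinity>"
        by (simp add: emeasure_space_1)
    qed measurable
    then show ?thesis by (subst nn_integral_density) measurable
  qed
  show ?thesis
  proof (rule traj_space_measure_eqI)
    interpret prob_space "traj v \<pi>" by (rule prob_space_traj[OF v \<pi>])
    show "finite_measure (density (traj v \<pi>) L)"
    proof (rule finite_measureI)
      have "L \<omega> \<le> ennreal C" for \<omega>
        by (rule LIMSEQ_le_const2[OF lim(1)]) (use C in auto)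
      then have "(\<integral>\<^sup>+\<omega>. L \<omega> \<partial>traj v \<pi>) \<le> (\<integral>\<^sup>+\<omega>. ennreal C \<partial>traj v \<pi>)"
        by (intro nn_integral_mono)
      also have "\<dots> < \<infinity>" by (simp add: emeasure_space_1)
      finally show "emeasure (density (traj v \<pi>) L) (space (density (traj v \<pi>) L)) \<noteq> \<infinity>"
        using meas[OF \<pi> L(1)] by (simp add: emeasure_density cong: nn_integral_cong)
    qed
    fix n and A :: "'v move list set"
    assume A: "(\<lambda>\<omega>. indicator A (hist n \<omega>) :: ennreal) \<in> borel_measurable (fin_traj_space n)"
    \<comment> \<open>The event at time \<open>n\<close> is evaluated on the longer history by
      \<open>take n\<close>.\<close>
    have "(\<integral>\<^sup>+\<omega>. \<Lambda> (hist m \<omega>) * indicator A (hist n \<omega>) \<partial>traj v \<pi>) =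
        (\<integral>\<^sup>+\<omega>. \<Lambda>' (hist m \<omega>) * indicator A (hist n \<omega>) \<partial>traj v \<pi>')" if "n \<le> m" for m
      using nn_integral_traj_reweight[OF v \<pi> \<pi>' \<rho> \<rho>' \<Lambda> \<Lambda>' start prod dest arc,
          of "\<lambda>h. indicator A (take n h)" m] measurable_hist_prefix[OF A that] that
      by (simp add: take_hist)
    then have "(\<lambda>m. \<integral>\<^sup>+\<omega>. \<Lambda>' (hist m \<omega>) * indicator A (hist n \<omega>) \<partial>traj v \<pi>')
      \<longlonglongrightarrow> (\<integral>\<^sup>+\<omega>. indicator A (hist n \<omega>) \<partial>density (traj v \<pi>) L)"
      by (intro Lim_transform_eventually[OF conv[OF \<pi> L(1) \<Lambda> C(1) lim(1) A]])
         (auto simp: eventually_sequentially)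
    from LIMSEQ_unique[OF this conv[OF \<pi>' L(2) \<Lambda>' C(2) lim(2) A]]
    show "(\<integral>\<^sup>+\<omega>. indicator A (hist n \<omega>) \<partial>density (traj v \<pi>) L) =
        (\<integral>\<^sup>+\<omega>. indicator A (hist n \<omega>) \<partial>density (traj v \<pi>') L')" .
  qed (simp_all add: sets_traj[OF v \<pi>] sets_traj[OF v \<pi>'])
qed

section \<open>Laws that agree on part of the trajectories\<close>

definition rest_cost :: "nat \<Rightarrow> (nat \<Rightarrow> 'v move) \<Rightarrow> ennreal" where
  "rest_cost n \<omega> = (\<Sum>k. ennreal (snd (\<omega> (n + k))))"

lemma spent_hist: "spent (hist n \<omega>) = (\<Sum>k<n. snd (\<omega> k))"
  by (induction n) (simp_all add: hist_Suc, simp add: spent_def)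

lemma total_cost_split:
  assumes "\<And>k. 0 \<le> snd (\<omega> k)"
  shows "total_cost \<omega> = ennreal (spent (hist n \<omega>)) + rest_cost n \<omega>"
proof -
  have "total_cost \<omega> = (\<Sum>k. ennreal (snd (\<omega> (k + n)))) + (\<Sum>k<n. ennreal (snd (\<omega> k)))"
    unfolding total_cost_def by (rule suminf_offset) simp
  then show ?thesis
    using assms by (simp add: rest_cost_def spent_hist add.commute sum_nonneg)
qed

lemma (in adaptive_ssp) measurable_component_traj: "(\<lambda>\<omega>. \<omega> n) \<in> measurable traj_space move_space"
  using measurable_component_singleton[of n UNIV "\<lambda>_. move_space"] by simp

lemma (in adaptive_ssp) measurable_rest_cost: "rest_cost n \<in> borel_measurable traj_space"
proof -
  have [measurable]: "(\<lambda>\<omega>. snd (\<omega> k)) \<in> borel_measurable traj_space" for k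
    by (rule measurable_compose[OF measurable_component_traj measurable_cost])
  show ?thesis unfolding rest_cost_def[abs_def] by measurable
qed

lemma (in adaptive_ssp) measurable_total_cost: "total_cost \<in> borel_measurable traj_space"
  using measurable_rest_cost[of 0] by (simp add: rest_cost_def[abs_def] total_cost_def[abs_def])

lemma (in adaptive_ssp) measurable_payoff:
  assumes "f \<in> borel_measurable borel"
  shows "payoff f T \<in> borel_measurable traj_space"
proof -
  note [measurable] = assms measurable_total_cost
  show ?thesis unfolding payoff_def[abs_def] by measurable
qed

lemma (in adaptive_ssp) measurable_trajI: "v \<in> pverts G \<Longrightarrow> strategy v \<pi> \<Longrightarrow> f \<in> measurable traj_space N \<Longrightarrow> f \<in> measurable (traj v \<pi>) N"
  using measurable_cong_sets[OF sets_traj refl] by blast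

lemma (in adaptive_ssp) legal_move_cost_nonneg: "legal_move v \<pi> h m \<Longrightarrow> 0 \<le> snd m"
  using \<delta>_inf_pos by (fastforce simp: legal_move_def Let_def split: if_splits)

lemma (in adaptive_ssp) legal_move_dest: "legal_move v \<pi> h m \<Longrightarrow> cur_node v h = d \<Longrightarrow> m = (d, 0)"
  by (simp add: legal_move_def)

text \<open>Both one-step weights are the indicator of \<open>A\<close>. Closure under prefixes
  makes the indicator its own running product, and where a continuation leaves \<open>A\<close> both
  sides of the kernel identity are 0, so the strategies have to agree only at histories that can be
  continued inside \<open>A\<close>.\<close>

lemma (in adaptive_ssp) density_traj_agree:
  assumes v: "v \<in> pverts G" and \<pi>: "strategy v \<pi>" and \<pi>': "strategy v \<pi>'"
    and A: "\<And>n. Measurable.pred (fin_traj_space n) (\<lambda>\<omega>. hist n \<omega> \<in> A)"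
    and closed: "\<And>h m. h @ [m] \<in> A \<Longrightarrow> h \<in> A"
    and agree: "\<And>h m. h @ [m] \<in> A \<Longrightarrow> cur_node v h \<noteq> d \<Longrightarrow> \<pi> h = \<pi>' h"
  shows "density (traj v \<pi>) (indicator {\<omega>. \<forall>n. hist n \<omega> \<in> A}) =
    density (traj v \<pi>') (indicator {\<omega>. \<forall>n. hist n \<omega> \<in> A})"
proof -
  let ?\<Lambda> = "indicator A :: 'v move list \<Rightarrow> ennreal"
  let ?L = "indicator {\<omega>. \<forall>n. hist n \<omega> \<in> A} :: (nat \<Rightarrow> 'v move) \<Rightarrow> ennreal"
  have \<Lambda>: "(\<lambda>\<omega>. ?\<Lambda> (hist n \<omega>)) \<in> borel_measurable (fin_traj_space n)" for n
    using A[of n] by (simp add: indicator_def)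
  have prod: "?\<Lambda> (h @ [m]) = ?\<Lambda> h * ?\<Lambda> (h @ [m])" for h m
    using closed[of h m] by (cases "h @ [m] \<in> A") simp_all
  have arc: "ennreal (pmf (\<pi> h) j) * ?\<Lambda> (h @ [(j, c)]) = ennreal (pmf (\<pi>' h) j) * ?\<Lambda> (h @ [(j, c)])"
    if "cur_node v h \<noteq> d" for h j c
    using agree[OF _ that] by (auto simp: indicator_def)
  have [measurable]: "Measurable.pred traj_space (\<lambda>\<omega>. hist n \<omega> \<in> A)" for n
    by (rule measurable_hist_traj[OF A])
  have L: "?L \<in> borel_measurable traj_space"
    unfolding indicator_def[abs_def] by measurable
  \<comment> \<open>Once a trajectory has left \<open>A\<close> it stays outside, so the indicators
    are eventually constant.\<close>
  have lim: "(\<lambda>n. ?\<Lambda> (hist n \<omega>)) \<longlonglongrightarrow> ?L \<omega>" for \<omega>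
  proof (cases "\<forall>n. hist n \<omega> \<in> A")
    case False
    then obtain k where k: "hist k \<omega> \<notin> A" by blast
    have "hist n \<omega> \<notin> A" if "k \<le> n" for n
      using that k by (induction n rule: dec_induct) (auto simp: hist_Suc dest: closed)
    then have "\<forall>\<^sub>F n in sequentially. ?\<Lambda> (hist n \<omega>) = 0"
      unfolding eventually_sequentially by (intro exI[of _ k]) simp
    then show ?thesis using False by (auto intro: tendsto_eventually)
  qed simp
  have "?\<Lambda> h \<le> ennreal 1" for h by (simp add: indicator_def)
  from density_traj_reweight[OF v \<pi> \<pi>' \<Lambda> \<Lambda> \<Lambda> \<Lambda> refl prod prod refl arc this this L L lim lim]
  show ?thesis by simp
qed

section \<open>Strategies that agree up to a given time\<close>

lemma (in adaptive_ssp) nn_integral_hist_agree: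
  assumes v: "v \<in> pverts G" and \<pi>: "strategy v \<pi>" and \<pi>': "strategy v \<pi>'"
    and agree: "\<And>h. length h < n \<Longrightarrow> \<pi> h = \<pi>' h"
    and g: "(\<lambda>\<omega>. g (hist n \<omega>) :: ennreal) \<in> borel_measurable (fin_traj_space n)"
  shows "(\<integral>\<^sup>+\<omega>. g (hist n \<omega>) \<partial>traj v \<pi>) = (\<integral>\<^sup>+\<omega>. g (hist n \<omega>) \<partial>traj v \<pi>')"
proof -
  \<comment> \<open>Weight 0 beyond length \<open>n\<close> makes the weighted kernels equal also at
    the histories where the strategies may differ.\<close>
  let ?\<Lambda> = "\<lambda>h :: 'v move list. if length h \<le> n then 1 else 0 :: ennreal"
  from nn_integral_traj_reweight[OF v \<pi> \<pi>', where \<rho> = ?\<Lambda> and \<rho>' = ?\<Lambda> and \<Lambda> = ?\<Lambda> and \<Lambda>' = ?\<Lambda>, OF _ _ _ _ _ _ _ _ _ g]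
  show ?thesis using agree by simp
qed

text \<open>Equality of the laws of the first \<open>n\<close> moves, and not just of non-negative
  integrals, is what transfers integrability and integrals of signed functions.\<close>

lemma (in adaptive_ssp) distr_restrict_traj_agree:
  assumes v: "v \<in> pverts G" and \<pi>: "strategy v \<pi>" and \<pi>': "strategy v \<pi>'"
    and agree: "\<And>h. length h < n \<Longrightarrow> \<pi> h = \<pi>' h"
  shows "distr (traj v \<pi>) (fin_traj_space n) (\<lambda>\<omega>. restrict \<omega> {0..<n}) =
    distr (traj v \<pi>') (fin_traj_space n) (\<lambda>\<omega>. restrict \<omega> {0..<n})"
proof (rule measure_eqI)
  have restr: "(\<lambda>\<omega>. restrict \<omega> {0..<n}) \<in> measurable (traj v \<sigma>) (fin_traj_space n)"
    if "strategy v \<sigma>" for \<sigma>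
    by (intro measurable_trajI v that measurable_restrict_subset) auto
  fix A assume "A \<in> sets (distr (traj v \<pi>) (fin_traj_space n) (\<lambda>\<omega>. restrict \<omega> {0..<n}))"
  then have A: "A \<in> sets (fin_traj_space n)" by simp
  let ?g = "\<lambda>h. indicator A (\<lambda>k\<in>{0..<n}. h ! k) :: ennreal"
  have g: "?g (hist n \<omega>) = indicator A (restrict \<omega> {0..<n})" for \<omega>
    by (rule arg_cong[of _ _ "indicator A"]) (auto simp: nth_hist)
  have "(\<lambda>\<omega>. ?g (hist n \<omega>)) \<in> borel_measurable (fin_traj_space n)"
    unfolding g using A
    by (intro measurable_compose[OF measurable_restrict_subset borel_measurable_indicator]) auto
  then have "(\<integral>\<^sup>+\<omega>. ?g (hist n \<omega>) \<partial>traj v \<pi>) = (\<integral>\<^sup>+\<omega>. ?g (hist n \<omega>) \<partial>traj v \<pi>')"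
    by (intro nn_integral_hist_agree[where g = ?g] v \<pi> \<pi>' agree)
  moreover have "emeasure (distr (traj v \<sigma>) (fin_traj_space n) (\<lambda>\<omega>. restrict \<omega> {0..<n})) A =
      (\<integral>\<^sup>+\<omega>. ?g (hist n \<omega>) \<partial>traj v \<sigma>)" if "strategy v \<sigma>" for \<sigma>
    unfolding g using A nn_integral_distr[OF restr[OF that], of "indicator A"] by simp
  ultimately show "emeasure (distr (traj v \<pi>) (fin_traj_space n) (\<lambda>\<omega>. restrict \<omega> {0..<n})) A =
      emeasure (distr (traj v \<pi>') (fin_traj_space n) (\<lambda>\<omega>. restrict \<omega> {0..<n})) A"
    using \<pi> \<pi>' by simp
qed simp

lemma (in adaptive_ssp) integral_hist_agree:
  fixes g :: "'v move list \<Rightarrow> real"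
  assumes v: "v \<in> pverts G" and \<pi>: "strategy v \<pi>" and \<pi>': "strategy v \<pi>'"
    and agree: "\<And>h. length h < n \<Longrightarrow> \<pi> h = \<pi>' h"
    and g: "(\<lambda>\<omega>. g (hist n \<omega>)) \<in> borel_measurable (fin_traj_space n)"
  shows "integrable (traj v \<pi>) (\<lambda>\<omega>. g (hist n \<omega>)) \<longleftrightarrow> integrable (traj v \<pi>') (\<lambda>\<omega>. g (hist n \<omega>))"
    and "(\<integral>\<omega>. g (hist n \<omega>) \<partial>traj v \<pi>) = (\<integral>\<omega>. g (hist n \<omega>) \<partial>traj v \<pi>')"
proof -
  have restr: "(\<lambda>\<omega>. restrict \<omega> {0..<n}) \<in> measurable (traj v \<sigma>) (fin_traj_space n)"
    if "strategy v \<sigma>" for \<sigma>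
    by (intro measurable_trajI v that measurable_restrict_subset) auto
  note eq = distr_restrict_traj_agree[OF v \<pi> \<pi>' agree]
  show "integrable (traj v \<pi>) (\<lambda>\<omega>. g (hist n \<omega>)) \<longleftrightarrow> integrable (traj v \<pi>') (\<lambda>\<omega>. g (hist n \<omega>))"
    using integrable_distr_eq[OF restr[OF \<pi>] g] integrable_distr_eq[OF restr[OF \<pi>'] g] eq
    by (simp add: hist_restrict)
  show "(\<integral>\<omega>. g (hist n \<omega>) \<partial>traj v \<pi>) = (\<integral>\<omega>. g (hist n \<omega>) \<partial>traj v \<pi>')"
    using integral_distr[OF restr[OF \<pi>] g] integral_distr[OF restr[OF \<pi>'] g] eq
    by (simp add: hist_restrict)
qed

text \<open>When two strategies differ at time \<open>n\<close> only, the likelihood ratio of their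
  laws is that of the single move \<open>n\<close>, which is seen in the history of length
  \<open>Suc n\<close>.\<close>

lemma (in adaptive_ssp) traj_tilt:
  fixes w :: "'v move list \<Rightarrow> real"
  assumes v: "v \<in> pverts G" and \<pi>: "strategy v \<pi>" and \<pi>': "strategy v \<pi>'"
    and agree: "\<And>h. length h \<noteq> n \<Longrightarrow> \<pi> h = \<pi>' h"
    and w: "(\<lambda>\<omega>. w (hist (Suc n) \<omega>)) \<in> borel_measurable (fin_traj_space (Suc n))"
    and bounds: "\<And>h. 0 \<le> w h" "\<And>h. w h \<le> C"
    and dest: "\<And>h. length h = n \<Longrightarrow> cur_node v h = d \<Longrightarrow> w (h @ [(d, 0)]) = 1"
    and arc: "\<And>h j c. length h = n \<Longrightarrow> cur_node v h \<noteq> d \<Longrightarrow> (cur_node v h, j) \<in> parcs G \<Longrightarrow>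
      pmf (\<pi> h) j * w (h @ [(j, c)]) = pmf (\<pi>' h) j"
  shows "traj v \<pi>' = density (traj v \<pi>) (\<lambda>\<omega>. ennreal (w (hist (Suc n) \<omega>)))"
proof -
  \<comment> \<open>The weight enters at move \<open>n\<close> alone, so the running product is 1
    before it and constant after it; hence also the bound \<open>max 1 C\<close>.\<close>
  let ?\<rho> = "\<lambda>h. if length h = Suc n then ennreal (w h) else 1"
  let ?\<Lambda> = "\<lambda>h. if n < length h then ennreal (w (take (Suc n) h)) else 1"
  have \<rho>: "(\<lambda>\<omega>. ?\<rho> (hist m \<omega>)) \<in> borel_measurable (fin_traj_space m)" for m
    using w by (cases "m = Suc n") simp_all
  have \<Lambda>: "(\<lambda>\<omega>. ?\<Lambda> (hist m \<omega>)) \<in> borel_measurable (fin_traj_space m)" for m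
    using measurable_hist_prefix[OF w, of m] by (cases "n < m") (simp_all add: take_hist)
  have prod: "?\<Lambda> (h @ [m]) = ?\<Lambda> h * ?\<rho> (h @ [m])" for h m
    by (cases "length h" n rule: linorder_cases) auto
  have d: "?\<rho> (h @ [(d, 0)]) = 1" if "cur_node v h = d" for h
    using dest[OF _ that] by simp
  have a: "ennreal (pmf (\<pi> h) j) * ?\<rho> (h @ [(j, c)]) = ennreal (pmf (\<pi>' h) j) * 1"
    if "cur_node v h \<noteq> d" "(cur_node v h, j) \<in> parcs G" for h j c
    using arc[OF _ that] agree[of h] bounds(1) by (auto simp: ennreal_mult[symmetric])
  have C: "?\<Lambda> h \<le> ennreal (max 1 C)" "(1 :: ennreal) \<le> ennreal (max 1 C)" for h
    using bounds(2)[of "take (Suc n) h"] by (auto simp: ennreal_leI le_max_iff_disj simp flip: ennreal_1)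
  have L: "(\<lambda>\<omega>. ennreal (w (hist (Suc n) \<omega>))) \<in> borel_measurable traj_space"
    using measurable_hist_traj[OF w] by measurable
  have lim: "(\<lambda>m. ?\<Lambda> (hist m \<omega>)) \<longlonglongrightarrow> ennreal (w (hist (Suc n) \<omega>))" for \<omega>
    by (intro tendsto_eventually eventually_mono[OF eventually_gt_at_top[of n]]) (auto simp: take_hist)
  have "density (traj v \<pi>) (\<lambda>\<omega>. ennreal (w (hist (Suc n) \<omega>))) = density (traj v \<pi>') (\<lambda>_. 1)"
    by (rule density_traj_reweight[OF v \<pi> \<pi>' \<rho> _ \<Lambda> _ _ prod _ d a C L _ lim]) auto
  then show ?thesis by (simp add: density_1)
qed

section \<open>Payoffs that vanish below a threshold\<close>

lemma (in adaptive_ssp) payoff_eq_0: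
  assumes f: "\<And>t. t < T\<^sub>f \<Longrightarrow> f t = 0" and "T - T\<^sub>f < x" and x: "ennreal x \<le> total_cost \<omega>"
  shows "payoff f T \<omega> = 0"
proof (cases "total_cost \<omega> = \<infinity>")
  case True
  have "Liminf at_bot (\<lambda>t. ereal (f t)) = Liminf at_bot (\<lambda>t::real. 0 :: ereal)"
    by (rule Liminf_eq, rule eventually_mono[OF eventually_gt_at_bot[of T\<^sub>f]]) (simp add: f)
  then show ?thesis using True by (simp add: payoff_def Liminf_const)
next
  case False
  then have "x \<le> enn2real (total_cost \<omega>)"
    using x by (cases "total_cost \<omega>") (auto simp: ennreal_le_iff2)
  then show ?thesis using False f assms(2) by (simp add: payoff_def)
qed

lemma (in adaptive_ssp) optimal_of_payoff_eq_0:
  assumes "strategy v \<sigma>" "\<And>\<omega> :: nat \<Rightarrow> 'v move. payoff f T \<omega> = 0"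
  shows "optimal f T v \<sigma>"
  using assms
  by (simp add: optimal_def has_expected_payoff_def expected_payoff_def pos_part_def neg_part_def
      at_least_as_good_def zero_ennreal.rep_eq)

text \<open>The destination is absorbing under legal moves, so a legal sequence that does not end
  there has never visited it, as \<open>history\<close> demands.\<close>

lemma (in adaptive_ssp) history_of_legal:
  assumes legal: "\<And>k. k < length h \<Longrightarrow> legal_move v \<pi> (take k h) (h ! k)" and "cur_node v h \<noteq> d"
  shows "history v h"
proof -
  have cur: "cur_node v (take (Suc k) h) = fst (h ! k)" if "k < length h" for k
    using that by (simp add: take_Suc_conv_app_nth)
  have "cur_node v (take k h) \<noteq> d" if "k \<le> length h" for k
    using that
  proof (induction k rule: inc_induct)
    case (step k)
    then show ?case using cur[of k] legal_move_dest[OF legal[of k]] by auto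
  qed (use assms in simp)
  then show ?thesis
    using legal by (force simp: history_def legal_move_def Let_def)
qed

text \<open>Trajectories are split by whether they ever spend more than
  \<open>T - T\<^sub>f\<close>. If so, the payoff is 0; on the others the two laws coincide, because
  the strategies agree at every history within the allowance.\<close>

lemma (in adaptive_ssp) payoff_parts_agree:
  assumes v: "v \<in> pverts G" and \<pi>: "strategy v \<pi>" and \<pi>': "strategy v \<pi>'"
    and f: "\<And>t. t < T\<^sub>f \<Longrightarrow> f t = 0" and f_meas: "f \<in> borel_measurable borel"
    and agree: "\<And>h. history v h \<Longrightarrow> cur_node v h \<noteq> d \<Longrightarrow> spent h \<le> T - T\<^sub>f \<Longrightarrow> \<pi> h = \<pi>' h"
  shows "pos_part f T v \<pi> = pos_part f T v \<pi>'" "neg_part f T v \<pi> = neg_part f T v \<pi>'"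
proof -
  \<comment> \<open>Legality is included because agreement is assumed only at histories that can
    occur.\<close>
  define A where "A = {h. spent h \<le> T - T\<^sub>f \<and> (\<forall>k<length h. legal_move v \<pi> (take k h) (h ! k))}"
  define E where "E = {\<omega>. \<forall>n. hist n \<omega> \<in> A}"
  have A: "Measurable.pred (fin_traj_space n) (\<lambda>\<omega>. hist n \<omega> \<in> A)" for n
  proof -
    have legal: "Measurable.pred (fin_traj_space n) (\<lambda>\<omega>. legal_move v \<pi> (hist k \<omega>) (\<omega> k))"
      if "k \<in> {..<n}" for k
    proof -
      have "Measurable.pred (fin_traj_space (Suc k))
          (\<lambda>\<omega>. legal_move v \<pi> (butlast (hist (Suc k) \<omega>)) (last (hist (Suc k) \<omega>)))"
        using measurable_legal_move[OF v \<pi>, of k] by (simp add: hist_Suc)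
      from measurable_hist_prefix[where g = "\<lambda>h. legal_move v \<pi> (butlast h) (last h)", OF this, of n]
      show ?thesis using that by (simp add: hist_Suc Suc_le_eq)
    qed
    have sp: "Measurable.pred (fin_traj_space n) (\<lambda>\<omega>. spent (hist n \<omega>) \<le> T - T\<^sub>f)"
      using measurable_spent[of n] by measurable
    have "Measurable.pred (fin_traj_space n)
        (\<lambda>\<omega>. spent (hist n \<omega>) \<le> T - T\<^sub>f \<and> (\<forall>k\<in>{..<n}. legal_move v \<pi> (hist k \<omega>) (\<omega> k)))"
      by (intro pred_intros_logic(3) sp pred_intros_finite finite_lessThan legal)
    then show ?thesis by (simp add: A_def take_hist nth_hist Ball_def)
  qed
  have snoc: "h @ [m] \<in> A \<longleftrightarrow> h \<in> A \<and> legal_move v \<pi> h m \<and> spent h + snd m \<le> T - T\<^sub>f" for h m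
  proof -
    have "(\<forall>k<length (h @ [m]). legal_move v \<pi> (take k (h @ [m])) ((h @ [m]) ! k)) \<longleftrightarrow>
        (\<forall>k<length h. legal_move v \<pi> (take k h) (h ! k)) \<and> legal_move v \<pi> h m"
      by (auto simp: nth_append less_Suc_eq)
    then show ?thesis
      using legal_move_cost_nonneg[of v \<pi> h m] by (auto simp: A_def simp del: length_append)
  qed
  have agree_A: "\<pi> h = \<pi>' h" if "h \<in> A" "cur_node v h \<noteq> d" for h
    using that history_of_legal[of h v \<pi>] by (intro agree) (auto simp: A_def)
  have eq: "density (traj v \<pi>) (indicator E) = density (traj v \<pi>') (indicator E)"
    unfolding E_def using snoc agree_A by (intro density_traj_agree v \<pi> \<pi>' A) auto
  have off: "payoff f T \<omega> = 0"
    if legal: "\<And>n. legal_move v \<sigma> (hist n \<omega>) (\<omega> n)" and \<sigma>: "\<sigma> = \<pi> \<or> \<sigma> = \<pi>'" and "\<omega> \<notin> E" for \<sigma> \<omega>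
  proof -
    have "\<exists>n. T - T\<^sub>f < spent (hist n \<omega>)"
    proof (rule ccontr)
      assume "\<not> ?thesis"
      then have le: "spent (hist n \<omega>) \<le> T - T\<^sub>f" for n by (simp add: not_less)
      have "hist n \<omega> \<in> A" for n
      proof (induction n)
        case 0
        then show ?case using le[of 0] by (simp add: A_def)
      next
        case (Suc n)
        \<comment> \<open>\<open>A\<close> refers to legality under \<pi>, but inside
          \<open>A\<close> both strategies make the same choice, so moves legal under the other one
          are legal under \<pi> too.\<close>
        have "legal_move v \<pi> (hist n \<omega>) (\<omega> n)"
          using legal[of n] \<sigma> agree_A[OF Suc] by (auto simp: legal_move_def Let_def)
        then show ?case using Suc le[of "Suc n"] by (simp add: hist_Suc snoc)
      qed
      then show False using \<open>\<omega> \<notin> E\<close> by (simp add: E_def)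
    qed
    then obtain n where n: "T - T\<^sub>f < spent (hist n \<omega>)" by blast
    have "ennreal (spent (hist n \<omega>)) \<le> total_cost \<omega>"
      using total_cost_split[of \<omega> n] legal_move_cost_nonneg[OF legal] by simp
    from payoff_eq_0[OF f n this] show ?thesis .
  qed
  have [measurable]: "Measurable.pred traj_space (\<lambda>\<omega>. hist n \<omega> \<in> A)" for n
    by (rule measurable_hist_traj[OF A])
  have E: "(indicator E :: _ \<Rightarrow> ennreal) \<in> borel_measurable traj_space"
    unfolding indicator_def[abs_def] E_def by measurable
  have restrict: "(\<integral>\<^sup>+\<omega>. k (payoff f T \<omega>) \<partial>traj v \<sigma>) = (\<integral>\<^sup>+\<omega>. k (payoff f T \<omega>) \<partial>density (traj v \<sigma>) (indicator E))"
    if \<sigma>: "\<sigma> = \<pi> \<or> \<sigma> = \<pi>'" and k: "k 0 = 0" "k \<in> borel_measurable borel" for \<sigma> and k :: "ereal \<Rightarrow> ennreal"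
  proof -
    have s: "strategy v \<sigma>" using \<sigma> \<pi> \<pi>' by auto
    have "(\<integral>\<^sup>+\<omega>. k (payoff f T \<omega>) \<partial>traj v \<sigma>) = (\<integral>\<^sup>+\<omega>. indicator E \<omega> * k (payoff f T \<omega>) \<partial>traj v \<sigma>)"
    proof (rule nn_integral_cong_AE)
      show "AE \<omega> in traj v \<sigma>. k (payoff f T \<omega>) = indicator E \<omega> * k (payoff f T \<omega>)"
        using AE_legal_move[OF v s]
      proof eventually_elim
        case (elim \<omega>)
        then show ?case using off[of \<sigma> \<omega>] \<sigma> k(1) by (cases "\<omega> \<in> E") auto
      qed
    qed
    also have "\<dots> = (\<integral>\<^sup>+\<omega>. k (payoff f T \<omega>) \<partial>density (traj v \<sigma>) (indicator E))"
      by (intro nn_integral_density[symmetric] measurable_trajI[OF v s] E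
            measurable_compose[OF measurable_payoff[OF f_meas] k(2)])
    finally show ?thesis .
  qed
  show "pos_part f T v \<pi> = pos_part f T v \<pi>'"
    using restrict[of \<pi> e2ennreal] restrict[of \<pi>' e2ennreal] eq by (simp add: pos_part_def)
  show "neg_part f T v \<pi> = neg_part f T v \<pi>'"
    using restrict[of \<pi> "\<lambda>x. e2ennreal (- x)"] restrict[of \<pi>' "\<lambda>x. e2ennreal (- x)"] eq
    by (simp add: neg_part_def)
qed

section \<open>Cost plus remaining distance\<close>

text \<open>The partial sums of \<open>rest_cost\<close>, with the same termwise truncation at 0 by
  \<open>ennreal\<close>.\<close>

definition spent_since :: "nat \<Rightarrow> 'v move list \<Rightarrow> ennreal" where
  "spent_since n h = (\<Sum>m\<leftarrow>drop n h. ennreal (snd m))"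

lemma spent_since_snoc: "n \<le> length h \<Longrightarrow> spent_since n (h @ [m]) = spent_since n h + ennreal (snd m)"
  by (simp add: spent_since_def)

lemma spent_since_hist: "spent_since n (hist (n + m) \<omega>) = (\<Sum>k<m. ennreal (snd (\<omega> (n + k))))"
  by (induction m) (simp_all add: hist_Suc spent_since_snoc, simp add: spent_since_def)

lemma spent_since_le_rest_cost: "spent_since n (hist (n + m) \<omega>) \<le> rest_cost n \<omega>"
  unfolding spent_since_hist rest_cost_def by (rule sum_le_suminf) auto

lemma (in adaptive_ssp) sum_pmf_succs:
  assumes "set_pmf q \<subseteq> succs i"
  shows "(\<Sum>j\<in>succs i. ennreal (pmf q j)) = 1"
  using sum_pmf_eq_1[OF finite_succs assms] by simp

text \<open>
  The lookahead is at least the current distance, with equality on the tree: this is the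
  (sub)martingale property of cost plus remaining distance.
\<close>

definition (in adaptive_ssp) lookahead :: "'v \<Rightarrow> 'v strategy \<Rightarrow> 'v move list \<Rightarrow> ennreal" where
  "lookahead v \<pi> h =
     (if cur_node v h = d then 0
      else \<Sum>j\<in>succs (cur_node v h).
             ennreal (pmf (\<pi> h) j) * ennreal (mean_cost (cur_node v h, j) + dist_dest j))"

lemma (in adaptive_ssp) strategy_supp:
  "strategy v \<pi> \<Longrightarrow> cur_node v h \<in> pverts G \<Longrightarrow> cur_node v h \<noteq> d \<Longrightarrow> set_pmf (\<pi> h) \<subseteq> succs (cur_node v h)"
  by (simp add: strategy_def)

lemma (in adaptive_ssp) lookahead_ge:
  assumes \<pi>: "strategy v \<pi>" and cur: "cur_node v h \<in> pverts G" "cur_node v h \<noteq> d"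
    and x: "\<And>j. j \<in> set_pmf (\<pi> h) \<Longrightarrow> x \<le> mean_cost (cur_node v h, j) + dist_dest j"
  shows "ennreal x \<le> lookahead v \<pi> h"
proof -
  have "ennreal x = (\<Sum>j\<in>succs (cur_node v h). ennreal (pmf (\<pi> h) j) * ennreal x)"
    by (simp add: sum_distrib_right[symmetric] sum_pmf_succs strategy_supp[OF \<pi> cur] del: sum_ennreal)
  also have "\<dots> \<le> lookahead v \<pi> h"
  proof -
    have "ennreal (pmf (\<pi> h) j) * ennreal x \<le>
        ennreal (pmf (\<pi> h) j) * ennreal (mean_cost (cur_node v h, j) + dist_dest j)" for j
      using x[of j] by (cases "j \<in> set_pmf (\<pi> h)") (auto intro: mult_left_mono ennreal_leI simp: set_pmf_iff)
    then show ?thesis using cur by (simp add: lookahead_def sum_mono)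
  qed
  finally show ?thesis .
qed

lemma (in adaptive_ssp) dist_dest_le_lookahead:
  assumes \<pi>: "strategy v \<pi>" and cur: "cur_node v h \<in> pverts G"
  shows "ennreal (dist_dest (cur_node v h)) \<le> lookahead v \<pi> h"
proof (cases "cur_node v h = d")
  case False
  then show ?thesis
    using strategy_supp[OF \<pi> cur False]
    by (intro lookahead_ge \<pi> cur dist_dest_triangle) (auto simp: succs_def)
qed (simp add: lookahead_def)

lemma (in adaptive_ssp) lookahead_tree:
  assumes \<pi>: "strategy v \<pi>" and cur: "cur_node v h \<in> pverts G"
    and tree: "cur_node v h \<noteq> d \<Longrightarrow> set_pmf (\<pi> h) \<subseteq> sp_tree (cur_node v h)"
  shows "lookahead v \<pi> h = ennreal (dist_dest (cur_node v h))"
proof (cases "cur_node v h = d")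
  case False
  have "ennreal (pmf (\<pi> h) j) * ennreal (mean_cost (cur_node v h, j) + dist_dest j) =
      ennreal (pmf (\<pi> h) j) * ennreal (dist_dest (cur_node v h))" for j
    using tree[OF False] sp_tree_iff[OF cur, of j] by (cases "j \<in> set_pmf (\<pi> h)") (auto simp: set_pmf_iff)
  then show ?thesis
    using False
    by (simp add: lookahead_def sum_distrib_right[symmetric] sum_pmf_succs strategy_supp[OF \<pi> cur]
          del: sum_ennreal)
qed (simp add: lookahead_def)

text \<open>The fresh cost enters linearly, so only its mean survives the integration. The factor
  \<open>W\<close> is frozen at time \<open>n\<close> and acts as a weight on the first
  \<open>n\<close> moves.\<close>

lemma (in adaptive_ssp) next_val_potential:
  assumes \<pi>: "strategy v \<pi>" and cur: "cur_node v h \<in> pverts G" and n: "n \<le> length h"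
  shows "next_val v \<pi> (\<lambda>h. W (take n h) * (spent_since n h + ennreal (dist_dest (cur_node v h)))) h =
    W (take n h) * (spent_since n h + lookahead v \<pi> h)"
proof (cases "cur_node v h = d")
  case True
  then show ?thesis using n by (simp add: next_val_def lookahead_def spent_since_snoc)
next
  case False
  let ?i = "cur_node v h"
  have "(\<integral>\<^sup>+c. W (take n h) * (spent_since n h + ennreal c + ennreal (dist_dest j)) \<partial>p (?i, j)) =
      W (take n h) * (spent_since n h + ennreal (mean_cost (?i, j) + dist_dest j))"
    if j: "(?i, j) \<in> parcs G" for j
  proof -
    interpret prob_space "p (?i, j)" using prob_space_p[OF j] .
    note [measurable_cong] = sets_p[OF j]
    have "(\<integral>\<^sup>+c. W (take n h) * (spent_since n h + ennreal c + ennreal (dist_dest j)) \<partial>p (?i, j)) =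
        W (take n h) * (spent_since n h + (\<integral>\<^sup>+c. ennreal c \<partial>p (?i, j)) + ennreal (dist_dest j))"
      by (simp add: nn_integral_cmult nn_integral_add emeasure_space_1)
    also have "\<dots> = W (take n h) * (spent_since n h + ennreal (mean_cost (?i, j) + dist_dest j))"
      using mean_cost_bounds(2)[OF j] dist_dest_nonneg in_arcsD2[OF j]
      by (simp add: nn_integral_cost[OF j] ennreal_plus add.assoc)
    finally show ?thesis .
  qed
  then have "next_val v \<pi> (\<lambda>h. W (take n h) * (spent_since n h + ennreal (dist_dest (cur_node v h)))) h =
      (\<Sum>j\<in>succs ?i. ennreal (pmf (\<pi> h) j) *
         (W (take n h) * (spent_since n h + ennreal (mean_cost (?i, j) + dist_dest j))))"
    using False n by (simp add: next_val_def spent_since_snoc succs_def)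
  also have "\<dots> = W (take n h) * ((\<Sum>j\<in>succs ?i. ennreal (pmf (\<pi> h) j)) * spent_since n h + lookahead v \<pi> h)"
    using False
    by (simp add: lookahead_def sum_distrib_left sum_distrib_right sum.distrib distrib_left ac_simps
          del: sum_ennreal)
  finally show ?thesis by (simp add: sum_pmf_succs strategy_supp[OF \<pi> cur False] del: sum_ennreal)
qed

lemma (in adaptive_ssp) measurable_spent_since:
  "(\<lambda>\<omega>. spent_since n (hist (n + m) \<omega>)) \<in> borel_measurable (fin_traj_space (n + m))"
  unfolding spent_since_hist
  by (intro borel_measurable_sum measurable_compose[OF measurable_compose[OF measurable_move measurable_cost]
        measurable_ennreal]) auto

lemma (in adaptive_ssp) measurable_fun_cur_node:
  assumes "v \<in> pverts G"
  shows "(\<lambda>\<omega>. F (cur_node v (hist n \<omega>)) :: 'b :: topological_space) \<in> borel_measurable (fin_traj_space n)"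
  by (rule measurable_compose[OF measurable_cur_node[OF assms]]) simp

lemma (in adaptive_ssp) nn_integral_potential_Suc:
  assumes v: "v \<in> pverts G" and \<pi>: "strategy v \<pi>"
    and W: "(\<lambda>\<omega>. W (hist n \<omega>) :: ennreal) \<in> borel_measurable (fin_traj_space n)"
  shows "(\<integral>\<^sup>+\<omega>. W (hist n \<omega>) * (spent_since n (hist (n + Suc m) \<omega>)
        + ennreal (dist_dest (cur_node v (hist (n + Suc m) \<omega>)))) \<partial>traj v \<pi>) =
    (\<integral>\<^sup>+\<omega>. W (hist n \<omega>) * (spent_since n (hist (n + m) \<omega>) + lookahead v \<pi> (hist (n + m) \<omega>)) \<partial>traj v \<pi>)"
proof -
  let ?g = "\<lambda>h. W (take n h) * (spent_since n h + ennreal (dist_dest (cur_node v h)))"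
  note [measurable] = measurable_hist_prefix[OF W le_add1[of n "Suc m"]]
    measurable_spent_since[of n "Suc m"]
    measurable_fun_cur_node[OF v, of "\<lambda>i. ennreal (dist_dest i)" "n + Suc m"]
  have "(\<lambda>\<omega>. ?g (hist (n + Suc m) \<omega>)) \<in> borel_measurable (fin_traj_space (n + Suc m))"
    unfolding take_hist[OF le_add1] by measurable
  then have "(\<integral>\<^sup>+\<omega>. ?g (hist (n + Suc m) \<omega>) \<partial>traj v \<pi>) = (\<integral>\<^sup>+\<omega>. next_val v \<pi> ?g (hist (n + m) \<omega>) \<partial>traj v \<pi>)"
    using traj_step[OF v \<pi>, of ?g "n + m"] by simp
  also have "\<dots> = (\<integral>\<^sup>+\<omega>. W (hist n \<omega>) * (spent_since n (hist (n + m) \<omega>) + lookahead v \<pi> (hist (n + m) \<omega>)) \<partial>traj v \<pi>)"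
  proof (rule nn_integral_cong)
    fix \<omega> assume "\<omega> \<in> space (traj v \<pi>)"
    then have "cur_node v (hist (n + m) \<omega>) \<in> pverts G"
      using cur_node_in_verts[OF v] by (simp add: space_traj[OF v \<pi>])
    from next_val_potential[OF \<pi> this, of n W]
    show "next_val v \<pi> ?g (hist (n + m) \<omega>) =
        W (hist n \<omega>) * (spent_since n (hist (n + m) \<omega>) + lookahead v \<pi> (hist (n + m) \<omega>))"
      by (simp add: take_hist)
  qed
  finally show ?thesis by (simp add: take_hist)
qed

lemma (in adaptive_ssp) cur_node_dest_absorbing:
  assumes legal: "\<And>k. legal_move v \<pi> (hist k \<omega>) (\<omega> k)" and "k \<le> m" "cur_node v (hist m \<omega>) \<noteq> d"
  shows "cur_node v (hist k \<omega>) \<noteq> d"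
  using assms(2,3)
proof (induction k rule: inc_induct)
  case (step k)
  then show ?case using legal_move_dest[OF legal[of k]] by (auto simp: cur_node_hist_Suc)
qed

text \<open>The weighted potential gains \<epsilon> at the arc off the tree and does not decrease
  afterwards. To replace it by the cost alone in the limit, the distance still ahead is bounded by a
  vanishing fraction of the cost incurred. A relative error is used because \<open>W\<close> need
  not be integrable.\<close>

lemma (in adaptive_ssp) nn_integral_rest_cost_ge:
  assumes v: "v \<in> pverts G" and \<pi>: "strategy v \<pi>"
    and W: "(\<lambda>\<omega>. W (hist n \<omega>) :: ennreal) \<in> borel_measurable (fin_traj_space n)"
    and gap: "\<And>i j. (i, j) \<in> parcs G \<Longrightarrow> j \<notin> sp_tree i \<Longrightarrow> dist_dest i + \<epsilon> \<le> mean_cost (i, j) + dist_dest j"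
    and off: "\<And>h. length h = n \<Longrightarrow> W h \<noteq> 0 \<Longrightarrow> cur_node v h \<noteq> d \<and> set_pmf (\<pi> h) \<inter> sp_tree (cur_node v h) = {}"
  shows "(\<integral>\<^sup>+\<omega>. W (hist n \<omega>) * ennreal (dist_dest (cur_node v (hist n \<omega>)) + \<epsilon>) \<partial>traj v \<pi>) \<le>
    (\<integral>\<^sup>+\<omega>. W (hist n \<omega>) * rest_cost n \<omega> \<partial>traj v \<pi>)"
    (is "?a \<le> ?I")
proof (cases "?I = \<infinity>")
  case False
  define \<Phi> where "\<Phi> m = (\<integral>\<^sup>+\<omega>. W (hist n \<omega>) * (spent_since n (hist (n + m) \<omega>)
      + ennreal (dist_dest (cur_node v (hist (n + m) \<omega>)))) \<partial>traj v \<pi>)" for m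
  have cur: "cur_node v (hist m \<omega>) \<in> pverts G" if "\<omega> \<in> space (traj v \<pi>)" for m \<omega>
    using that cur_node_in_verts[OF v] by (simp add: space_traj[OF v \<pi>])
  have "?a \<le> \<Phi> (Suc 0)"
    unfolding \<Phi>_def nn_integral_potential_Suc[OF v \<pi> W]
  proof (rule nn_integral_mono)
    fix \<omega> assume \<omega>: "\<omega> \<in> space (traj v \<pi>)"
    show "W (hist n \<omega>) * ennreal (dist_dest (cur_node v (hist n \<omega>)) + \<epsilon>) \<le>
        W (hist n \<omega>) * (spent_since n (hist (n + 0) \<omega>) + lookahead v \<pi> (hist (n + 0) \<omega>))"
    proof (cases "W (hist n \<omega>) = 0")
      case False
      note off' = off[OF length_hist False]
      have "ennreal (dist_dest (cur_node v (hist n \<omega>)) + \<epsilon>) \<le> lookahead v \<pi> (hist n \<omega>)"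
        using off' strategy_supp[OF \<pi> cur[OF \<omega>, of n]]
        by (intro lookahead_ge \<pi> cur[OF \<omega>] gap) (auto simp: succs_def)
      then show ?thesis by (intro mult_left_mono) (auto intro: add_increasing)
    qed simp
  qed
  moreover have "\<Phi> m \<le> \<Phi> (Suc m)" for m
    unfolding \<Phi>_def nn_integral_potential_Suc[OF v \<pi> W]
    by (intro nn_integral_mono mult_left_mono add_left_mono dist_dest_le_lookahead \<pi> cur) auto
  ultimately have \<Phi>: "?a \<le> \<Phi> (Suc m)" for m
    using lift_Suc_mono_le[of \<Phi> "Suc 0" "Suc m"] by (force intro: order.trans)
  obtain \<delta> \<Delta> K where \<delta>: "0 < \<delta>" and K: "0 \<le> K"
    and \<delta>_le: "\<And>e. e \<in> parcs G \<Longrightarrow> \<delta> \<le> \<delta>_inf e" and dist_le: "\<And>i. i \<in> pverts G \<Longrightarrow> dist_dest i \<le> K"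
    using uniform_bounds by metis
  have "\<Phi> (Suc m) \<le> ?I * (1 + ennreal (K / \<delta> / real (Suc m)))" for m
  proof -
    have "\<Phi> (Suc m) \<le> (\<integral>\<^sup>+\<omega>. (W (hist n \<omega>) * rest_cost n \<omega>) * (1 + ennreal (K / \<delta> / real (Suc m))) \<partial>traj v \<pi>)"
      unfolding \<Phi>_def
    proof (rule nn_integral_mono_AE)
      show "AE \<omega> in traj v \<pi>. W (hist n \<omega>) * (spent_since n (hist (n + Suc m) \<omega>)
            + ennreal (dist_dest (cur_node v (hist (n + Suc m) \<omega>)))) \<le>
          (W (hist n \<omega>) * rest_cost n \<omega>) * (1 + ennreal (K / \<delta> / real (Suc m)))"
        using AE_legal_move[OF v \<pi>] AE_space
      proof eventually_elim
        case (elim \<omega>)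
        let ?S = "spent_since n (hist (n + Suc m) \<omega>)" and ?i = "cur_node v (hist (n + Suc m) \<omega>)"
        \<comment> \<open>Either the destination is reached and the distance is 0, or all
          \<open>Suc m\<close> moves since time \<open>n\<close> crossed arcs and cost at least
          \<delta> each, while the distance is at most \<open>K\<close>.\<close>
        have "ennreal (dist_dest ?i) \<le> ?S * ennreal (K / \<delta> / real (Suc m))"
        proof (cases "?i = d")
          case False
          have "\<delta> \<le> snd (\<omega> (n + k))" if "k < Suc m" for k
          proof -
            have "cur_node v (hist (n + k) \<omega>) \<noteq> d"
              using cur_node_dest_absorbing[of v \<pi> \<omega> "n + k" "n + Suc m"] elim(1) False that by simp
            then show ?thesis
              using spec[OF elim(1), of "n + k"] \<delta>_le by (force simp: legal_move_def Let_def)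
          qed
          then have "(\<Sum>k<Suc m. ennreal \<delta>) \<le> ?S"
            unfolding spent_since_hist by (intro sum_mono ennreal_leI) auto
          then have "ennreal (real (Suc m) * \<delta>) \<le> ?S"
            using \<delta> by (simp add: ennreal_mult ennreal_of_nat_eq_real_of_nat del: of_nat_Suc)
          then have "ennreal (real (Suc m) * \<delta>) * ennreal (K / \<delta> / real (Suc m)) \<le>
              ?S * ennreal (K / \<delta> / real (Suc m))"
            by (rule mult_right_mono) simp
          moreover have "ennreal (real (Suc m) * \<delta>) * ennreal (K / \<delta> / real (Suc m)) = ennreal K"
            using \<delta> K by (subst ennreal_mult[symmetric]) auto
          ultimately show ?thesis
            using dist_le[OF cur[OF elim(2), of "n + Suc m"]] ennreal_leI order.trans by metis
        qed simp
        then have "?S + ennreal (dist_dest ?i) \<le> ?S * (1 + ennreal (K / \<delta> / real (Suc m)))"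
          by (simp add: distrib_left add_left_mono)
        also have "\<dots> \<le> rest_cost n \<omega> * (1 + ennreal (K / \<delta> / real (Suc m)))"
          by (intro mult_right_mono spent_since_le_rest_cost) simp
        finally show ?case by (simp add: mult.assoc mult_left_mono)
      qed
    qed
    also have "\<dots> = ?I * (1 + ennreal (K / \<delta> / real (Suc m)))"
      using measurable_trajI[OF v \<pi> measurable_hist_traj[OF W]] measurable_trajI[OF v \<pi> measurable_rest_cost]
      by (intro nn_integral_multc) measurable
    finally show ?thesis .
  qed
  with \<Phi> have le: "?a \<le> ?I * (1 + ennreal (K / \<delta> / real (Suc m)))" for m
    using order.trans by blast
  have "(\<lambda>m. K / \<delta> / real (Suc m)) \<longlonglongrightarrow> 0"
    using LIMSEQ_Suc[OF lim_const_over_n[of "K / \<delta>"]] .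
  then have "(\<lambda>m. ?I * (1 + ennreal (K / \<delta> / real (Suc m)))) \<longlonglongrightarrow> ?I * (1 + ennreal 0)"
    using False by (intro ennreal_tendsto_cmult tendsto_add tendsto_const tendsto_ennrealI) (auto simp: less_top)
  from LIMSEQ_le_const[OF this] show ?thesis using le by simp
qed simp

text \<open>On the tree the weighted potential is constant in time; dropping the distance still
  ahead bounds every partial sum of the expected cost by its initial value.\<close>

lemma (in adaptive_ssp) nn_integral_rest_cost_tree_le:
  assumes v: "v \<in> pverts G" and \<pi>: "strategy v \<pi>"
    and W: "(\<lambda>\<omega>. W (hist n \<omega>) :: ennreal) \<in> borel_measurable (fin_traj_space n)"
    and tree: "\<And>h. n \<le> length h \<Longrightarrow> W (take n h) \<noteq> 0 \<Longrightarrow> cur_node v h \<in> pverts G \<Longrightarrow> cur_node v h \<noteq> d \<Longrightarrow>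
      set_pmf (\<pi> h) \<subseteq> sp_tree (cur_node v h)"
  shows "(\<integral>\<^sup>+\<omega>. W (hist n \<omega>) * rest_cost n \<omega> \<partial>traj v \<pi>) \<le>
    (\<integral>\<^sup>+\<omega>. W (hist n \<omega>) * ennreal (dist_dest (cur_node v (hist n \<omega>))) \<partial>traj v \<pi>)"
proof -
  have cur: "cur_node v (hist m \<omega>) \<in> pverts G" if "\<omega> \<in> space (traj v \<pi>)" for m \<omega>
    using that cur_node_in_verts[OF v] by (simp add: space_traj[OF v \<pi>])
  have \<Phi>: "(\<integral>\<^sup>+\<omega>. W (hist n \<omega>) * (spent_since n (hist (n + m) \<omega>)
        + ennreal (dist_dest (cur_node v (hist (n + m) \<omega>)))) \<partial>traj v \<pi>) =
      (\<integral>\<^sup>+\<omega>. W (hist n \<omega>) * ennreal (dist_dest (cur_node v (hist n \<omega>))) \<partial>traj v \<pi>)" for m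
  proof (induction m)
    case 0
    then show ?case by (simp add: spent_since_def)
  next
    case (Suc m)
    show ?case
      unfolding nn_integral_potential_Suc[OF v \<pi> W] Suc[symmetric]
    proof (rule nn_integral_cong)
      fix \<omega> assume "\<omega> \<in> space (traj v \<pi>)"
      then have c: "cur_node v (hist (n + m) \<omega>) \<in> pverts G" by (rule cur)
      show "W (hist n \<omega>) * (spent_since n (hist (n + m) \<omega>) + lookahead v \<pi> (hist (n + m) \<omega>)) =
        W (hist n \<omega>) * (spent_since n (hist (n + m) \<omega>) + ennreal (dist_dest (cur_node v (hist (n + m) \<omega>))))"
        using lookahead_tree[OF \<pi> c] tree[OF _ _ c] by (cases "W (hist n \<omega>) = 0") (auto simp: take_hist)
    qed
  qed
  have [measurable]: "(\<lambda>\<omega>. snd (\<omega> k)) \<in> borel_measurable (traj v \<pi>)" for k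
    by (intro measurable_trajI v \<pi> measurable_compose[OF measurable_component_traj measurable_cost])
  note [measurable] = measurable_trajI[OF v \<pi> measurable_hist_traj[OF W]]
  have "(\<integral>\<^sup>+\<omega>. W (hist n \<omega>) * rest_cost n \<omega> \<partial>traj v \<pi>) =
      (\<Sum>k. \<integral>\<^sup>+\<omega>. W (hist n \<omega>) * ennreal (snd (\<omega> (n + k))) \<partial>traj v \<pi>)"
    unfolding rest_cost_def ennreal_suminf_cmult[symmetric]
    by (intro nn_integral_suminf) measurable
  also have "\<dots> \<le> (\<integral>\<^sup>+\<omega>. W (hist n \<omega>) * ennreal (dist_dest (cur_node v (hist n \<omega>))) \<partial>traj v \<pi>)"
  proof (rule suminf_le_const)
    fix m
    have "(\<Sum>k<m. \<integral>\<^sup>+\<omega>. W (hist n \<omega>) * ennreal (snd (\<omega> (n + k))) \<partial>traj v \<pi>) =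
        (\<integral>\<^sup>+\<omega>. W (hist n \<omega>) * spent_since n (hist (n + m) \<omega>) \<partial>traj v \<pi>)"
      unfolding spent_since_hist sum_distrib_left
      by (intro nn_integral_sum[symmetric]) measurable
    also have "\<dots> \<le> (\<integral>\<^sup>+\<omega>. W (hist n \<omega>) * (spent_since n (hist (n + m) \<omega>)
        + ennreal (dist_dest (cur_node v (hist (n + m) \<omega>)))) \<partial>traj v \<pi>)"
      by (intro nn_integral_mono mult_left_mono) auto
    finally show "(\<Sum>k<m. \<integral>\<^sup>+\<omega>. W (hist n \<omega>) * ennreal (snd (\<omega> (n + k))) \<partial>traj v \<pi>) \<le>
        (\<integral>\<^sup>+\<omega>. W (hist n \<omega>) * ennreal (dist_dest (cur_node v (hist n \<omega>))) \<partial>traj v \<pi>)"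
      unfolding \<Phi> .
  qed simp
  finally show ?thesis .
qed

text \<open>Along the tree each arc costs at most a fixed multiple of the decrease of the distance.\<close>

lemma (in adaptive_ssp) rest_cost_tree_bounded:
  obtains B where "0 \<le> B"
    "\<And>v \<pi> \<omega> n. v \<in> pverts G \<Longrightarrow> \<omega> \<in> space traj_space \<Longrightarrow> (\<And>k. legal_move v \<pi> (hist k \<omega>) (\<omega> k)) \<Longrightarrow>
      (\<And>k. n \<le> k \<Longrightarrow> cur_node v (hist k \<omega>) \<noteq> d \<Longrightarrow> set_pmf (\<pi> (hist k \<omega>)) \<subseteq> sp_tree (cur_node v (hist k \<omega>))) \<Longrightarrow>
      rest_cost n \<omega> \<le> ennreal B"
proof -
  obtain \<delta> \<Delta> K where \<delta>: "0 < \<delta>" "\<delta> \<le> \<Delta>" and K: "0 \<le> K"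
    and \<delta>_le: "\<And>e. e \<in> parcs G \<Longrightarrow> \<delta> \<le> \<delta>_inf e" and \<Delta>_ge: "\<And>e. e \<in> parcs G \<Longrightarrow> \<delta>_sup e \<le> \<Delta>"
    and dist_le: "\<And>i. i \<in> pverts G \<Longrightarrow> dist_dest i \<le> K"
    using uniform_bounds by metis
  \<comment> \<open>A tree arc reduces the distance by its mean cost, which is at least \<delta>,
    and costs at most \<Delta>, hence the factor \<open>\<Delta> / \<delta>\<close>; the reductions
    telescope to at most \<open>K\<close>. The bound holds on each path, not only in
    expectation.\<close>
  show ?thesis
  proof (rule that[of "\<Delta> / \<delta> * K"])
    fix v \<pi> \<omega> n
    assume v: "v \<in> pverts G" and \<omega>: "\<omega> \<in> space traj_space"
      and legal: "\<And>k. legal_move v \<pi> (hist k \<omega>) (\<omega> k)"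
      and tree: "\<And>k. n \<le> k \<Longrightarrow> cur_node v (hist k \<omega>) \<noteq> d \<Longrightarrow>
        set_pmf (\<pi> (hist k \<omega>)) \<subseteq> sp_tree (cur_node v (hist k \<omega>))"
    note cur = cur_node_in_verts[OF v \<omega>]
    let ?D = "\<lambda>k. dist_dest (cur_node v (hist k \<omega>))"
    have step: "snd (\<omega> k) \<le> \<Delta> / \<delta> * (?D k - ?D (Suc k))" if "n \<le> k" for k
    proof (cases "cur_node v (hist k \<omega>) = d")
      case True
      then show ?thesis using legal_move_dest[OF legal[of k]] by (simp add: cur_node_hist_Suc)
    next
      case False
      let ?e = "(cur_node v (hist k \<omega>), fst (\<omega> k))"
      have e: "?e \<in> parcs G" "snd (\<omega> k) \<le> \<delta>_sup ?e" "fst (\<omega> k) \<in> sp_tree (cur_node v (hist k \<omega>))"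
        using legal[of k] tree[OF that False] False by (auto simp: legal_move_def Let_def)
      have "mean_cost ?e = ?D k - ?D (Suc k)"
        using e(3) sp_tree_iff[OF cur] by (simp add: cur_node_hist_Suc)
      moreover have "\<delta> \<le> mean_cost ?e"
        using mean_cost_bounds(1)[OF e(1)] \<delta>_le[OF e(1)] by simp
      then have "\<Delta> / \<delta> * \<delta> \<le> \<Delta> / \<delta> * mean_cost ?e"
        using \<delta> by (intro mult_left_mono) auto
      ultimately show ?thesis using e(2) \<Delta>_ge[OF e(1)] \<delta> by simp
    qed
    have "rest_cost n \<omega> = (\<Sum>k. ennreal (snd (\<omega> (n + k))))" by (simp add: rest_cost_def)
    also have "\<dots> \<le> ennreal (\<Delta> / \<delta> * K)"
    proof (rule suminf_le_const)
      fix m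
      have "(\<Sum>k<m. ennreal (snd (\<omega> (n + k)))) = ennreal (\<Sum>k<m. snd (\<omega> (n + k)))"
        using legal_move_cost_nonneg[OF legal] by (intro sum_ennreal) auto
      also have "(\<Sum>k<m. snd (\<omega> (n + k))) \<le> (\<Sum>k<m. \<Delta> / \<delta> * (?D (n + k) - ?D (n + Suc k)))"
        using step by (intro sum_mono) auto
      also have "\<dots> = \<Delta> / \<delta> * (?D n - ?D (n + m))"
        unfolding sum_distrib_left[symmetric] by (induction m) (auto simp: algebra_simps)
      also have "\<dots> \<le> \<Delta> / \<delta> * K"
        using \<delta> dist_le[OF cur, of n] dist_dest_nonneg[OF cur, of "n + m"] by (intro mult_left_mono) auto
      finally show "(\<Sum>k<m. ennreal (snd (\<omega> (n + k)))) \<le> ennreal (\<Delta> / \<delta> * K)"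
        by (simp add: ennreal_leI)
    qed simp
    finally show "rest_cost n \<omega> \<le> ennreal (\<Delta> / \<delta> * K)" .
  qed (use \<delta> K in auto)
qed

section \<open>Comparison of a detour with the tree\<close>

lemma (in adaptive_ssp) expected_payoff_eq_integral:
  fixes \<pi> :: "'v strategy"
  assumes fin: "AE \<omega> in traj v \<pi>. total_cost \<omega> \<noteq> \<infinity>"
    and int: "integrable (traj v \<pi>) (\<lambda>\<omega>. f (T - enn2real (total_cost \<omega>)))"
  shows "has_expected_payoff f T v \<pi>"
    "expected_payoff f T v \<pi> = ereal (\<integral>\<omega>. f (T - enn2real (total_cost \<omega>)) \<partial>traj v \<pi>)"
proof -
  let ?F = "\<lambda>\<omega> :: nat \<Rightarrow> 'v move. f (T - enn2real (total_cost \<omega>))"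
  have pos: "pos_part f T v \<pi> = (\<integral>\<^sup>+\<omega>. ennreal (?F \<omega>) \<partial>traj v \<pi>)"
    unfolding pos_part_def
    by (rule nn_integral_cong_AE, use fin in eventually_elim) (simp add: payoff_def)
  have neg: "neg_part f T v \<pi> = (\<integral>\<^sup>+\<omega>. ennreal (- ?F \<omega>) \<partial>traj v \<pi>)"
    unfolding neg_part_def
    by (rule nn_integral_cong_AE, use fin in eventually_elim) (simp add: payoff_def)
  have finite: "pos_part f T v \<pi> \<noteq> \<infinity>" "neg_part f T v \<pi> \<noteq> \<infinity>"
    using int unfolding pos neg real_integrable_def by auto
  then show "has_expected_payoff f T v \<pi>" by (simp add: has_expected_payoff_def)
  have "enn2ereal (pos_part f T v \<pi>) = ereal (enn2real (pos_part f T v \<pi>))"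
    "enn2ereal (neg_part f T v \<pi>) = ereal (enn2real (neg_part f T v \<pi>))"
    using finite by (metis enn2real_nonneg ennreal_enn2real enn2ereal_ennreal infinity_ennreal_def less_top)+
  then show "expected_payoff f T v \<pi> = ereal (\<integral>\<omega>. ?F \<omega> \<partial>traj v \<pi>)"
    using real_lebesgue_integral_def[OF int] by (simp add: expected_payoff_def pos neg)
qed

text \<open>A trajectory of infinite cost has payoff -infinity, so a finite negative part rules such
  trajectories out almost surely.\<close>

lemma (in adaptive_ssp) integrable_of_finite_expected_payoff:
  fixes \<pi> :: "'v strategy"
  assumes v: "v \<in> pverts G" and \<pi>: "strategy v \<pi>" and f_meas: "f \<in> borel_measurable borel"
    and lim: "Liminf at_bot (\<lambda>t. ereal (f t)) = - \<infinity>"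
    and has: "has_expected_payoff f T v \<pi>" and finite: "\<bar>expected_payoff f T v \<pi>\<bar> \<noteq> \<infinity>"
  shows "AE \<omega> in traj v \<pi>. total_cost \<omega> \<noteq> \<infinity>"
    "integrable (traj v \<pi>) (\<lambda>\<omega>. f (T - enn2real (total_cost \<omega>)))"
proof -
  let ?F = "\<lambda>\<omega> :: nat \<Rightarrow> 'v move. f (T - enn2real (total_cost \<omega>))"
  have parts: "pos_part f T v \<pi> \<noteq> \<infinity>" "neg_part f T v \<pi> \<noteq> \<infinity>"
    using has finite
    by (cases "pos_part f T v \<pi>"; cases "neg_part f T v \<pi>"; simp add: expected_payoff_def has_expected_payoff_def)+
  note [measurable] = f_meas measurable_trajI[OF v \<pi> measurable_payoff[OF f_meas, of T]]
    measurable_trajI[OF v \<pi> measurable_total_cost]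
  have "AE \<omega> in traj v \<pi>. e2ennreal (- payoff f T \<omega>) \<noteq> \<infinity>"
    using parts(2) by (intro nn_integral_noteq_infinite) (auto simp: neg_part_def)
  then show fin: "AE \<omega> in traj v \<pi>. total_cost \<omega> \<noteq> \<infinity>"
    by eventually_elim (auto simp: payoff_def lim e2ennreal_infty)
  have "pos_part f T v \<pi> = (\<integral>\<^sup>+\<omega>. ennreal (?F \<omega>) \<partial>traj v \<pi>)"
    unfolding pos_part_def
    by (rule nn_integral_cong_AE, use fin in eventually_elim) (simp add: payoff_def)
  moreover have "neg_part f T v \<pi> = (\<integral>\<^sup>+\<omega>. ennreal (- ?F \<omega>) \<partial>traj v \<pi>)"
    unfolding neg_part_def
    by (rule nn_integral_cong_AE, use fin in eventually_elim) (simp add: payoff_def)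
  ultimately show "integrable (traj v \<pi>) ?F"
    using parts by (simp add: real_integrable_def)
qed

text \<open>
  Below the budget \<open>T\<^sub>f\<close> the risk function lies between two linear functions of the cost whose
  slopes differ by less than what the gap \<open>\<epsilon>\<close> of an arc off the tree can absorb.
\<close>

locale sandwiched_risk = adaptive_ssp G s d p \<delta>_inf \<delta>_sup
  for G :: "'v pair_pre_digraph" and s d p \<delta>_inf \<delta>_sup +
  fixes f a :: "real \<Rightarrow> real" and T\<^sub>f B \<eta> \<epsilon> K :: real
  assumes f_meas: "f \<in> borel_measurable borel" and a_meas: "a \<in> borel_measurable borel"
    and a_pos: "\<And>t. t \<le> T\<^sub>f \<Longrightarrow> 0 < a t"
    and upper: "\<And>t x. t \<le> T\<^sub>f \<Longrightarrow> 0 \<le> x \<Longrightarrow> f (t - x) \<le> f t - a t * x"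
    and lower: "\<And>t x. t \<le> T\<^sub>f \<Longrightarrow> 0 \<le> x \<Longrightarrow> x \<le> B \<Longrightarrow> f t - (1 + \<eta>) * a t * x \<le> f (t - x)"
    and bounded: "\<And>v \<pi> \<omega> n. v \<in> pverts G \<Longrightarrow> \<omega> \<in> space traj_space \<Longrightarrow>
      (\<And>k. legal_move v \<pi> (hist k \<omega>) (\<omega> k)) \<Longrightarrow>
      (\<And>k. n \<le> k \<Longrightarrow> cur_node v (hist k \<omega>) \<noteq> d \<Longrightarrow> set_pmf (\<pi> (hist k \<omega>)) \<subseteq> sp_tree (cur_node v (hist k \<omega>))) \<Longrightarrow>
      rest_cost n \<omega> \<le> ennreal B"
    and gap: "\<And>i j. (i, j) \<in> parcs G \<Longrightarrow> j \<notin> sp_tree i \<Longrightarrow> dist_dest i + \<epsilon> \<le> mean_cost (i, j) + dist_dest j"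
    and dist_le: "\<And>i. i \<in> pverts G \<Longrightarrow> dist_dest i \<le> K"
    and \<eta>: "0 \<le> \<eta>" and B: "0 \<le> B" and K: "0 \<le> K" and \<epsilon>: "\<eta> * K < \<epsilon>"

text \<open>The upper linear bound at \<open>T\<^sub>f\<close> has positive slope, so
  \<open>f\<close> falls below every real number.\<close>

lemma (in sandwiched_risk) Liminf_f: "Liminf at_bot (\<lambda>t. ereal (f t)) = - \<infinity>"
proof (rule ereal_bot)
  fix r :: real
  have "f t \<le> r" if "t \<le> T\<^sub>f - max 0 ((f T\<^sub>f - r) / a T\<^sub>f)" for t
  proof -
    have "(f T\<^sub>f - r) / a T\<^sub>f \<le> T\<^sub>f - t" using that by linarith
    then have "f T\<^sub>f - r \<le> a T\<^sub>f * (T\<^sub>f - t)"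
      using a_pos[of T\<^sub>f] by (simp add: pos_divide_le_eq mult.commute)
    moreover have "t \<le> T\<^sub>f" using that by linarith
    ultimately show ?thesis using upper[of T\<^sub>f "T\<^sub>f - t"] by simp
  qed
  then have "\<forall>\<^sub>F t in at_bot. ereal (f t) \<le> ereal r"
    unfolding eventually_at_bot_linorder by auto
  from Liminf_mono[OF this] show "Liminf at_bot (\<lambda>t. ereal (f t)) \<le> ereal r"
    by (simp add: Liminf_const)
qed

lemma (in sandwiched_risk) f_le:
  assumes "t \<le> T\<^sub>f"
  shows "f t \<le> f T\<^sub>f"
proof -
  have "0 \<le> a T\<^sub>f * (T\<^sub>f - t)" using a_pos[of T\<^sub>f] assms by simp
  then show ?thesis using upper[of T\<^sub>f "T\<^sub>f - t"] assms by simp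
qed

text \<open>Outside \<open>D\<close> the laws coincide. On \<open>D\<close>, per unit of slope, the
  detour loses at least the distance plus \<epsilon>, the tree at most \<open>1 + \<eta>\<close>
  times the distance, so the tree gains at least \<open>\<epsilon> - \<eta> * K\<close>. Only the
  payoff of the detour is known to be integrable; the integrability of all other quantities is
  extracted from it.\<close>

lemma (in sandwiched_risk) tree_beats_detour:
  fixes D :: "'v move list set"
  assumes v: "v \<in> pverts G" and \<pi>: "strategy v \<pi>\<^sub>1" "strategy v \<pi>\<^sub>2"
    and D_meas: "Measurable.pred (fin_traj_space n) (\<lambda>\<omega>. hist n \<omega> \<in> D)"
    and D: "\<And>h. length h = n \<Longrightarrow> h \<in> D \<Longrightarrow>
      cur_node v h \<noteq> d \<and> T - spent h \<le> T\<^sub>f \<and> set_pmf (\<pi>\<^sub>1 h) \<inter> sp_tree (cur_node v h) = {}"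
    and tree: "\<And>h. n \<le> length h \<Longrightarrow> take n h \<in> D \<Longrightarrow> cur_node v h \<in> pverts G \<Longrightarrow> cur_node v h \<noteq> d \<Longrightarrow>
      set_pmf (\<pi>\<^sub>2 h) \<subseteq> sp_tree (cur_node v h)"
    and agree: "\<And>h. length h < n \<or> take n h \<notin> D \<Longrightarrow> \<pi>\<^sub>1 h = \<pi>\<^sub>2 h"
    and fin: "AE \<omega> in traj v \<pi>\<^sub>1. total_cost \<omega> \<noteq> \<infinity>"
    and int: "integrable (traj v \<pi>\<^sub>1) (\<lambda>\<omega>. f (T - enn2real (total_cost \<omega>)))"
  defines "slope \<equiv> \<lambda>h. a (T - spent h) * indicator D h"
  shows "AE \<omega> in traj v \<pi>\<^sub>2. total_cost \<omega> \<noteq> \<infinity>"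
    and "integrable (traj v \<pi>\<^sub>2) (\<lambda>\<omega>. f (T - enn2real (total_cost \<omega>)))"
    and "integrable (traj v \<pi>\<^sub>1) (\<lambda>\<omega>. slope (hist n \<omega>))"
    and "(\<integral>\<omega>. f (T - enn2real (total_cost \<omega>)) \<partial>traj v \<pi>\<^sub>1) + (\<epsilon> - \<eta> * K) * (\<integral>\<omega>. slope (hist n \<omega>) \<partial>traj v \<pi>\<^sub>1) \<le>
      (\<integral>\<omega>. f (T - enn2real (total_cost \<omega>)) \<partial>traj v \<pi>\<^sub>2)"
proof -
  let ?P = "traj v \<pi>\<^sub>1" and ?Q = "traj v \<pi>\<^sub>2"
  \<comment> \<open>All quantities are localized to \<open>D\<close>: \<open>base\<close> is the
    payoff without any further cost, \<open>m\<close> and \<open>y\<close> are the distance and the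
    actual remaining cost, both weighted by the slope.\<close>
  define F where "F \<omega> = f (T - enn2real (total_cost \<omega>))" for \<omega> :: "nat \<Rightarrow> 'v move"
  define i where "i h = (indicator D h :: real)" for h :: "'v move list"
  define base where "base h = f (T - spent h) * i h" for h
  define m where "m h = slope h * dist_dest (cur_node v h)" for h
  define y where "y \<omega> = slope (hist n \<omega>) * enn2real (rest_cost n \<omega>)" for \<omega>
  define W where "W h = ennreal (slope h)" for h
  interpret P: prob_space ?P by (rule prob_space_traj[OF v \<pi>(1)])
  interpret Q: prob_space ?Q by (rule prob_space_traj[OF v \<pi>(2)])
  have cur: "cur_node v (hist k \<omega>) \<in> pverts G" if "\<omega> \<in> space traj_space" for k \<omega>
    using that cur_node_in_verts[OF v] by simp
  have slope_nonneg: "0 \<le> slope (hist n \<omega>)" for \<omega>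
    using D[of "hist n \<omega>"] a_pos[of "T - spent (hist n \<omega>)"] by (auto simp: slope_def indicator_def)
  have slope_0: "slope h = 0" if "h \<notin> D" for h
    using that by (simp add: slope_def)
  have W_D: "h \<in> D" if "W h \<noteq> 0" for h
    using that slope_0[of h] by (cases "h \<in> D") (auto simp: W_def)
  have i_meas: "(\<lambda>\<omega>. i (hist n \<omega>)) \<in> borel_measurable (fin_traj_space n)"
    unfolding i_def indicator_def using D_meas by measurable
  have slope_meas: "(\<lambda>\<omega>. slope (hist n \<omega>)) \<in> borel_measurable (fin_traj_space n)"
  proof -
    note [measurable] = a_meas measurable_spent i_meas[unfolded i_def]
    show ?thesis unfolding slope_def by measurable
  qed
  have base_meas: "(\<lambda>\<omega>. base (hist n \<omega>)) \<in> borel_measurable (fin_traj_space n)"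
  proof -
    note [measurable] = f_meas measurable_spent i_meas
    show ?thesis unfolding base_def by measurable
  qed
  have m_meas: "(\<lambda>\<omega>. m (hist n \<omega>)) \<in> borel_measurable (fin_traj_space n)"
  proof -
    note [measurable] = slope_meas measurable_fun_cur_node[OF v, of dist_dest n]
    show ?thesis unfolding m_def by measurable
  qed
  have W_meas: "(\<lambda>\<omega>. W (hist n \<omega>)) \<in> borel_measurable (fin_traj_space n)"
    unfolding W_def using slope_meas by measurable
  have F_meas: "F \<in> borel_measurable traj_space"
  proof -
    note [measurable] = f_meas measurable_total_cost
    show ?thesis unfolding F_def[abs_def] by measurable
  qed
  have y_meas: "y \<in> borel_measurable traj_space"
  proof -
    note [measurable] = measurable_rest_cost measurable_hist_traj[OF slope_meas]
    show ?thesis unfolding y_def[abs_def] by measurable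
  qed
  note meas1 = measurable_trajI[OF v \<pi>(1)] and meas2 = measurable_trajI[OF v \<pi>(2)]
  have y_nonneg: "0 \<le> y \<omega>" for \<omega> by (simp add: y_def slope_nonneg)

  \<comment> \<open>Finiteness of either cost suffices, as the amount spent by time \<open>n\<close>
    is finite: the total cost is known to be finite for the detour, the remaining cost for the
    tree.\<close>
  have F_split: "F \<omega> = f (T - spent (hist n \<omega>) - enn2real (rest_cost n \<omega>)) \<and> (total_cost \<omega> = \<infinity> \<longleftrightarrow> rest_cost n \<omega> = \<infinity>)"
    if "\<And>k. 0 \<le> snd (\<omega> k)" "rest_cost n \<omega> \<noteq> \<infinity> \<or> total_cost \<omega> \<noteq> \<infinity>" for \<omega>
  proof -
    have t: "total_cost \<omega> = ennreal (spent (hist n \<omega>)) + rest_cost n \<omega>"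
      by (rule total_cost_split[OF that(1)])
    have "0 \<le> spent (hist n \<omega>)" unfolding spent_hist using that(1) by (rule sum_nonneg)
    with t that(2) show ?thesis
      by (cases "rest_cost n \<omega>") (auto simp: F_def ennreal_plus[symmetric] diff_diff_eq simp del: ennreal_plus)
  qed
  have F_upper: "F \<omega> * i (hist n \<omega>) \<le> base (hist n \<omega>) - y \<omega>"
    if "\<And>k. 0 \<le> snd (\<omega> k)" "rest_cost n \<omega> \<noteq> \<infinity> \<or> total_cost \<omega> \<noteq> \<infinity>" for \<omega>
  proof (cases "hist n \<omega> \<in> D")
    case True
    have "F \<omega> = f (T - spent (hist n \<omega>) - enn2real (rest_cost n \<omega>))"
      using F_split[of \<omega>] that by blast
    moreover have "T - spent (hist n \<omega>) \<le> T\<^sub>f" using D[OF length_hist True] by blast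
    ultimately show ?thesis
      using upper[of "T - spent (hist n \<omega>)" "enn2real (rest_cost n \<omega>)"] True
      by (simp add: base_def y_def slope_def i_def)
  qed (simp add: base_def y_def slope_def i_def)
  have base_le: "base (hist n \<omega>) \<le> \<bar>f T\<^sub>f\<bar>" for \<omega>
  proof (cases "hist n \<omega> \<in> D")
    case True
    then show ?thesis
      using f_le[of "T - spent (hist n \<omega>)"] D[OF length_hist True] by (simp add: base_def i_def)
  qed (simp add: base_def i_def)
  have nonneg_AE: "AE \<omega> in traj v \<sigma>. \<forall>k. 0 \<le> snd (\<omega> k)" if "strategy v \<sigma>" for \<sigma>
    using AE_legal_move[OF v that] by eventually_elim (blast intro: legal_move_cost_nonneg)

  have intP: "integrable ?P F" using int by (simp add: F_def[abs_def])
  have FiP: "integrable ?P (\<lambda>\<omega>. F \<omega> * i (hist n \<omega>))"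
    using intP meas1[OF F_meas] meas1[OF measurable_hist_traj[OF i_meas]]
    by (intro Bochner_Integration.integrable_bound[OF intP]) (auto simp: i_def indicator_def)
  have upP: "AE \<omega> in ?P. F \<omega> * i (hist n \<omega>) \<le> base (hist n \<omega>) - y \<omega>"
    using nonneg_AE[OF \<pi>(1)] fin by eventually_elim (rule F_upper, auto)
  \<comment> \<open>\<open>base\<close> lies between the integrable \<open>F * i\<close> and the
    constant \<open>\<bar>f T\<^sub>f\<bar>\<close>; then \<open>y\<close> is integrable too, being
    at most their difference \<open>base - F * i\<close>.\<close>
  have baseP: "integrable ?P (\<lambda>\<omega>. base (hist n \<omega>))"
  proof (rule Bochner_Integration.integrable_bound)
    show "integrable ?P (\<lambda>\<omega>. \<bar>F \<omega> * i (hist n \<omega>)\<bar> + \<bar>f T\<^sub>f\<bar>)" using FiP by auto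
    show "(\<lambda>\<omega>. base (hist n \<omega>)) \<in> borel_measurable ?P" by (rule meas1[OF measurable_hist_traj[OF base_meas]])
    show "AE \<omega> in ?P. norm (base (hist n \<omega>)) \<le> norm (\<bar>F \<omega> * i (hist n \<omega>)\<bar> + \<bar>f T\<^sub>f\<bar>)"
      using upP
    proof eventually_elim
      case (elim \<omega>)
      then show ?case using base_le[of \<omega>] y_nonneg[of \<omega>] by simp
    qed
  qed
  have yP: "integrable ?P y"
  proof (rule Bochner_Integration.integrable_bound)
    show "integrable ?P (\<lambda>\<omega>. base (hist n \<omega>) - F \<omega> * i (hist n \<omega>))" using FiP baseP by auto
    show "AE \<omega> in ?P. norm (y \<omega>) \<le> norm (base (hist n \<omega>) - F \<omega> * i (hist n \<omega>))"
      using upP by eventually_elim (use y_nonneg in simp)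
  qed (rule meas1[OF y_meas])
  have upP': "(\<integral>\<omega>. F \<omega> * i (hist n \<omega>) \<partial>?P) \<le> (\<integral>\<omega>. base (hist n \<omega>) \<partial>?P) - (\<integral>\<omega>. y \<omega> \<partial>?P)"
    using integral_mono_AE[OF FiP Bochner_Integration.integrable_diff[OF baseP yP] upP] baseP yP by simp

  \<comment> \<open>\<open>enn2real\<close> sends infinity to 0, so the two integrands match on
    \<open>D\<close> only where the remaining cost is finite; off \<open>D\<close> both
    vanish.\<close>
  have WY: "(\<integral>\<^sup>+\<omega>. W (hist n \<omega>) * rest_cost n \<omega> \<partial>traj v \<sigma>) = (\<integral>\<^sup>+\<omega>. ennreal (y \<omega>) \<partial>traj v \<sigma>)"
    if "AE \<omega> in traj v \<sigma>. hist n \<omega> \<in> D \<longrightarrow> rest_cost n \<omega> \<noteq> \<infinity>" for \<sigma>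
    by (rule nn_integral_cong_AE, use that in eventually_elim)
       (auto simp: W_def y_def ennreal_mult slope_nonneg slope_0 less_top)
  have "AE \<omega> in ?P. hist n \<omega> \<in> D \<longrightarrow> rest_cost n \<omega> \<noteq> \<infinity>"
    using nonneg_AE[OF \<pi>(1)] fin by eventually_elim (use F_split in auto)
  from WY[OF this] have WYP: "(\<integral>\<^sup>+\<omega>. W (hist n \<omega>) * rest_cost n \<omega> \<partial>?P) = ennreal (\<integral>\<omega>. y \<omega> \<partial>?P)"
    using nn_integral_eq_integral[OF yP] y_nonneg by simp
  have eps: "0 \<le> \<epsilon>" "0 < \<epsilon>" using \<epsilon> \<eta> K mult_nonneg_nonneg[of \<eta> K] by linarith+
  have geP: "(\<integral>\<^sup>+\<omega>. ennreal (m (hist n \<omega>) + \<epsilon> * slope (hist n \<omega>)) \<partial>?P) \<le> ennreal (\<integral>\<omega>. y \<omega> \<partial>?P)"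
  proof -
    have "(\<integral>\<^sup>+\<omega>. ennreal (m (hist n \<omega>) + \<epsilon> * slope (hist n \<omega>)) \<partial>?P) =
        (\<integral>\<^sup>+\<omega>. W (hist n \<omega>) * ennreal (dist_dest (cur_node v (hist n \<omega>)) + \<epsilon>) \<partial>?P)"
    proof (rule nn_integral_cong)
      fix \<omega> assume "\<omega> \<in> space ?P"
      then have "0 \<le> dist_dest (cur_node v (hist n \<omega>))"
        using cur dist_dest_nonneg by (simp add: space_traj[OF v \<pi>(1)])
      then show "ennreal (m (hist n \<omega>) + \<epsilon> * slope (hist n \<omega>)) =
          W (hist n \<omega>) * ennreal (dist_dest (cur_node v (hist n \<omega>)) + \<epsilon>)"
        using slope_nonneg eps by (simp add: W_def m_def ennreal_mult[symmetric] algebra_simps)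
    qed
    also have "\<dots> \<le> (\<integral>\<^sup>+\<omega>. W (hist n \<omega>) * rest_cost n \<omega> \<partial>?P)"
      using D W_D by (intro nn_integral_rest_cost_ge v \<pi> W_meas gap) blast+
    finally show ?thesis unfolding WYP .
  qed
  have m_bounds: "0 \<le> m (hist n \<omega>)" "m (hist n \<omega>) \<le> K * slope (hist n \<omega>)" if "\<omega> \<in> space traj_space" for \<omega>
    using mult_left_mono[OF dist_le[OF cur[OF that]] slope_nonneg[of \<omega>]]
      mult_nonneg_nonneg[OF slope_nonneg[of \<omega>] dist_dest_nonneg[OF cur[OF that]]]
    by (simp_all add: m_def mult.commute)
  \<comment> \<open>Here the strict positivity of \<epsilon> matters: the expected cost dominates
    \<epsilon> times the slope.\<close>
  have slopeP: "integrable ?P (\<lambda>\<omega>. slope (hist n \<omega>))"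
  proof (rule integrableI_nonneg)
    have "(\<integral>\<^sup>+\<omega>. ennreal \<epsilon> * ennreal (slope (hist n \<omega>)) \<partial>?P) \<le>
        (\<integral>\<^sup>+\<omega>. ennreal (m (hist n \<omega>) + \<epsilon> * slope (hist n \<omega>)) \<partial>?P)"
    proof (rule nn_integral_mono)
      fix \<omega> assume "\<omega> \<in> space ?P"
      then have "\<omega> \<in> space traj_space" by (simp add: space_traj[OF v \<pi>(1)])
      from m_bounds(1)[OF this] slope_nonneg[of \<omega>] eps(1)
      show "ennreal \<epsilon> * ennreal (slope (hist n \<omega>)) \<le> ennreal (m (hist n \<omega>) + \<epsilon> * slope (hist n \<omega>))"
        by (simp add: ennreal_mult[symmetric] ennreal_leI)
    qed
    also have "\<dots> < \<infinity>" using geP by (simp add: order_le_less_trans)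
    finally have "ennreal \<epsilon> * (\<integral>\<^sup>+\<omega>. ennreal (slope (hist n \<omega>)) \<partial>?P) < \<infinity>"
      using meas1[OF measurable_hist_traj[OF slope_meas]] by (simp add: nn_integral_cmult)
    then show "(\<integral>\<^sup>+\<omega>. ennreal (slope (hist n \<omega>)) \<partial>?P) < \<infinity>"
      using eps by (auto simp: ennreal_mult_less_top)
  qed (use slope_nonneg meas1[OF measurable_hist_traj[OF slope_meas]] in auto)
  have mP: "integrable ?P (\<lambda>\<omega>. m (hist n \<omega>))"
  proof (rule Bochner_Integration.integrable_bound)
    show "integrable ?P (\<lambda>\<omega>. K * slope (hist n \<omega>))" using slopeP by simp
    show "AE \<omega> in ?P. norm (m (hist n \<omega>)) \<le> norm (K * slope (hist n \<omega>))"
    proof (rule AE_I2)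
      fix \<omega> assume "\<omega> \<in> space ?P"
      then have "\<omega> \<in> space traj_space" by (simp add: space_traj[OF v \<pi>(1)])
      from m_bounds[OF this] show "norm (m (hist n \<omega>)) \<le> norm (K * slope (hist n \<omega>))" by simp
    qed
  qed (rule meas1[OF measurable_hist_traj[OF m_meas]])
  have geP': "(\<integral>\<omega>. m (hist n \<omega>) \<partial>?P) + \<epsilon> * (\<integral>\<omega>. slope (hist n \<omega>) \<partial>?P) \<le> (\<integral>\<omega>. y \<omega> \<partial>?P)"
  proof -
    have "(\<integral>\<^sup>+\<omega>. ennreal (m (hist n \<omega>) + \<epsilon> * slope (hist n \<omega>)) \<partial>?P) =
        ennreal (\<integral>\<omega>. m (hist n \<omega>) + \<epsilon> * slope (hist n \<omega>) \<partial>?P)"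
      using mP slopeP m_bounds slope_nonneg eps
      by (intro nn_integral_eq_integral AE_I2) (auto simp: space_traj[OF v \<pi>(1)])
    with geP have "(\<integral>\<omega>. m (hist n \<omega>) + \<epsilon> * slope (hist n \<omega>) \<partial>?P) \<le> (\<integral>\<omega>. y \<omega> \<partial>?P)"
      using y_nonneg by (simp add: ennreal_le_iff)
    then show ?thesis using mP slopeP by simp
  qed

  \<comment> \<open>\<open>base\<close> and \<open>m\<close> depend on the first \<open>n\<close>
    moves, on which the two laws agree, so their integrals can be carried from the detour to the
    tree.\<close>
  note agree_len = agree[OF disjI1]
  note hist_eq = integral_hist_agree[OF v \<pi> agree_len]
  have baseQ: "integrable ?Q (\<lambda>\<omega>. base (hist n \<omega>))" using hist_eq(1)[OF _ base_meas] baseP by simp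
  have mQ: "integrable ?Q (\<lambda>\<omega>. m (hist n \<omega>))" using hist_eq(1)[OF _ m_meas] mP by simp
  have m_eq: "(\<integral>\<omega>. m (hist n \<omega>) \<partial>?P) = (\<integral>\<omega>. m (hist n \<omega>) \<partial>?Q)" using hist_eq(2)[OF _ m_meas] by simp
  have base_eq: "(\<integral>\<omega>. base (hist n \<omega>) \<partial>?P) = (\<integral>\<omega>. base (hist n \<omega>) \<partial>?Q)"
    using hist_eq(2)[OF _ base_meas] by simp
  have restQ: "AE \<omega> in ?Q. hist n \<omega> \<in> D \<longrightarrow> rest_cost n \<omega> \<le> ennreal B"
    using AE_legal_move[OF v \<pi>(2)] AE_space
  proof eventually_elim
    case (elim \<omega>)
    then have \<omega>: "\<omega> \<in> space traj_space" by (simp add: space_traj[OF v \<pi>(2)])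
    show ?case
      using tree[OF _ _ cur[OF \<omega>]] elim(1) by (auto intro!: bounded[OF v \<omega>] simp: take_hist)
  qed
  have "AE \<omega> in ?Q. hist n \<omega> \<in> D \<longrightarrow> rest_cost n \<omega> \<noteq> \<infinity>"
    using restQ by eventually_elim (auto simp: top_unique)
  note WYQ = WY[OF this]
  have leQ: "(\<integral>\<^sup>+\<omega>. ennreal (y \<omega>) \<partial>?Q) \<le> ennreal (\<integral>\<omega>. m (hist n \<omega>) \<partial>?Q)"
  proof -
    have "(\<integral>\<^sup>+\<omega>. ennreal (y \<omega>) \<partial>?Q) \<le>
        (\<integral>\<^sup>+\<omega>. W (hist n \<omega>) * ennreal (dist_dest (cur_node v (hist n \<omega>))) \<partial>?Q)"
      unfolding WYQ[symmetric] using tree W_D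
      by (intro nn_integral_rest_cost_tree_le v \<pi> W_meas) blast
    also have "\<dots> = (\<integral>\<^sup>+\<omega>. ennreal (m (hist n \<omega>)) \<partial>?Q)"
    proof (rule nn_integral_cong)
      fix \<omega> assume "\<omega> \<in> space ?Q"
      then have "0 \<le> dist_dest (cur_node v (hist n \<omega>))"
        using cur dist_dest_nonneg by (simp add: space_traj[OF v \<pi>(2)])
      then show "W (hist n \<omega>) * ennreal (dist_dest (cur_node v (hist n \<omega>))) = ennreal (m (hist n \<omega>))"
        using slope_nonneg by (simp add: W_def m_def ennreal_mult[symmetric])
    qed
    also have "\<dots> = ennreal (\<integral>\<omega>. m (hist n \<omega>) \<partial>?Q)"
      using m_bounds by (intro nn_integral_eq_integral mQ AE_I2) (auto simp: space_traj[OF v \<pi>(2)])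
    finally show ?thesis .
  qed
  have yQ: "integrable ?Q y"
    using leQ y_nonneg meas2[OF y_meas] by (intro integrableI_nonneg) (auto simp: order_le_less_trans)
  have leQ': "(\<integral>\<omega>. y \<omega> \<partial>?Q) \<le> (\<integral>\<omega>. m (hist n \<omega>) \<partial>?Q)"
  proof -
    have "0 \<le> (\<integral>\<omega>. m (hist n \<omega>) \<partial>?Q)"
      using m_bounds by (intro integral_nonneg_AE AE_I2) (auto simp: space_traj[OF v \<pi>(2)])
    then show ?thesis
      using leQ nn_integral_eq_integral[OF yQ] y_nonneg by (simp add: ennreal_le_iff)
  qed
  have loQ: "AE \<omega> in ?Q. base (hist n \<omega>) - (1 + \<eta>) * y \<omega> \<le> F \<omega> * i (hist n \<omega>) \<and>
      F \<omega> * i (hist n \<omega>) \<le> base (hist n \<omega>) - y \<omega>"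
    using nonneg_AE[OF \<pi>(2)] restQ
  proof eventually_elim
    case (elim \<omega>)
    show ?case
    proof (cases "hist n \<omega> \<in> D")
      case True
      then have r: "rest_cost n \<omega> \<le> ennreal B" using elim(2) by simp
      then have fin': "rest_cost n \<omega> \<noteq> \<infinity>" by (auto simp: top_unique)
      have "enn2real (rest_cost n \<omega>) \<le> B" using r B by (rule enn2real_leI[rotated])
      then show ?thesis
        using F_upper[of \<omega>] F_split[of \<omega>] elim(1) fin' D[OF length_hist True] True
          lower[of "T - spent (hist n \<omega>)" "enn2real (rest_cost n \<omega>)"]
        by (simp add: base_def y_def slope_def i_def mult.assoc)
    qed (simp add: base_def y_def slope_def i_def)
  qed
  have FiQ: "integrable ?Q (\<lambda>\<omega>. F \<omega> * i (hist n \<omega>))"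
  proof (rule Bochner_Integration.integrable_bound)
    show "integrable ?Q (\<lambda>\<omega>. \<bar>base (hist n \<omega>)\<bar> + (1 + \<eta>) * y \<omega>)" using baseQ yQ by auto
    show "(\<lambda>\<omega>. F \<omega> * i (hist n \<omega>)) \<in> borel_measurable ?Q"
      using meas2[OF F_meas] meas2[OF measurable_hist_traj[OF i_meas]] by measurable
    show "AE \<omega> in ?Q. norm (F \<omega> * i (hist n \<omega>)) \<le> norm (\<bar>base (hist n \<omega>)\<bar> + (1 + \<eta>) * y \<omega>)"
      using loQ
    proof eventually_elim
      case (elim \<omega>)
      moreover have "0 \<le> \<eta> * y \<omega>" using \<eta> y_nonneg by simp
      ultimately show ?case using y_nonneg[of \<omega>] by (simp add: algebra_simps) linarith
    qed
  qed
  have loQ': "(\<integral>\<omega>. base (hist n \<omega>) \<partial>?Q) - (1 + \<eta>) * (\<integral>\<omega>. y \<omega> \<partial>?Q) \<le> (\<integral>\<omega>. F \<omega> * i (hist n \<omega>) \<partial>?Q)"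
  proof -
    have "(\<integral>\<omega>. base (hist n \<omega>) - (1 + \<eta>) * y \<omega> \<partial>?Q) \<le> (\<integral>\<omega>. F \<omega> * i (hist n \<omega>) \<partial>?Q)"
      using loQ by (intro integral_mono_AE FiQ) (use baseQ yQ in auto)
    then show ?thesis using baseQ yQ by simp
  qed

  \<comment> \<open>Trajectories that do not pass through \<open>D\<close> at time \<open>n\<close>;
    on them the strategies agree throughout, so the restricted laws are equal.\<close>
  define A where "A = {h. n \<le> length h \<longrightarrow> take n h \<notin> D}"
  have A_meas: "Measurable.pred (fin_traj_space k) (\<lambda>\<omega>. hist k \<omega> \<in> A)" for k
    using measurable_hist_prefix[OF D_meas, of k] by (cases "n \<le> k") (simp_all add: A_def take_hist)
  have A_closed: "h \<in> A" if "h @ [x] \<in> A" for h x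
    using that by (auto simp: A_def)
  have A_agree: "\<pi>\<^sub>1 h = \<pi>\<^sub>2 h" if "h @ [x] \<in> A" for h x
    using that agree[of h] by (cases "length h < n") (auto simp: A_def)
  have dens: "density ?P (indicator {\<omega>. \<forall>k. hist k \<omega> \<in> A}) = density ?Q (indicator {\<omega>. \<forall>k. hist k \<omega> \<in> A})"
    by (rule density_traj_agree[OF v \<pi> A_meas A_closed A_agree])
  have "{\<omega>. \<forall>k. hist k \<omega> \<in> A} = {\<omega>. hist n \<omega> \<notin> D}"
    by (auto simp: A_def take_hist)
  then have "(indicator {\<omega>. \<forall>k. hist k \<omega> \<in> A} :: _ \<Rightarrow> ennreal) = (\<lambda>\<omega>. ennreal (1 - i (hist n \<omega>)))"
    by (auto simp: indicator_def i_def fun_eq_iff)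
  with dens have dens: "density ?P (\<lambda>\<omega>. ennreal (1 - i (hist n \<omega>))) = density ?Q (\<lambda>\<omega>. ennreal (1 - i (hist n \<omega>)))"
    by simp
  have j_meas: "(\<lambda>\<omega>. 1 - i (hist n \<omega>)) \<in> borel_measurable traj_space"
    using measurable_hist_traj[OF i_meas] by measurable
  have j_nonneg: "0 \<le> 1 - i h" for h by (simp add: i_def indicator_def)
  note jP = integral_density[OF meas1[OF F_meas] meas1[OF j_meas] AE_I2[OF j_nonneg]]
    integrable_density[OF meas1[OF F_meas] meas1[OF j_meas] AE_I2[OF j_nonneg]]
  note jQ = integral_density[OF meas2[OF F_meas] meas2[OF j_meas] AE_I2[OF j_nonneg]]
    integrable_density[OF meas2[OF F_meas] meas2[OF j_meas] AE_I2[OF j_nonneg]]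
  have FjP: "integrable ?P (\<lambda>\<omega>. (1 - i (hist n \<omega>)) * F \<omega>)"
    using Bochner_Integration.integrable_diff[OF intP FiP] by (simp add: algebra_simps)
  then have FjQ: "integrable ?Q (\<lambda>\<omega>. (1 - i (hist n \<omega>)) * F \<omega>)"
    using jP(2) jQ(2) dens by simp
  have Fj_eq: "(\<integral>\<omega>. (1 - i (hist n \<omega>)) * F \<omega> \<partial>?P) = (\<integral>\<omega>. (1 - i (hist n \<omega>)) * F \<omega> \<partial>?Q)"
    using jP(1) jQ(1) dens by simp
  have F_eq: "F \<omega> = (1 - i (hist n \<omega>)) * F \<omega> + F \<omega> * i (hist n \<omega>)" for \<omega>
    by (simp add: algebra_simps)
  have intQ: "integrable ?Q F"
    using Bochner_Integration.integrable_add[OF FjQ FiQ] by (simp add: F_eq[symmetric])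
  then show "integrable ?Q (\<lambda>\<omega>. f (T - enn2real (total_cost \<omega>)))" by (simp add: F_def[abs_def])
  show "integrable ?P (\<lambda>\<omega>. slope (hist n \<omega>))" by (rule slopeP)
  have splitP: "(\<integral>\<omega>. F \<omega> \<partial>?P) = (\<integral>\<omega>. (1 - i (hist n \<omega>)) * F \<omega> \<partial>?P) + (\<integral>\<omega>. F \<omega> * i (hist n \<omega>) \<partial>?P)"
    using Bochner_Integration.integral_add[OF FjP FiP] by (simp add: F_eq[symmetric])
  have splitQ: "(\<integral>\<omega>. F \<omega> \<partial>?Q) = (\<integral>\<omega>. (1 - i (hist n \<omega>)) * F \<omega> \<partial>?Q) + (\<integral>\<omega>. F \<omega> * i (hist n \<omega>) \<partial>?Q)"
    using Bochner_Integration.integral_add[OF FjQ FiQ] by (simp add: F_eq[symmetric])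
  \<comment> \<open>The price of the unequal slopes: the surplus \<open>\<eta> * m\<close> is at
    most \<open>\<eta> * K\<close> times the slope.\<close>
  have "(\<integral>\<omega>. m (hist n \<omega>) \<partial>?P) \<le> (\<integral>\<omega>. K * slope (hist n \<omega>) \<partial>?P)"
    using m_bounds slopeP by (intro integral_mono mP) (auto simp: space_traj[OF v \<pi>(1)])
  then have "\<eta> * (\<integral>\<omega>. m (hist n \<omega>) \<partial>?P) \<le> \<eta> * (K * (\<integral>\<omega>. slope (hist n \<omega>) \<partial>?P))"
    using \<eta> by (intro mult_left_mono) auto
  moreover have "(1 + \<eta>) * (\<integral>\<omega>. y \<omega> \<partial>?Q) \<le> (1 + \<eta>) * (\<integral>\<omega>. m (hist n \<omega>) \<partial>?Q)"
    using leQ' \<eta> by (intro mult_left_mono) auto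
  ultimately show "(\<integral>\<omega>. f (T - enn2real (total_cost \<omega>)) \<partial>?P) + (\<epsilon> - \<eta> * K) * (\<integral>\<omega>. slope (hist n \<omega>) \<partial>?P) \<le>
      (\<integral>\<omega>. f (T - enn2real (total_cost \<omega>)) \<partial>?Q)"
    using splitP splitQ Fj_eq upP' loQ' geP' m_eq base_eq
    unfolding F_def[symmetric] by (simp add: algebra_simps)
  have "AE \<omega> in density ?P (\<lambda>\<omega>. ennreal (1 - i (hist n \<omega>))). total_cost \<omega> \<noteq> \<infinity>"
    using fin meas1[OF j_meas] by (subst AE_density) auto
  then have "AE \<omega> in ?Q. 0 < 1 - i (hist n \<omega>) \<longrightarrow> total_cost \<omega> \<noteq> \<infinity>"
    unfolding dens using meas2[OF j_meas] by (subst (asm) AE_density) auto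
  then show "AE \<omega> in ?Q. total_cost \<omega> \<noteq> \<infinity>"
    using nonneg_AE[OF \<pi>(2)] restQ
  proof eventually_elim
    case (elim \<omega>)
    show ?case
    proof (cases "hist n \<omega> \<in> D")
      case True
      then have "rest_cost n \<omega> \<noteq> \<infinity>" using elim(3) by (auto simp: top_unique)
      then show ?thesis using F_split[of \<omega>] elim(2) by auto
    qed (use elim(1) in \<open>simp add: i_def\<close>)
  qed
qed

section \<open>Optimal strategies\<close>

text \<open>The other component when \<open>q\<close> is written as a mixture with weight \<theta>
  on the point mass at \<open>j\<close> and \<open>1 - \<theta>\<close> on the rest; meaningful if
  \<open>\<theta> \<le> pmf q j\<close> and \<open>\<theta> < 1\<close>.\<close>

definition drop_mass :: "real \<Rightarrow> 'b \<Rightarrow> 'b pmf \<Rightarrow> 'b pmf" where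
  "drop_mass \<theta> j q = embed_pmf (\<lambda>x. (pmf q x - (if x = j then \<theta> else 0)) / (1 - \<theta>))"

lemma pmf_drop_mass:
  assumes \<theta>: "0 \<le> \<theta>" "\<theta> < 1" "\<theta> \<le> pmf q j"
  shows "pmf (drop_mass \<theta> j q) x = (pmf q x - (if x = j then \<theta> else 0)) / (1 - \<theta>)"
proof -
  define g where "g x = pmf q x - (if x = j then \<theta> else 0)" for x
  have g: "0 \<le> g x" for x using \<theta> by (simp add: g_def)
  \<comment> \<open>The removed mass is added back to recover the total mass 1 of \<open>q\<close>,
    which avoids an integral of a difference.\<close>
  have "(\<integral>\<^sup>+x. ennreal (g x) \<partial>count_space UNIV) + ennreal \<theta> =
      (\<integral>\<^sup>+x. ennreal (g x) + ennreal \<theta> * indicator {j} x \<partial>count_space UNIV)"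
    by (subst nn_integral_add) (simp_all add: nn_integral_cmult)
  also have "\<dots> = (\<integral>\<^sup>+x. ennreal (pmf q x) \<partial>count_space UNIV)"
    using \<theta> g by (intro nn_integral_cong) (auto simp: g_def indicator_def ennreal_plus[symmetric] simp del: ennreal_plus)
  also have "\<dots> = 1" by (simp add: nn_integral_pmf_eq_1)
  finally have sum: "(\<integral>\<^sup>+x. ennreal (g x) \<partial>count_space UNIV) = ennreal (1 - \<theta>)"
    using \<theta>
    by (cases "\<integral>\<^sup>+x. ennreal (g x) \<partial>count_space UNIV")
       (auto simp: ennreal_plus[symmetric] top_add simp flip: ennreal_1 simp del: ennreal_plus)
  have "(\<integral>\<^sup>+x. ennreal (g x / (1 - \<theta>)) \<partial>count_space UNIV) =
      (\<integral>\<^sup>+x. ennreal (1 / (1 - \<theta>)) * ennreal (g x) \<partial>count_space UNIV)"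
    using \<theta> g by (intro nn_integral_cong) (simp add: ennreal_mult[symmetric])
  also have "\<dots> = ennreal (1 / (1 - \<theta>)) * ennreal (1 - \<theta>)"
    by (simp add: nn_integral_cmult sum)
  also have "\<dots> = 1" using \<theta> by (simp add: ennreal_mult[symmetric] flip: ennreal_1)
  finally show ?thesis
    unfolding drop_mass_def g_def[symmetric] using \<theta> g by (intro pmf_embed_pmf) simp_all
qed

lemma (in adaptive_ssp) strategy_if:
  assumes \<pi>: "strategy v \<pi>" and \<sigma>: "strategy v \<sigma>"
    and A: "\<And>n. Measurable.pred (fin_traj_space n) (\<lambda>\<omega>. hist n \<omega> \<in> A)"
  shows "strategy v (\<lambda>h. if h \<in> A then \<sigma> h else \<pi> h)"
proof -
  note [measurable] = A measurable_pmf_strategy[OF \<pi>] measurable_pmf_strategy[OF \<sigma>]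
  have "(\<lambda>\<omega>. pmf (if hist n \<omega> \<in> A then \<sigma> (hist n \<omega>) else \<pi> (hist n \<omega>)) j) =
      (\<lambda>\<omega>. if hist n \<omega> \<in> A then pmf (\<sigma> (hist n \<omega>)) j else pmf (\<pi> (hist n \<omega>)) j)" for n j
    by auto
  then have "(\<lambda>\<omega>. pmf (if hist n \<omega> \<in> A then \<sigma> (hist n \<omega>) else \<pi> (hist n \<omega>)) j)
      \<in> borel_measurable (fin_traj_space n)" for n j
    by simp
  then show ?thesis using \<pi> \<sigma> by (simp add: strategy_def)
qed

lemma (in adaptive_ssp) strategy_stationary:
  assumes "v \<in> pverts G" "\<And>i. i \<in> pverts G \<Longrightarrow> i \<noteq> d \<Longrightarrow> \<tau> i \<in> succs i"
  shows "strategy v (\<lambda>h. return_pmf (\<tau> (cur_node v h)))"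
  using assms measurable_fun_cur_node[OF assms(1), of "\<lambda>i. pmf (return_pmf (\<tau> i)) j" for j]
  by (simp add: strategy_def)

lemma (in adaptive_ssp) strategy_drop_mass:
  assumes \<pi>: "strategy v \<pi>" and A: "\<And>n. Measurable.pred (fin_traj_space n) (\<lambda>\<omega>. hist n \<omega> \<in> A)"
    and \<theta>: "0 \<le> \<theta>" "\<theta> < 1" "\<And>h. h \<in> A \<Longrightarrow> \<theta> \<le> pmf (\<pi> h) j"
  shows "strategy v (\<lambda>h. if h \<in> A then drop_mass \<theta> j (\<pi> h) else \<pi> h)"
proof -
  note [measurable] = A measurable_pmf_strategy[OF \<pi>]
  note pmf = pmf_drop_mass[OF \<theta>(1,2) \<theta>(3)]
  have "set_pmf (drop_mass \<theta> j (\<pi> h)) \<subseteq> set_pmf (\<pi> h)" if "h \<in> A" for h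
  proof
    fix x assume "x \<in> set_pmf (drop_mass \<theta> j (\<pi> h))"
    then have "pmf (drop_mass \<theta> j (\<pi> h)) x \<noteq> 0" by (simp add: set_pmf_iff)
    then show "x \<in> set_pmf (\<pi> h)"
      using pmf[OF that, of x] \<theta> \<theta>(3)[OF that] by (auto simp: set_pmf_iff split: if_splits)
  qed
  moreover have "(\<lambda>\<omega>. pmf (if hist n \<omega> \<in> A then drop_mass \<theta> j (\<pi> (hist n \<omega>)) else \<pi> (hist n \<omega>)) x)
      \<in> borel_measurable (fin_traj_space n)" for n x
  proof -
    have "(\<lambda>\<omega>. pmf (if hist n \<omega> \<in> A then drop_mass \<theta> j (\<pi> (hist n \<omega>)) else \<pi> (hist n \<omega>)) x) =
      (\<lambda>\<omega>. if hist n \<omega> \<in> A then (pmf (\<pi> (hist n \<omega>)) x - (if x = j then \<theta> else 0)) / (1 - \<theta>)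
            else pmf (\<pi> (hist n \<omega>)) x)"
      using pmf by auto
    then show ?thesis by simp
  qed
  ultimately show ?thesis using \<pi> by (fastforce simp: strategy_def)
qed

text \<open>
  Let \<open>D\<close> be the set of histories at which \<open>\<pi>\<close> picks \<open>j\<close> with probability at least \<open>\<theta>\<close>.  There
  \<open>\<pi>\<close> is the mixture, with weights \<open>\<theta>\<close> and \<open>1 - \<theta>\<close>, of a strategy \<open>\<pi>\<^sub>1\<close> that is sure to pick \<open>j\<close>
  and of a strategy \<open>\<pi>\<^sub>3\<close>; since \<open>\<pi>\<^sub>3\<close> is not better than \<open>\<pi>\<close>, \<open>\<pi>\<^sub>1\<close> is not worse.  But \<open>\<pi>\<^sub>1\<close> is
  beaten by the strategy \<open>\<pi>\<^sub>2\<close> that follows the tree from \<open>D\<close> on.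
\<close>

lemma (in sandwiched_risk) optimal_avoids_off_tree_arc:
  assumes v: "v \<in> pverts G" and opt: "optimal f T v \<pi>"
    and i: "i \<noteq> d" and j: "(i, j) \<in> parcs G" "j \<notin> sp_tree i"
    and \<theta>: "0 < \<theta>" "\<theta> < 1"
  shows "AE \<omega> in traj v \<pi>. \<not> (cur_node v (hist n \<omega>) = i \<and> T - T\<^sub>f < spent (hist n \<omega>) \<and> \<theta> \<le> pmf (\<pi> (hist n \<omega>)) j)"
proof -
  have \<pi>: "strategy v \<pi>" and has: "has_expected_payoff f T v \<pi>" "\<bar>expected_payoff f T v \<pi>\<bar> \<noteq> \<infinity>"
    and best: "\<And>\<pi>'. strategy v \<pi>' \<Longrightarrow> at_least_as_good f T v \<pi> \<pi>'"
    using opt by (auto simp: optimal_def)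
  define F where "F \<omega> = f (T - enn2real (total_cost \<omega>))" for \<omega> :: "nat \<Rightarrow> 'v move"
  note fin = integrable_of_finite_expected_payoff(1)[OF v \<pi> f_meas Liminf_f has]
  have int: "integrable (traj v \<pi>) F"
    using integrable_of_finite_expected_payoff(2)[OF v \<pi> f_meas Liminf_f has] by (simp add: F_def[abs_def])
  have F_meas: "F \<in> borel_measurable traj_space"
  proof -
    note [measurable] = f_meas measurable_total_cost
    show ?thesis unfolding F_def[abs_def] by measurable
  qed
  have best': "(\<integral>\<omega>. F \<omega> \<partial>traj v \<sigma>) \<le> (\<integral>\<omega>. F \<omega> \<partial>traj v \<pi>)"
    if "strategy v \<sigma>" "AE \<omega> in traj v \<sigma>. total_cost \<omega> \<noteq> \<infinity>" "integrable (traj v \<sigma>) F" for \<sigma>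
    using best[OF that(1)] expected_payoff_eq_integral[OF that(2), of f T]
      expected_payoff_eq_integral[OF fin, of f T] that(3) int
    by (simp add: at_least_as_good_def F_def[abs_def])

  define D where "D = {h. length h = n \<and> cur_node v h = i \<and> T - T\<^sub>f < spent h \<and> \<theta> \<le> pmf (\<pi> h) j}"
  have D_meas: "Measurable.pred (fin_traj_space n) (\<lambda>\<omega>. hist n \<omega> \<in> D)"
  proof -
    note [measurable] = measurable_spent measurable_pmf_strategy[OF \<pi>] measurable_cur_node[OF v]
    have [measurable]: "Measurable.pred (fin_traj_space n) (\<lambda>\<omega>. cur_node v (hist n \<omega>) = i)"
      by (rule measurable_compose[where g = "\<lambda>k. k = i" and N = "count_space (pverts G)"]) measurable
    show ?thesis unfolding D_def by simp measurable
  qed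
  have D_meas': "Measurable.pred (fin_traj_space m) (\<lambda>\<omega>. hist m \<omega> \<in> D)" for m
  proof (cases "m = n")
    case False
    then have "hist m \<omega> \<notin> D" for \<omega> by (simp add: D_def)
    then show ?thesis by simp
  qed (use D_meas in simp)
  have i_verts: "i \<in> pverts G" using in_arcsD1[OF j(1)] .
  define \<tau> where "\<tau> k = (SOME l. l \<in> sp_tree k)" for k
  have \<tau>: "\<tau> k \<in> sp_tree k" if "k \<in> pverts G" "k \<noteq> d" for k
    unfolding \<tau>_def using sp_tree_nonempty[OF that] by (simp add: some_in_eq)
  have \<tau>_succ: "\<tau> k \<in> succs k" if "k \<in> pverts G" "k \<noteq> d" for k
    using \<tau>[OF that] by (simp add: sp_tree_def)
  \<comment> \<open>The comparison strategy has to stay on the tree forever after \<open>D\<close>,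
    so it needs all histories that passed through \<open>D\<close>, not just those in it.\<close>
  define A where "A = {h. n \<le> length h \<and> take n h \<in> D}"
  have A_meas: "Measurable.pred (fin_traj_space m) (\<lambda>\<omega>. hist m \<omega> \<in> A)" for m
    using measurable_hist_prefix[OF D_meas, of m] by (cases "n \<le> m") (simp_all add: A_def take_hist)
  \<comment> \<open>On \<open>D\<close> the current node is \<open>i\<close>, so the choice is
    \<open>j\<close>; testing the node makes the inserted rule a stationary strategy defined at
    every node.\<close>
  define \<pi>\<^sub>1 where "\<pi>\<^sub>1 h = (if h \<in> D then return_pmf (if cur_node v h = i then j else \<tau> (cur_node v h)) else \<pi> h)" for h
  define \<pi>\<^sub>2 where "\<pi>\<^sub>2 h = (if h \<in> A then return_pmf (\<tau> (cur_node v h)) else \<pi> h)" for h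
  define \<pi>\<^sub>3 where "\<pi>\<^sub>3 h = (if h \<in> D then drop_mass \<theta> j (\<pi> h) else \<pi> h)" for h
  have \<pi>1: "strategy v \<pi>\<^sub>1"
    unfolding \<pi>\<^sub>1_def[abs_def]
    using \<tau>_succ j(1)
    by (intro strategy_if \<pi> D_meas' strategy_stationary[where \<tau> = "\<lambda>k. if k = i then j else \<tau> k"] v)
       (auto simp: succs_def)
  have \<pi>2: "strategy v \<pi>\<^sub>2"
    unfolding \<pi>\<^sub>2_def[abs_def] by (intro strategy_if \<pi> A_meas strategy_stationary v \<tau>_succ)
  have \<pi>3: "strategy v \<pi>\<^sub>3"
    unfolding \<pi>\<^sub>3_def[abs_def] using \<theta> by (intro strategy_drop_mass \<pi> D_meas') (auto simp: D_def)
  have D_len: "h \<notin> D" if "length h \<noteq> n" for h using that by (simp add: D_def)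

  \<comment> \<open>The likelihood ratio of move \<open>n\<close> under \<open>\<pi>\<^sub>1\<close>
    against \<pi>, read from the history that ends with this move. On \<open>D\<close> the arc has
    probability at least \<theta>, so the ratio is at most \<open>1 / \<theta>\<close>; this makes
    \<open>w\<^sub>3\<close>, defined by the mixture identity, non-negative.\<close>
  define w\<^sub>1 where "w\<^sub>1 h = (if butlast h \<in> D then if fst (last h) = j then 1 / pmf (\<pi> (butlast h)) j else 0 else 1)"
    for h
  define w\<^sub>3 where "w\<^sub>3 h = (1 - \<theta> * w\<^sub>1 h) / (1 - \<theta>)" for h
  have w1_meas: "(\<lambda>\<omega>. w\<^sub>1 (hist (Suc n) \<omega>)) \<in> borel_measurable (fin_traj_space (Suc n))"
  proof -
    note [measurable] = measurable_hist_prefix[OF D_meas, of "Suc n", simplified]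
      measurable_hist_prefix[OF measurable_pmf_strategy[OF \<pi>], of n "Suc n" j, simplified]
      measurable_move[of n "Suc n"]
    have [measurable]: "Measurable.pred (fin_traj_space (Suc n)) (\<lambda>\<omega>. fst (\<omega> n) = j)"
      by (rule measurable_compose[where g = "\<lambda>k. k = j" and N = "count_space (pverts G)"]) measurable
    have "(\<lambda>\<omega>. w\<^sub>1 (hist (Suc n) \<omega>)) =
        (\<lambda>\<omega>. if hist n \<omega> \<in> D then if fst (\<omega> n) = j then 1 / pmf (\<pi> (hist n \<omega>)) j else 0 else 1)"
      by (auto simp: w\<^sub>1_def hist_Suc fun_eq_iff)
    then show ?thesis by simp
  qed
  have w3_meas: "(\<lambda>\<omega>. w\<^sub>3 (hist (Suc n) \<omega>)) \<in> borel_measurable (fin_traj_space (Suc n))"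
    unfolding w\<^sub>3_def using w1_meas by measurable
  have w1_bounds: "0 \<le> w\<^sub>1 h" "w\<^sub>1 h \<le> 1 / \<theta>" for h
    using \<theta> by (auto simp: w\<^sub>1_def D_def frac_le)
  have "\<theta> * w\<^sub>1 h \<le> 1" for h
    using w1_bounds(2)[of h] \<theta> by (simp add: field_simps)
  then have w3_bounds: "0 \<le> w\<^sub>3 h" "w\<^sub>3 h \<le> 1 / (1 - \<theta>)" for h
    using w1_bounds(1)[of h] \<theta> by (auto simp: w\<^sub>3_def divide_right_mono)
  have mix: "\<theta> * w\<^sub>1 h + (1 - \<theta>) * w\<^sub>3 h = 1" for h
    using \<theta> by (simp add: w\<^sub>3_def)
  have arc1: "pmf (\<pi> h) k * w\<^sub>1 (h @ [(k, c)]) = pmf (\<pi>\<^sub>1 h) k" for h k c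
    using \<theta> by (auto simp: w\<^sub>1_def \<pi>\<^sub>1_def D_def indicator_def)
  have arc3: "pmf (\<pi> h) k * w\<^sub>3 (h @ [(k, c)]) = pmf (\<pi>\<^sub>3 h) k" for h k c
  proof (cases "h \<in> D")
    case True
    then have "pmf (\<pi>\<^sub>3 h) k = (pmf (\<pi> h) k - (if k = j then \<theta> else 0)) / (1 - \<theta>)"
      using \<theta> by (simp add: \<pi>\<^sub>3_def D_def pmf_drop_mass)
    moreover have "pmf (\<pi> h) j \<noteq> 0" using True \<theta> by (auto simp: D_def)
    ultimately show ?thesis using True by (simp add: w\<^sub>3_def w\<^sub>1_def right_diff_distrib)
  qed (use \<theta> in \<open>simp add: w\<^sub>3_def w\<^sub>1_def \<pi>\<^sub>3_def\<close>)
  have w1_dest: "w\<^sub>1 (h @ [(d, 0)]) = 1" if "cur_node v h = d" for h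
    using that i by (simp add: w\<^sub>1_def D_def)
  have P1: "traj v \<pi>\<^sub>1 = density (traj v \<pi>) (\<lambda>\<omega>. ennreal (w\<^sub>1 (hist (Suc n) \<omega>)))"
    using D_len w1_dest
    by (intro traj_tilt[OF v \<pi> \<pi>1 _ w1_meas w1_bounds _ arc1]) (auto simp: \<pi>\<^sub>1_def)
  have P3: "traj v \<pi>\<^sub>3 = density (traj v \<pi>) (\<lambda>\<omega>. ennreal (w\<^sub>3 (hist (Suc n) \<omega>)))"
    using D_len w1_dest \<theta>
    by (intro traj_tilt[OF v \<pi> \<pi>3 _ w3_meas w3_bounds _ arc3]) (auto simp: \<pi>\<^sub>3_def w\<^sub>3_def)

  note meas = measurable_trajI[OF v \<pi>]
  have tilted: "AE \<omega> in traj v \<sigma>. total_cost \<omega> \<noteq> \<infinity>" "integrable (traj v \<sigma>) F"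
    "integrable (traj v \<pi>) (\<lambda>\<omega>. w (hist (Suc n) \<omega>) * F \<omega>)"
    "(\<integral>\<omega>. F \<omega> \<partial>traj v \<sigma>) = (\<integral>\<omega>. w (hist (Suc n) \<omega>) * F \<omega> \<partial>traj v \<pi>)"
    if \<sigma>: "traj v \<sigma> = density (traj v \<pi>) (\<lambda>\<omega>. ennreal (w (hist (Suc n) \<omega>)))"
      and w: "(\<lambda>\<omega>. w (hist (Suc n) \<omega>)) \<in> borel_measurable (fin_traj_space (Suc n))"
      and bounds: "\<And>h. 0 \<le> w h" "\<And>h. w h \<le> C" for \<sigma> w and C :: real
  proof -
    note w' = meas[OF measurable_hist_traj[OF w]]
    show "AE \<omega> in traj v \<sigma>. total_cost \<omega> \<noteq> \<infinity>"
      unfolding \<sigma> using fin w' by (subst AE_density) auto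
    show wF: "integrable (traj v \<pi>) (\<lambda>\<omega>. w (hist (Suc n) \<omega>) * F \<omega>)"
    proof (rule Bochner_Integration.integrable_bound)
      show "integrable (traj v \<pi>) (\<lambda>\<omega>. C * F \<omega>)" using int by simp
      show "(\<lambda>\<omega>. w (hist (Suc n) \<omega>) * F \<omega>) \<in> borel_measurable (traj v \<pi>)"
        using w' meas[OF F_meas] by measurable
      show "AE \<omega> in traj v \<pi>. norm (w (hist (Suc n) \<omega>) * F \<omega>) \<le> norm (C * F \<omega>)"
      proof (rule AE_I2)
        fix \<omega>
        have "\<bar>w (hist (Suc n) \<omega>)\<bar> \<le> \<bar>C\<bar>" using bounds[of "hist (Suc n) \<omega>"] by simp
        then show "norm (w (hist (Suc n) \<omega>) * F \<omega>) \<le> norm (C * F \<omega>)"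
          by (simp add: abs_mult mult_right_mono)
      qed
    qed
    show "integrable (traj v \<sigma>) F"
      unfolding \<sigma> using wF w' meas[OF F_meas] bounds(1) by (subst integrable_density) auto
    show "(\<integral>\<omega>. F \<omega> \<partial>traj v \<sigma>) = (\<integral>\<omega>. w (hist (Suc n) \<omega>) * F \<omega> \<partial>traj v \<pi>)"
      unfolding \<sigma> using w' meas[OF F_meas] bounds(1) by (subst integral_density) auto
  qed
  note t1 = tilted[OF P1 w1_meas w1_bounds] and t3 = tilted[OF P3 w3_meas w3_bounds]
  \<comment> \<open>The value of \<pi> is the weighted mean of the values of its two components; as
    one is not above it, the other is not below it.\<close>
  have "(\<integral>\<omega>. F \<omega> \<partial>traj v \<pi>) =
      (\<integral>\<omega>. \<theta> * (w\<^sub>1 (hist (Suc n) \<omega>) * F \<omega>) + (1 - \<theta>) * (w\<^sub>3 (hist (Suc n) \<omega>) * F \<omega>) \<partial>traj v \<pi>)"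
    by (simp add: mult.assoc[symmetric] distrib_right[symmetric] mix)
  also have "\<dots> = \<theta> * (\<integral>\<omega>. F \<omega> \<partial>traj v \<pi>\<^sub>1) + (1 - \<theta>) * (\<integral>\<omega>. F \<omega> \<partial>traj v \<pi>\<^sub>3)"
    using t1(3) t3(3) by (simp add: t1(4) t3(4))
  also have "\<dots> \<le> \<theta> * (\<integral>\<omega>. F \<omega> \<partial>traj v \<pi>\<^sub>1) + (1 - \<theta>) * (\<integral>\<omega>. F \<omega> \<partial>traj v \<pi>)"
    using best'[OF \<pi>3 t3(1,2)] \<theta> by (intro add_left_mono mult_left_mono) auto
  finally have "\<theta> * (\<integral>\<omega>. F \<omega> \<partial>traj v \<pi>) \<le> \<theta> * (\<integral>\<omega>. F \<omega> \<partial>traj v \<pi>\<^sub>1)"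
    by (simp add: algebra_simps)
  then have ge: "(\<integral>\<omega>. F \<omega> \<partial>traj v \<pi>) \<le> (\<integral>\<omega>. F \<omega> \<partial>traj v \<pi>\<^sub>1)"
    using \<theta> by simp

  let ?slope = "\<lambda>h. a (T - spent h) * indicator D h :: real"
  have off: "cur_node v h \<noteq> d \<and> T - spent h \<le> T\<^sub>f \<and> set_pmf (\<pi>\<^sub>1 h) \<inter> sp_tree (cur_node v h) = {}"
    if "length h = n" "h \<in> D" for h
    using that i j by (auto simp: \<pi>\<^sub>1_def D_def)
  have tree: "set_pmf (\<pi>\<^sub>2 h) \<subseteq> sp_tree (cur_node v h)"
    if "n \<le> length h" "take n h \<in> D" "cur_node v h \<in> pverts G" "cur_node v h \<noteq> d" for h
    using that \<tau> by (simp add: \<pi>\<^sub>2_def A_def)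
  have agree: "\<pi>\<^sub>1 h = \<pi>\<^sub>2 h" if "length h < n \<or> take n h \<notin> D" for h
    using that by (auto simp: \<pi>\<^sub>1_def \<pi>\<^sub>2_def A_def D_def)
  note beat = tree_beats_detour[OF v \<pi>1 \<pi>2 D_meas off tree agree t1(1) t1(2)[unfolded F_def]]
  have "(\<integral>\<omega>. F \<omega> \<partial>traj v \<pi>\<^sub>2) \<le> (\<integral>\<omega>. F \<omega> \<partial>traj v \<pi>)"
    using best'[OF \<pi>2] beat(1,2) by (simp add: F_def[abs_def])
  with beat(4) ge have "(\<epsilon> - \<eta> * K) * (\<integral>\<omega>. ?slope (hist n \<omega>) \<partial>traj v \<pi>\<^sub>1) \<le> 0"
    by (simp add: F_def)
  then have le0: "(\<integral>\<omega>. ?slope (hist n \<omega>) \<partial>traj v \<pi>\<^sub>1) \<le> 0"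
    using \<epsilon> by (simp add: mult_le_0_iff)
  have slope_nonneg: "0 \<le> ?slope h" for h
    using a_pos[of "T - spent h"] by (auto simp: D_def indicator_def)
  have slope_meas: "(\<lambda>\<omega>. ?slope (hist n \<omega>)) \<in> borel_measurable (fin_traj_space n)"
  proof -
    note [measurable] = a_meas measurable_spent
    have [measurable]: "(\<lambda>\<omega>. indicator D (hist n \<omega>) :: real) \<in> borel_measurable (fin_traj_space n)"
      unfolding indicator_def using D_meas by measurable
    show ?thesis by measurable
  qed
  \<comment> \<open>Membership in \<open>D\<close> is decided by the first \<open>n\<close> moves,
    which have the same law under \<pi> and \<open>\<pi>\<^sub>1\<close>. So the slope has integral
    0 under \<pi> as well, and being positive on \<open>D\<close>, it makes \<open>D\<close> a null
    event.\<close>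
  have agree': "\<pi> h = \<pi>\<^sub>1 h" if "length h < n" for h
    using that by (simp add: \<pi>\<^sub>1_def D_def)
  have "integrable (traj v \<pi>) (\<lambda>\<omega>. ?slope (hist n \<omega>))" "(\<integral>\<omega>. ?slope (hist n \<omega>) \<partial>traj v \<pi>) \<le> 0"
    using integral_hist_agree[OF v \<pi> \<pi>1 agree' slope_meas] beat(3) le0 by simp_all
  moreover have "0 \<le> (\<integral>\<omega>. ?slope (hist n \<omega>) \<partial>traj v \<pi>)"
    using slope_nonneg by (intro integral_nonneg_AE AE_I2)
  ultimately have "AE \<omega> in traj v \<pi>. ?slope (hist n \<omega>) = 0"
    using integral_nonneg_eq_0_iff_AE[of "traj v \<pi>" "\<lambda>\<omega>. ?slope (hist n \<omega>)"] slope_nonneg by simp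
  then show ?thesis
  proof eventually_elim
    case (elim \<omega>)
    then show ?case
      using a_pos[of "T - spent (hist n \<omega>)"] by (auto simp: D_def indicator_def split: if_splits)
  qed
qed

text \<open>A union of countably many null events, over the times, the arcs off the tree and a
  sequence of thresholds that tends to 0.\<close>

lemma (in sandwiched_risk) optimal_follows_tree:
  assumes v: "v \<in> pverts G" and opt: "optimal f T v \<pi>"
  shows "AE \<omega> in traj v \<pi>. \<forall>n. cur_node v (hist n \<omega>) \<noteq> d \<and> T - T\<^sub>f < spent (hist n \<omega>) \<longrightarrow>
    follows_tree_at v \<pi> (hist n \<omega>)"
proof -
  have \<pi>: "strategy v \<pi>" using opt by (simp add: optimal_def)
  let ?X = "{(i, j) \<in> parcs G. i \<noteq> d \<and> j \<notin> sp_tree i}"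
  have "countable ?X"
    by (rule countable_finite, rule finite_subset[OF _ pair_finite_arcs]) auto
  moreover have "AE \<omega> in traj v \<pi>. \<not> (cur_node v (hist n \<omega>) = fst e \<and> T - T\<^sub>f < spent (hist n \<omega>) \<and>
      inverse (real (Suc (Suc k))) \<le> pmf (\<pi> (hist n \<omega>)) (snd e))" if "e \<in> ?X" for e n k
  proof -
    \<comment> \<open>The thresholds start at 1/2 because \<theta> has to be strictly below
      1.\<close>
    have "inverse (real (Suc (Suc k))) < 1" by (rule inverse_less_1_iff[THEN iffD2]) simp
    then show ?thesis
      using that by (intro optimal_avoids_off_tree_arc v opt) auto
  qed
  ultimately have "AE \<omega> in traj v \<pi>. \<forall>n k. \<forall>e\<in>?X. \<not> (cur_node v (hist n \<omega>) = fst e \<and>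
      T - T\<^sub>f < spent (hist n \<omega>) \<and> inverse (real (Suc (Suc k))) \<le> pmf (\<pi> (hist n \<omega>)) (snd e))"
    by (simp only: AE_all_countable AE_ball_countable) blast
  then show ?thesis
    using AE_space
  proof eventually_elim
    case (elim \<omega>)
    show ?case
    proof (intro allI impI)
      fix n assume n: "cur_node v (hist n \<omega>) \<noteq> d \<and> T - T\<^sub>f < spent (hist n \<omega>)"
      let ?h = "hist n \<omega>"
      have cur: "cur_node v ?h \<in> pverts G"
        using cur_node_in_verts[OF v] elim(2) by (simp add: space_traj[OF v \<pi>])
      show "follows_tree_at v \<pi> ?h"
        unfolding follows_tree_at_def
      proof (rule subsetI, rule ccontr)
        fix j assume j: "j \<in> set_pmf (\<pi> ?h)" "j \<notin> sp_tree (cur_node v ?h)"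
        then obtain k where k: "inverse (real (Suc k)) < pmf (\<pi> ?h) j"
          using reals_Archimedean pmf_positive by metis
        have "inverse (real (Suc (Suc k))) \<le> inverse (real (Suc k))" by simp
        then have k': "inverse (real (Suc (Suc k))) \<le> pmf (\<pi> ?h) j" using k by linarith
        have "(cur_node v ?h, j) \<in> ?X"
          using j n strategy_supp[OF \<pi> cur] by (auto simp: succs_def)
        from elim(1)[rule_format, OF this, of n k] show False using n k' by simp
      qed
    qed
  qed
qed

lemma (in adaptive_ssp) exists_sandwich:
  fixes f :: "real \<Rightarrow> real"
  assumes f_meas: "f \<in> borel_measurable borel"
    and risk: "(mono_on {..<T\<^sub>1} f \<and> concave_on {..<T\<^sub>1} f \<and>
          (\<exists>f' f''.
             (\<forall>t<T\<^sub>1. (f has_real_derivative f' t) (at t)) \<and>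
             (\<forall>t<T\<^sub>1. (f' has_real_derivative f'' t) (at t)) \<and>
             continuous_on {..<T\<^sub>1} f'' \<and>
             (\<forall>\<^sub>F t in at_bot. f' t \<noteq> 0) \<and>
             ((\<lambda>t. f'' t / f' t) \<longlongrightarrow> 0) at_bot))
       \<or> (\<exists>f' L.
             (\<forall>t<T\<^sub>1. (f has_real_derivative f' t) (at t)) \<and>
             continuous_on {..<T\<^sub>1} f' \<and>
             (f' \<longlongrightarrow> L) at_bot \<and> 0 < L)"
  shows "\<exists>a T\<^sub>f B \<eta> \<epsilon> K. sandwiched_risk G s d p \<delta>_inf \<delta>_sup f a T\<^sub>f B \<eta> \<epsilon> K"
proof -
  obtain \<epsilon> where \<epsilon>: "0 < \<epsilon>"
    "\<And>i j. (i, j) \<in> parcs G \<Longrightarrow> j \<notin> sp_tree i \<Longrightarrow> dist_dest i + \<epsilon> \<le> mean_cost (i, j) + dist_dest j"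
    using off_tree_gap by metis
  obtain K where K: "0 \<le> K" "\<And>i. i \<in> pverts G \<Longrightarrow> dist_dest i \<le> K"
    using uniform_bounds by metis
  obtain B where B: "0 \<le> B"
    "\<And>v \<pi> \<omega> n. v \<in> pverts G \<Longrightarrow> \<omega> \<in> space traj_space \<Longrightarrow> (\<And>k. legal_move v \<pi> (hist k \<omega>) (\<omega> k)) \<Longrightarrow>
      (\<And>k. n \<le> k \<Longrightarrow> cur_node v (hist k \<omega>) \<noteq> d \<Longrightarrow> set_pmf (\<pi> (hist k \<omega>)) \<subseteq> sp_tree (cur_node v (hist k \<omega>))) \<Longrightarrow>
      rest_cost n \<omega> \<le> ennreal B"
    using rest_cost_tree_bounded by blast
  \<comment> \<open>\<epsilon>, \<open>K\<close> and \<open>B\<close> come from the network alone,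
    so the tolerance can be fixed before the threshold on the budget; \<open>K + 1\<close> keeps the
    denominator positive when all distances are 0.\<close>
  define \<eta> where "\<eta> = \<epsilon> / (2 * (K + 1))"
  have \<eta>: "0 < \<eta>" "\<eta> * K < \<epsilon>"
    using \<epsilon>(1) K(1) by (auto simp: \<eta>_def field_simps add_nonneg_pos)
  have sandwich: "sandwiched_risk G s d p \<delta>_inf \<delta>_sup f a T\<^sub>f B \<eta> \<epsilon> K"
    if "a \<in> borel_measurable borel" "\<And>t. t \<le> T\<^sub>f \<Longrightarrow> 0 < a t"
      "\<And>t x. t \<le> T\<^sub>f \<Longrightarrow> 0 \<le> x \<Longrightarrow> f (t - x) \<le> f t - a t * x"
      "\<And>t x. t \<le> T\<^sub>f \<Longrightarrow> 0 \<le> x \<Longrightarrow> x \<le> B \<Longrightarrow> f t - (1 + \<eta>) * a t * x \<le> f (t - x)" for a T\<^sub>f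
    by (intro sandwiched_risk.intro[OF adaptive_ssp_axioms] sandwiched_risk_axioms.intro)
       (fact f_meas that B \<epsilon>(2) K \<eta>(2) less_imp_le[OF \<eta>(1)])+
  from risk show ?thesis
  proof (elim disjE conjE exE)
    fix f' f''
    assume m: "mono_on {..<T\<^sub>1} f" "concave_on {..<T\<^sub>1} f"
      and d1: "\<forall>t<T\<^sub>1. (f has_real_derivative f' t) (at t)"
      and d2: "\<forall>t<T\<^sub>1. (f' has_real_derivative f'' t) (at t)"
      and l: "\<forall>\<^sub>F t in at_bot. f' t \<noteq> 0" "((\<lambda>t. f'' t / f' t) \<longlongrightarrow> 0) at_bot"
    obtain T\<^sub>0 where T0: "T\<^sub>0 < T\<^sub>1" "\<And>t. t \<le> T\<^sub>0 \<Longrightarrow> 0 < f' t"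
      "\<And>t x. t \<le> T\<^sub>0 \<Longrightarrow> 0 \<le> x \<Longrightarrow> f (t - x) \<le> f t - f' t * x"
      "\<And>t x. t \<le> T\<^sub>0 \<Longrightarrow> 0 \<le> x \<Longrightarrow> x \<le> B \<Longrightarrow> f t - (1 + \<eta>) * f' t * x \<le> f (t - x)"
    proof (rule linear_sandwich_of_concave[OF m _ _ l \<eta>(1) B(1)])
      show "(f has_real_derivative f' t) (at t)" if "t < T\<^sub>1" for t using d1 that by blast
      show "(f' has_real_derivative f'' t) (at t)" if "t < T\<^sub>1" for t using d2 that by blast
    qed (rule that)
    \<comment> \<open>Nothing is known about \<open>f'\<close> above \<open>T\<^sub>1\<close>, so
      the slope is set to 0 beyond \<open>T\<^sub>0\<close> to obtain a measurable function on the
      whole line.\<close>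
    have "continuous_on {..T\<^sub>0} f'"
      by (intro continuous_at_imp_continuous_on ballI DERIV_isCont[OF d2[rule_format]]) (use T0(1) in auto)
    then have "(\<lambda>t. if t \<in> {..T\<^sub>0} then f' t else 0) \<in> borel_measurable borel"
      by (intro borel_measurable_continuous_on_if) auto
    with T0 have "sandwiched_risk G s d p \<delta>_inf \<delta>_sup f (\<lambda>t. if t \<in> {..T\<^sub>0} then f' t else 0) T\<^sub>0 B \<eta> \<epsilon> K"
      by (intro sandwich) auto
    then show ?thesis by blast
  next
    fix f' L
    assume d1: "\<forall>t<T\<^sub>1. (f has_real_derivative f' t) (at t)" and l: "(f' \<longlongrightarrow> L) at_bot" "0 < L"
    obtain T\<^sub>0 a where "0 < a"
      "\<And>t x. t \<le> T\<^sub>0 \<Longrightarrow> 0 \<le> x \<Longrightarrow> f (t - x) \<le> f t - a * x"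
      "\<And>t x. t \<le> T\<^sub>0 \<Longrightarrow> 0 \<le> x \<Longrightarrow> f t - (1 + \<eta>) * a * x \<le> f (t - x)"
      using linear_sandwich_of_convergent_deriv[OF _ l \<eta>(1)] d1 by metis
    then have "sandwiched_risk G s d p \<delta>_inf \<delta>_sup f (\<lambda>_. a) T\<^sub>0 B \<eta> \<epsilon> K"
      by (intro sandwich) auto
    then show ?thesis by blast
  qed
qed

lemma (in adaptive_ssp) history_cur_node:
  assumes "v \<in> pverts G" "history v h"
  shows "cur_node v h \<in> pverts G"
proof (cases "h = []")
  case False
  then have "(cur_node v (take (length h - 1) h), fst (h ! (length h - 1))) \<in> parcs G"
    using assms(2) by (simp add: history_def Let_def)
  then show ?thesis using False in_arcsD2 by (simp add: cur_node_def last_conv_nth)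
qed (use assms in simp)

text \<open>After \<open>h\<close> the remaining problem starts with a budget below
  \<open>T\<^sub>f\<close>, so its empty history is already past the threshold. What holds almost
  surely there does not depend on the trajectory, hence it holds outright, even if \<open>h\<close>
  itself has probability 0.\<close>

lemma (in sandwiched_risk) follows_tree_of_optimal_continuation:
  assumes v: "v \<in> pverts G" and h: "history v h" "cur_node v h \<noteq> d" "T - T\<^sub>f < spent h"
    and opt: "optimal f (T - spent h) (cur_node v h) (continuation \<pi> h)"
  shows "follows_tree_at v \<pi> h"
proof -
  note cur = history_cur_node[OF v h(1)]
  have "strategy (cur_node v h) (continuation \<pi> h)" using opt by (simp add: optimal_def)
  then interpret prob_space "traj (cur_node v h) (continuation \<pi> h)"
    by (rule prob_space_traj[OF cur])
  have "AE \<omega> in traj (cur_node v h) (continuation \<pi> h).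
      follows_tree_at (cur_node v h) (continuation \<pi> h) []"
    using optimal_follows_tree[OF cur opt]
  proof eventually_elim
    case (elim \<omega>)
    from spec[OF this, of 0] show ?case using h by (simp add: spent_def)
  qed
  then show ?thesis by (simp add: follows_tree_at_def continuation_def)
qed

text \<open>With a budget below \<open>T\<^sub>f\<close> every payoff is 0, so all strategies
  tie.\<close>

lemma (in adaptive_ssp) optimal_below_support:
  assumes f0: "\<And>t. t < T\<^sub>f \<Longrightarrow> f t = 0" and "T < T\<^sub>f" and \<sigma>: "strategy v \<sigma>"
  shows "optimal f T v \<sigma>"
proof (rule optimal_of_payoff_eq_0[OF \<sigma>])
  show "payoff f T \<omega> = 0" for \<omega> :: "nat \<Rightarrow> 'v move"
    by (rule payoff_eq_0[where x = 0, OF f0]) (use assms(2) in auto)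
qed

lemma (in adaptive_ssp) at_least_as_good_of_agree:
  assumes f0: "\<And>t. t < T\<^sub>f \<Longrightarrow> f t = 0" and f_meas: "f \<in> borel_measurable borel"
    and v: "v \<in> pverts G" and \<pi>: "strategy v \<pi>" "strategy v \<pi>'"
    and agree: "\<And>h. history v h \<Longrightarrow> cur_node v h \<noteq> d \<Longrightarrow> spent h \<le> T - T\<^sub>f \<Longrightarrow> \<pi> h = \<pi>' h"
  shows "at_least_as_good f T v \<pi>' \<pi>"
  using payoff_parts_agree[OF v \<pi> f0 f_meas agree]
  by (simp add: at_least_as_good_def has_expected_payoff_def expected_payoff_def)

text \<open>Optimality from the source does not constrain choices at histories of probability 0. The
  property is therefore given along almost every trajectory, and pointwise at each history from
  which the continuation is itself optimal.\<close>

lemma (in adaptive_ssp) eventually_tree_optimal: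
  fixes f :: "real \<Rightarrow> real"
  assumes f_meas: "f \<in> borel_measurable borel"
    and risk: "(mono_on {..<T\<^sub>1} f \<and> concave_on {..<T\<^sub>1} f \<and>
          (\<exists>f' f''.
             (\<forall>t<T\<^sub>1. (f has_real_derivative f' t) (at t)) \<and>
             (\<forall>t<T\<^sub>1. (f' has_real_derivative f'' t) (at t)) \<and>
             continuous_on {..<T\<^sub>1} f'' \<and>
             (\<forall>\<^sub>F t in at_bot. f' t \<noteq> 0) \<and>
             ((\<lambda>t. f'' t / f' t) \<longlongrightarrow> 0) at_bot))
       \<or> (\<exists>f' L.
             (\<forall>t<T\<^sub>1. (f has_real_derivative f' t) (at t)) \<and>
             continuous_on {..<T\<^sub>1} f' \<and>
             (f' \<longlongrightarrow> L) at_bot \<and> 0 < L)"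
  shows "\<exists>T\<^sub>f::real. \<forall>T\<ge>0. \<forall>\<pi>. strategy s \<pi> \<longrightarrow>
             (optimal f T s \<pi> \<longrightarrow>
                (AE \<omega> in traj s \<pi>. \<forall>n.
                   cur_node s (hist n \<omega>) \<noteq> d \<and> spent (hist n \<omega>) > T - T\<^sub>f \<longrightarrow>
                   follows_tree_at s \<pi> (hist n \<omega>)))
           \<and> (\<forall>h. history s h \<and> cur_node s h \<noteq> d \<and> spent h > T - T\<^sub>f \<and>
                   optimal f (T - spent h) (cur_node s h) (continuation \<pi> h) \<longrightarrow>
                   follows_tree_at s \<pi> h)"
proof -
  obtain a T\<^sub>f B \<eta> \<epsilon> K where "sandwiched_risk G s d p \<delta>_inf \<delta>_sup f a T\<^sub>f B \<eta> \<epsilon> K"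
    using exists_sandwich[OF f_meas risk] by blast
  then interpret sandwiched_risk G s d p \<delta>_inf \<delta>_sup f a T\<^sub>f B \<eta> \<epsilon> K .
  show ?thesis
    using optimal_follows_tree[OF source_in_verts] follows_tree_of_optimal_continuation[OF source_in_verts]
    by (intro exI[of _ T\<^sub>f]) blast
qed

text \<open>Optimality of the tree is meant in two ways: for the problem that remains after a
  history, and as a change of strategy past the threshold that does not lower the value of the
  original problem.\<close>

lemma (in adaptive_ssp) tree_optimal_below_support:
  fixes f :: "real \<Rightarrow> real"
  assumes f_meas: "f \<in> borel_measurable borel" and supp: "closure {t. f t \<noteq> 0} \<subseteq> {T\<^sub>f..}"
  shows "(\<forall>h \<sigma>. history s h \<and> cur_node s h \<noteq> d \<and> spent h > T - T\<^sub>f \<and>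
             strategy (cur_node s h) \<sigma> \<and>
             (\<forall>h'. history (cur_node s h) h' \<and> cur_node (cur_node s h) h' \<noteq> d \<longrightarrow>
                   follows_tree_at (cur_node s h) \<sigma> h') \<longrightarrow>
             optimal f (T - spent h) (cur_node s h) \<sigma>)
       \<and> (\<forall>\<pi> \<pi>'. strategy s \<pi> \<and> strategy s \<pi>' \<and>
             (\<forall>h. history s h \<and> cur_node s h \<noteq> d \<longrightarrow>
                (if spent h > T - T\<^sub>f then follows_tree_at s \<pi>' h else \<pi>' h = \<pi> h)) \<longrightarrow>
             at_least_as_good f T s \<pi>' \<pi>)"
proof (intro conjI allI impI; elim conjE)
  have f0: "f t = 0" if "t < T\<^sub>f" for t
    using that supp closure_subset[of "{t. f t \<noteq> 0}"] by force
  show "optimal f (T - spent h) (cur_node s h) \<sigma>"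
    if "spent h > T - T\<^sub>f" "strategy (cur_node s h) \<sigma>" for h \<sigma>
    by (rule optimal_below_support[OF f0]) (use that in auto)
  show "at_least_as_good f T s \<pi>' \<pi>"
    if \<pi>: "strategy s \<pi>" "strategy s \<pi>'"
      and *: "\<forall>h. history s h \<and> cur_node s h \<noteq> d \<longrightarrow>
        (if spent h > T - T\<^sub>f then follows_tree_at s \<pi>' h else \<pi>' h = \<pi> h)" for \<pi> \<pi>'
  proof (rule at_least_as_good_of_agree[OF f0 f_meas source_in_verts \<pi>])
    show "\<pi> h = \<pi>' h" if "history s h" "cur_node s h \<noteq> d" "spent h \<le> T - T\<^sub>f" for h
      using *[rule_format, of h] that by (simp split: if_splits)
  qed
qed

theorem theorem1:
  fixes G :: "'v pair_pre_digraph" and s d :: 'v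
    and p :: "'v \<times> 'v \<Rightarrow> real measure"
    and \<delta>_inf \<delta>_sup :: "'v \<times> 'v \<Rightarrow> real"
    and f :: "real \<Rightarrow> real"
  assumes ssp: "adaptive_ssp G s d p \<delta>_inf \<delta>_sup"
    and f_meas: "f \<in> borel_measurable borel"
  shows
    "((\<exists>T\<^sub>1.
         (mono_on {..<T\<^sub>1} f \<and> concave_on {..<T\<^sub>1} f \<and>
          (\<exists>f' f''.
             (\<forall>t<T\<^sub>1. (f has_real_derivative f' t) (at t)) \<and>
             (\<forall>t<T\<^sub>1. (f' has_real_derivative f'' t) (at t)) \<and>
             continuous_on {..<T\<^sub>1} f'' \<and>
             (\<forall>\<^sub>F t in at_bot. f' t \<noteq> 0) \<and>
             ((\<lambda>t. f'' t / f' t) \<longlongrightarrow> 0) at_bot))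
       \<or> (\<exists>f' L.
             (\<forall>t<T\<^sub>1. (f has_real_derivative f' t) (at t)) \<and>
             continuous_on {..<T\<^sub>1} f' \<and>
             (f' \<longlongrightarrow> L) at_bot \<and> 0 < L))
      \<longrightarrow> (\<exists>T\<^sub>f::real. \<forall>T\<ge>0. \<forall>\<pi>. adaptive_ssp.strategy G d s \<pi> \<longrightarrow>
             (adaptive_ssp.optimal G d p f T s \<pi> \<longrightarrow>
                (AE \<omega> in adaptive_ssp.traj G d p s \<pi>. \<forall>n.
                   cur_node s (hist n \<omega>) \<noteq> d \<and> spent (hist n \<omega>) > T - T\<^sub>f \<longrightarrow>
                   adaptive_ssp.follows_tree_at G d p s \<pi> (hist n \<omega>)))
           \<and> (\<forall>h. adaptive_ssp.history G d \<delta>_inf \<delta>_sup s h \<and>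
                   cur_node s h \<noteq> d \<and> spent h > T - T\<^sub>f \<and>
                   adaptive_ssp.optimal G d p f (T - spent h) (cur_node s h) (continuation \<pi> h) \<longrightarrow>
                   adaptive_ssp.follows_tree_at G d p s \<pi> h)))
     \<and>
     (\<forall>T\<^sub>f T. closure {t. f t \<noteq> 0} \<subseteq> {T\<^sub>f..} \<longrightarrow>
         (\<forall>h \<sigma>. adaptive_ssp.history G d \<delta>_inf \<delta>_sup s h \<and>
             cur_node s h \<noteq> d \<and> spent h > T - T\<^sub>f \<and>
             adaptive_ssp.strategy G d (cur_node s h) \<sigma> \<and>
             (\<forall>h'. adaptive_ssp.history G d \<delta>_inf \<delta>_sup (cur_node s h) h' \<and>
                   cur_node (cur_node s h) h' \<noteq> d \<longrightarrow>
                   adaptive_ssp.follows_tree_at G d p (cur_node s h) \<sigma> h') \<longrightarrow>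
             adaptive_ssp.optimal G d p f (T - spent h) (cur_node s h) \<sigma>)
       \<and> (\<forall>\<pi> \<pi>'. adaptive_ssp.strategy G d s \<pi> \<and> adaptive_ssp.strategy G d s \<pi>' \<and>
             (\<forall>h. adaptive_ssp.history G d \<delta>_inf \<delta>_sup s h \<and> cur_node s h \<noteq> d \<longrightarrow>
                (if spent h > T - T\<^sub>f then adaptive_ssp.follows_tree_at G d p s \<pi>' h
                 else \<pi>' h = \<pi> h)) \<longrightarrow>
             adaptive_ssp.at_least_as_good G d p f T s \<pi>' \<pi>))"
  using adaptive_ssp.eventually_tree_optimal[OF ssp f_meas] adaptive_ssp.tree_optimal_below_support[OF ssp f_meas]
  by blast

end
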